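(* Let $2<p\le\infty$ and let $B_1^c=\mathbb{R}^2\setminus B_1$. Let $u$ be a real-valued solution of $$\Delta u-W\cdot\nabla u=0\quad\text{in } B_1^c,$$ where $W=(W_1,W_2)$ is a real vector-valued function satisfying $\|W\|_{L^p(B_1^c)}\le 1$. Assume moreover that $\|\nabla u\|_{L^\infty(B_1^c)}\le 1$ and that there exists $C_0'>0$ such that $$\inf_{|z_0|=3}|\nabla u(z_0)|\ge C_0' .$$ Then there exist positive constants $C_1'$ and $C_2'$ depending on $p$ and $C_0'$ such that $$\inf_{|z_0|=R}\ \sup_{|z-z_0|<1}|u(z)|\ge C_2'\exp\left(-C_1'R\log^2R\right)$$ for all sufficiently large $R$.
   Context: $B_1=\{x\in\mathbb{R}^2:|x|<1\}$ is the open unit ball. $\log^2 R$ means $(\log R)^2$. Pointwise values of $\nabla u$ are those of the continuous representative: under the hypotheses $W\in L^p$ with $p>2$ and $\nabla u\in L^\infty$, $u$ is $C^1$ in the exterior domain. *)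

theory Defs
  imports "HOL-Analysis.Analysis" "HOL-Probability.Essential_Supremum"
begin

definition Lp_norm :: "ereal \<Rightarrow> 'a measure \<Rightarrow> ('a \<Rightarrow> 'b::real_normed_vector) \<Rightarrow> ereal" where
  "Lp_norm p M f =
     (if p = \<infinity> then esssup M (\<lambda>x. ereal (norm (f x)))
      else let I = (\<integral>\<^sup>+ x. ennreal (norm (f x) powr real_of_ereal p) \<partial>M)
           in if I = \<infinity> then \<infinity> else ereal (enn2real I powr (1 / real_of_ereal p)))"

definition locally_integrable ::
  "'a::euclidean_space set \<Rightarrow> ('a \<Rightarrow> 'b::euclidean_space) \<Rightarrow> bool" where
  "locally_integrable \<Omega> f \<longleftrightarrow> (\<forall>K. compact K \<and> K \<subseteq> \<Omega> \<longrightarrow> f absolutely_integrable_on K)"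

text \<open>Test functions are \<open>C\<^sup>1\<close> with compact support in \<open>\<Omega>\<close> (extended by zero); the second
  argument is the gradient. As in Gilbarg and Trudinger, weak derivatives and weak solutions of
  second-order equations are defined by testing with this class; by mollification, testing with
  smooth compactly supported functions gives the same notions.\<close>

definition test_function ::
  "'a::euclidean_space set \<Rightarrow> ('a \<Rightarrow> real) \<Rightarrow> ('a \<Rightarrow> 'a) \<Rightarrow> bool" where
  "test_function \<Omega> \<phi> D\<phi> \<longleftrightarrow>
     (\<forall>x. GDERIV \<phi> x :> D\<phi> x) \<and> continuous_on UNIV D\<phi> \<and>
     (\<exists>K. compact K \<and> K \<subseteq> \<Omega> \<and> (\<forall>x. x \<notin> K \<longrightarrow> \<phi> x = 0))"

definition weak_gradient ::
  "'a::euclidean_space set \<Rightarrow> ('a \<Rightarrow> real) \<Rightarrow> ('a \<Rightarrow> 'a) \<Rightarrow> bool" where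
  "weak_gradient \<Omega> u Du \<longleftrightarrow>
     locally_integrable \<Omega> u \<and> locally_integrable \<Omega> Du \<and>
     (\<forall>\<phi> D\<phi>. test_function \<Omega> \<phi> D\<phi> \<longrightarrow>
        (\<integral>x. u x *\<^sub>R D\<phi> x \<partial>lebesgue_on \<Omega>) = - (\<integral>x. \<phi> x *\<^sub>R Du x \<partial>lebesgue_on \<Omega>))"

text \<open>Weak form of \<open>\<Delta>u - W \<bullet> \<nabla>u = 0\<close> in the open set \<open>\<Omega>\<close>, where \<open>Du\<close> represents \<open>\<nabla>u\<close>.\<close>

definition weak_drift_solution ::
  "'a::euclidean_space set \<Rightarrow> ('a \<Rightarrow> 'a) \<Rightarrow> ('a \<Rightarrow> real) \<Rightarrow> ('a \<Rightarrow> 'a) \<Rightarrow> bool" where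
  "weak_drift_solution \<Omega> W u Du \<longleftrightarrow>
     weak_gradient \<Omega> u Du \<and> locally_integrable \<Omega> (\<lambda>x. W x \<bullet> Du x) \<and>
     (\<forall>\<phi> D\<phi>. test_function \<Omega> \<phi> D\<phi> \<longrightarrow>
        (\<integral>x. Du x \<bullet> D\<phi> x + (W x \<bullet> Du x) * \<phi> x \<partial>lebesgue_on \<Omega>) = 0)"

end

theory Submission
  imports Defs "HOL-Complex_Analysis.Complex_Analysis"
begin

text \<open>
  With \<open>f = u\<^sub>x - i u\<^sub>y\<close> the equation becomes the first order system \<open>\<partial>f/\<partial>zbar = a f\<close> with
  \<open>|a| \<le> |W|/2\<close>. On \<open>1 < |z| < 20 R\<close> the Cauchy potential \<open>w\<close> of \<open>a\<close> satisfies \<open>|w| \<le> C R\<close>: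
  the part of \<open>a\<close> of modulus at most \<open>1\<close> contributes \<open>O(R)\<close> and, by Young's inequality, the rest
  contributes \<open>O(1)\<close> because \<open>p > 2\<close>. Hence \<open>f = e\<^sup>w h\<close> with \<open>h\<close> holomorphic. The harmonic measure
  of the disc \<open>|z - z0| < 1/2\<close>, \<open>|z0| = R\<close>, seen from distance \<open>3\<close> in the annulus
  \<open>3/2 < |z| < 10 R\<close> is at least of order \<open>1/log\<^sup>2 R\<close>, so the lower bound for \<open>|f|\<close> at distance \<open>3\<close>
  forces \<open>|h| \<ge> exp (- C R log\<^sup>2 R)\<close> somewhere on \<open>|z - z0| = 1/2\<close>. A mean value of \<open>h\<close>, with \<open>w\<close>
  regularised at a scale that is a power of \<open>sup |u|\<close>, integrates by parts onto \<open>u\<close> and bounds \<open>h\<close>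
  by a power of \<open>sup |u|\<close> times \<open>e\<^bsup>CR\<^esup>\<close>.
\<close>

section \<open>Convolution with continuously differentiable kernels\<close>

text \<open>Since \<open>a\<close> is only p-integrable, w has a modulus of continuity but no
  pointwise gradient bound, while moving a derivative from u onto a test function containing exp
  (-w) asks for one. The regularisation of w at scale e has gradient O(e^-2) and differs from w by
  O(e^\<delta>), up to powers of R, where \<delta> > 0 comes from p > 2. If |u| \<le> M < 1, the
  errors e^\<delta> and M e^-2 are both at most M^(\<delta>/3) for e = M^(1/3). The loss of the
  exponent \<delta>/3 only enlarges the constant in front of R log^2 R, so crude sup bounds replace
  singular integral estimates. Inside the disc of radius e the Cauchy kernel is replaced by an
  explicit polynomial whose dbar derivative is a polynomial bump. This one family of kernels yields
  Weyl's lemma, the similarity principle and the final bound. Of the two logarithms, one is the size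
  of log |G| on |z - z0| = 1/2; the other is N, by which the Green's function is multiplied so that
  the comparison function is nonpositive on the outer circle.\<close>

definition C1_partials ::
  "(complex \<Rightarrow> complex) \<Rightarrow> (complex \<Rightarrow> complex) \<Rightarrow> (complex \<Rightarrow> complex) \<Rightarrow> bool" where
  "C1_partials \<phi> \<phi>x \<phi>y \<longleftrightarrow>
     (\<forall>z. (\<phi> has_derivative (\<lambda>h. Re h *\<^sub>R \<phi>x z + Im h *\<^sub>R \<phi>y z)) (at z)) \<and>
     continuous_on UNIV \<phi>x \<and> continuous_on UNIV \<phi>y"

text \<open>The first factor need only be integrable; the second carries the regularity, and
  derivatives fall on it.\<close>

definition conv :: "(complex \<Rightarrow> complex) \<Rightarrow> (complex \<Rightarrow> complex) \<Rightarrow> complex \<Rightarrow> complex" where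
  "conv a k z = (LBINT v. a v * k (z - v))"

lemma C1_partialsD:
  assumes "C1_partials \<phi> \<phi>x \<phi>y"
  shows "(\<phi> has_derivative (\<lambda>h. Re h *\<^sub>R \<phi>x z + Im h *\<^sub>R \<phi>y z)) (at z)"
    "continuous_on UNIV \<phi>x" "continuous_on UNIV \<phi>y" "continuous_on UNIV \<phi>"
  using assms unfolding C1_partials_def
  by (auto intro: has_derivative_continuous_on has_derivative_at_withinI)

text \<open>Lets a convolution be differentiated on either factor: the two resulting expressions for
  its partials must agree.\<close>

lemma C1_partials_unique:
  assumes "C1_partials \<phi> \<phi>x \<phi>y" "C1_partials \<phi> \<psi>x \<psi>y"
  shows "\<phi>x = \<psi>x" "\<phi>y = \<psi>y"
proof -
  have eq: "(\<lambda>h. Re h *\<^sub>R \<phi>x z + Im h *\<^sub>R \<phi>y z) = (\<lambda>h. Re h *\<^sub>R \<psi>x z + Im h *\<^sub>R \<psi>y z)" for z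
    using has_derivative_unique C1_partialsD(1)[OF assms(1)] C1_partialsD(1)[OF assms(2)] by blast
  show "\<phi>x = \<psi>x"
  proof
    fix z show "\<phi>x z = \<psi>x z" using fun_cong[OF eq[of z], of 1] by simp
  qed
  show "\<phi>y = \<psi>y"
  proof
    fix z show "\<phi>y z = \<psi>y z" using fun_cong[OF eq[of z], of \<i>] by simp
  qed
qed

lemma C1_partials_lipschitz:
  assumes "C1_partials k kx ky" "\<And>z. norm (kx z) \<le> B" "\<And>z. norm (ky z) \<le> B"
  shows "norm (k x - k y) \<le> 2 * B * norm (x - y)"
proof -
  have B: "0 \<le> B" using order_trans[OF norm_ge_zero assms(2)] .
  have "norm (Re h *\<^sub>R kx z + Im h *\<^sub>R ky z) \<le> 2 * B * norm h" for h z
  proof -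
    have "norm (Re h *\<^sub>R kx z + Im h *\<^sub>R ky z) \<le> \<bar>Re h\<bar> * norm (kx z) + \<bar>Im h\<bar> * norm (ky z)"
      by (rule order_trans[OF norm_triangle_ineq]) simp
    also have "\<dots> \<le> norm h * B + norm h * B"
      by (intro add_mono mult_mono abs_Re_le_cmod abs_Im_le_cmod assms) auto
    finally show ?thesis by simp
  qed
  then have "onorm (\<lambda>h. Re h *\<^sub>R kx z + Im h *\<^sub>R ky z) \<le> 2 * B" for z
    using B by (intro onorm_bound) auto
  then show ?thesis
    by (intro differentiable_bound[of UNIV k "\<lambda>z h. Re h *\<^sub>R kx z + Im h *\<^sub>R ky z"])
       (auto intro: has_derivative_at_withinI C1_partialsD(1)[OF assms(1)])
qed

lemma conv_integrable:
  fixes a k :: "complex \<Rightarrow> complex"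
  assumes "integrable lborel a" "continuous_on UNIV k" "\<And>z. norm (k z) \<le> B"
  shows "integrable lborel (\<lambda>v. a v * k (z - v))"
proof (rule Bochner_Integration.integrable_bound)
  show "integrable lborel (\<lambda>v. B * norm (a v))" using assms(1) by simp
  have "(\<lambda>v. k (z - v)) \<in> borel_measurable borel"
    by (intro borel_measurable_continuous_onI continuous_intros continuous_on_compose2[OF assms(2)]) auto
  then show "(\<lambda>v. a v * k (z - v)) \<in> borel_measurable lborel"
    using borel_measurable_integrable[OF assms(1)] by auto
  have "0 \<le> B" using order_trans[OF norm_ge_zero assms(3)] .
  then show "AE x in lborel. cmod (a x * k (z - x)) \<le> norm (B * cmod (a x))"
    using mult_left_mono[OF assms(3)] by (auto simp: norm_mult abs_mult mult.commute[of B])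
qed

lemma conv_continuous:
  assumes "integrable lborel a" "continuous_on UNIV k" "\<And>z. norm (k z) \<le> B"
  shows "continuous_on UNIV (conv a k)"
  unfolding continuous_on_def
proof
  fix z :: complex
  show "(conv a k \<longlongrightarrow> conv a k z) (at z within UNIV)"
    unfolding tendsto_at_iff_sequentially
  proof (intro allI impI)
    fix X :: "nat \<Rightarrow> complex" assume X: "X \<longlonglongrightarrow> z"
    show "(conv a k \<circ> X) \<longlonglongrightarrow> conv a k z"
      unfolding conv_def o_def
    proof (rule integral_dominated_convergence[where w = "\<lambda>v. norm (a v) * B"])
      show "(\<lambda>v. a v * k (z - v)) \<in> borel_measurable lborel"
           "\<And>i. (\<lambda>v. a v * k (X i - v)) \<in> borel_measurable lborel"
        using conv_integrable[OF assms] by auto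
      show "integrable lborel (\<lambda>v. norm (a v) * B)" using assms(1) by simp
      show "AE v in lborel. (\<lambda>i. a v * k (X i - v)) \<longlonglongrightarrow> a v * k (z - v)"
        using assms(2) X
        by (auto intro!: tendsto_intros continuous_on_tendsto_compose[OF assms(2)])
      show "\<And>i. AE v in lborel. cmod (a v * k (X i - v)) \<le> cmod (a v) * B"
        using assms(3) by (auto simp: norm_mult intro!: mult_left_mono AE_I2)
    qed
  qed
qed

text \<open>The remainder quotient \<open>Q\<close> of the kernel tends to 0 pointwise and is at
  most \<open>4 * B\<close> by the Lipschitz estimate, so dominated convergence asks nothing of
  \<open>a\<close> beyond integrability.\<close>

lemma C1_partials_conv:
  assumes a: "integrable lborel a" and k: "C1_partials k kx ky"
    and B: "\<And>z. norm (k z) \<le> B0" "\<And>z. norm (kx z) \<le> B" "\<And>z. norm (ky z) \<le> B"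
  shows "C1_partials (conv a k) (conv a kx) (conv a ky)"
proof -
  note kD = C1_partialsD[OF k]
  note int = conv_integrable[OF a kD(4) B(1)] conv_integrable[OF a kD(2) B(2)] conv_integrable[OF a kD(3) B(3)]
  have B0: "0 \<le> B" using order_trans[OF norm_ge_zero B(2)] .
  have "(conv a k has_derivative (\<lambda>h. Re h *\<^sub>R conv a kx z + Im h *\<^sub>R conv a ky z)) (at z)" for z
    unfolding has_derivative_at_within
  proof (intro conjI)
    show "bounded_linear (\<lambda>h. Re h *\<^sub>R conv a kx z + Im h *\<^sub>R conv a ky z)"
      by (intro bounded_linear_add bounded_linear_compose[OF bounded_linear_scaleR_left] bounded_linear_Re bounded_linear_Im)
    define Q where "Q y v = (k (y - v) - k (z - v)
        - (Re (y - z) *\<^sub>R kx (z - v) + Im (y - z) *\<^sub>R ky (z - v))) /\<^sub>R norm (y - z)" for y v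
    have rw: "(conv a k y - conv a k z - (Re (y - z) *\<^sub>R conv a kx z + Im (y - z) *\<^sub>R conv a ky z)) /\<^sub>R norm (y - z)
      = (LBINT v. a v * Q y v)" and Qm: "(\<lambda>v. a v * Q y v) \<in> borel_measurable lborel" for y
    proof -
      have *: "a v * Q y v = (a v * k (y - v) - a v * k (z - v)
         - (Re (y - z) *\<^sub>R (a v * kx (z - v)) + Im (y - z) *\<^sub>R (a v * ky (z - v)))) /\<^sub>R norm (y - z)" for v
        by (simp add: Q_def algebra_simps)
      show "(conv a k y - conv a k z - (Re (y - z) *\<^sub>R conv a kx z + Im (y - z) *\<^sub>R conv a ky z)) /\<^sub>R norm (y - z)
      = (LBINT v. a v * Q y v)"
        unfolding * conv_def using int by simp
      show "(\<lambda>v. a v * Q y v) \<in> borel_measurable lborel"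
        unfolding * by (intro borel_measurable_integrable) (use int in simp)
    qed
    have Qb: "norm (Q y v) \<le> 4 * B" if "y \<noteq> z" for y v
    proof -
      have "norm (k (y - v) - k (z - v)) \<le> 2 * B * norm (y - z)"
        using C1_partials_lipschitz[OF k B(2,3), of "y - v" "z - v"] by simp
      moreover have "norm (Re (y - z) *\<^sub>R kx (z - v)) \<le> norm (y - z) * B"
        unfolding norm_scaleR by (intro mult_mono abs_Re_le_cmod B) auto
      moreover have "norm (Im (y - z) *\<^sub>R ky (z - v)) \<le> norm (y - z) * B"
        unfolding norm_scaleR by (intro mult_mono abs_Im_le_cmod B) auto
      ultimately have "norm (k (y - v) - k (z - v) - (Re (y - z) *\<^sub>R kx (z - v) + Im (y - z) *\<^sub>R ky (z - v)))
         \<le> 2 * B * norm (y - z) + (norm (y - z) * B + norm (y - z) * B)"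
        by (rule norm_triangle_le_diff[OF add_mono[OF _ norm_triangle_le[OF add_mono]]])
      moreover have "norm (Q y v) = norm (k (y - v) - k (z - v)
          - (Re (y - z) *\<^sub>R kx (z - v) + Im (y - z) *\<^sub>R ky (z - v))) / norm (y - z)"
        by (simp add: Q_def divide_inverse mult.commute)
      ultimately show ?thesis using that by (simp only:) (simp add: pos_divide_le_eq)
    qed
    have Q0: "((\<lambda>y. Q y v) \<longlongrightarrow> 0) (at z)" for v
    proof -
      have "((\<lambda>y. k (y - v)) has_derivative (\<lambda>h. Re h *\<^sub>R kx (z - v) + Im h *\<^sub>R ky (z - v))) (at z)"
        by (rule has_derivative_compose[OF _ kD(1), of "\<lambda>y. y - v" "\<lambda>h. h", simplified])
           (auto intro!: derivative_eq_intros)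
      then show ?thesis unfolding has_derivative_at_within Q_def by simp
    qed
    show "((\<lambda>y. (conv a k y - conv a k z - (Re (y - z) *\<^sub>R conv a kx z + Im (y - z) *\<^sub>R conv a ky z)) /\<^sub>R norm (y - z)) \<longlongrightarrow> 0) (at z)"
      unfolding rw tendsto_at_iff_sequentially
    proof (intro allI impI)
      fix X :: "nat \<Rightarrow> complex" assume X: "\<forall>i. X i \<in> UNIV - {z}" "X \<longlonglongrightarrow> z"
      have "(\<lambda>i. \<integral>v. a v * Q (X i) v \<partial>lborel) \<longlonglongrightarrow> (\<integral>v. 0 \<partial>(lborel::complex measure))"
      proof (rule integral_dominated_convergence[where w = "\<lambda>v. norm (a v) * (4 * B)"])
        show "AE v in lborel. (\<lambda>i. a v * Q (X i) v) \<longlonglongrightarrow> 0"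
          using Q0 X unfolding tendsto_at_iff_sequentially o_def
          by (auto intro!: tendsto_mult_right_zero)
        show "\<And>i. AE v in lborel. cmod (a v * Q (X i) v) \<le> cmod (a v) * (4 * B)"
          using Qb X(1) by (auto simp: norm_mult intro!: mult_left_mono)
      qed (use Qm a in auto)
      then show "((\<lambda>y. \<integral>v. a v * Q y v \<partial>lborel) \<circ> X) \<longlonglongrightarrow> 0" by (simp add: o_def)
    qed
  qed
  then show ?thesis
    unfolding C1_partials_def
    using conv_continuous[OF a kD(2) B(2)] conv_continuous[OF a kD(3) B(3)] by blast
qed

section \<open>Bumps and the regularised Cauchy kernel\<close>

lemma C1_partials_mult:
  assumes "C1_partials f fx fy" "C1_partials g gx gy"
  shows "C1_partials (\<lambda>z. f z * g z) (\<lambda>z. f z * gx z + fx z * g z) (\<lambda>z. f z * gy z + fy z * g z)"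
  unfolding C1_partials_def
proof (intro conjI allI)
  fix z
  show "((\<lambda>z. f z * g z) has_derivative (\<lambda>h. Re h *\<^sub>R (f z * gx z + fx z * g z) + Im h *\<^sub>R (f z * gy z + fy z * g z))) (at z)"
    by (rule has_derivative_eq_rhs[OF has_derivative_mult[OF C1_partialsD(1)[OF assms(1)] C1_partialsD(1)[OF assms(2)]]])
       (simp add: algebra_simps)
qed (intro continuous_intros C1_partialsD[OF assms(1)] C1_partialsD[OF assms(2)])+

lemma C1_partials_exp:
  assumes "C1_partials w wx wy"
  shows "C1_partials (\<lambda>z. exp (- w z)) (\<lambda>z. - wx z * exp (- w z)) (\<lambda>z. - wy z * exp (- w z))"
  unfolding C1_partials_def
proof (intro conjI allI)
  fix z
  have "((\<lambda>z. exp (- w z)) has_derivative (*) (exp (- w z)) \<circ> (\<lambda>h. - (Re h *\<^sub>R wx z + Im h *\<^sub>R wy z))) (at z)"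
    unfolding o_def
    by (rule has_derivative_compose[OF has_derivative_minus[OF C1_partialsD(1)[OF assms]],
          OF DERIV_exp[unfolded has_field_derivative_def]])
  then show "((\<lambda>z. exp (- w z)) has_derivative (\<lambda>h. Re h *\<^sub>R (- wx z * exp (- w z)) + Im h *\<^sub>R (- wy z * exp (- w z)))) (at z)"
    by (rule has_derivative_eq_rhs) (auto simp: algebra_simps)
qed (intro continuous_intros C1_partialsD[OF assms])+

lemma C1_partials_cmult:
  assumes "C1_partials f fx fy"
  shows "C1_partials (\<lambda>z. c * f z) (\<lambda>z. c * fx z) (\<lambda>z. c * fy z)"
  unfolding C1_partials_def
proof (intro conjI allI)
  fix z
  show "((\<lambda>z. c * f z) has_derivative (\<lambda>h. Re h *\<^sub>R (c * fx z) + Im h *\<^sub>R (c * fy z))) (at z)"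
    by (rule has_derivative_eq_rhs[OF has_derivative_mult_right[OF C1_partialsD(1)[OF assms]]])
       (simp add: algebra_simps)
qed (intro continuous_intros C1_partialsD[OF assms])+

lemma C1_partials_diff:
  assumes "C1_partials f fx fy" "C1_partials g gx gy"
  shows "C1_partials (\<lambda>z. f z - g z) (\<lambda>z. fx z - gx z) (\<lambda>z. fy z - gy z)"
  unfolding C1_partials_def
proof (intro conjI allI)
  fix z
  show "((\<lambda>z. f z - g z) has_derivative (\<lambda>h. Re h *\<^sub>R (fx z - gx z) + Im h *\<^sub>R (fy z - gy z))) (at z)"
    by (rule has_derivative_eq_rhs[OF has_derivative_diff[OF C1_partialsD(1)[OF assms(1)] C1_partialsD(1)[OF assms(2)]]])
       (simp add: algebra_simps)
qed (intro continuous_intros C1_partialsD[OF assms(1)] C1_partialsD[OF assms(2)])+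

lemma C1_partials_reflect:
  assumes "C1_partials f fx fy"
  shows "C1_partials (\<lambda>v. f (z - v)) (\<lambda>v. - fx (z - v)) (\<lambda>v. - fy (z - v))"
  unfolding C1_partials_def
proof (intro conjI allI)
  fix v
  have "((\<lambda>v. z - v) has_derivative uminus) (at v)"
    by (auto intro!: derivative_eq_intros)
  from has_derivative_compose[OF this C1_partialsD(1)[OF assms]]
  show "((\<lambda>v. f (z - v)) has_derivative (\<lambda>h. Re h *\<^sub>R - fx (z - v) + Im h *\<^sub>R - fy (z - v))) (at v)"
    by (rule has_derivative_eq_rhs) auto
qed (intro continuous_intros continuous_on_compose2[OF C1_partialsD(2)[OF assms]]
       continuous_on_compose2[OF C1_partialsD(3)[OF assms]]; simp)+

text \<open>Polynomial bumps have explicit derivatives. The exponent counts smoothness: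
  \<open>n = 2\<close> gives a C^1 function, \<open>n = 3\<close> the C^2 kernel used for the curl
  identity.\<close>

definition bump :: "nat \<Rightarrow> real \<Rightarrow> complex \<Rightarrow> real" where
  "bump n e z = (max 0 (1 - (norm z / e)\<^sup>2)) ^ n"

lemma bump_nonneg: "0 \<le> bump n e z"
  by (simp add: bump_def)

lemma bump_le1: "bump n e z \<le> 1"
  by (auto simp: bump_def intro!: power_le_one)

lemma bump_zero: "0 < n \<Longrightarrow> 0 < e \<Longrightarrow> e \<le> norm z \<Longrightarrow> bump n e z = 0"
proof -
  assume *: "0 < n" "0 < e" "e \<le> norm z"
  then have "1 \<le> (norm z / e)\<^sup>2" by (intro one_le_power) (simp add: le_divide_eq)
  then have "max 0 (1 - (norm z / e)\<^sup>2) = 0" by simp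
  with * show ?thesis unfolding bump_def by simp
qed

lemma bump_continuous: "continuous_on UNIV (bump n e)"
  unfolding bump_def divide_inverse by (intro continuous_intros)

lemma DERIV_max_power:
  fixes t :: real
  shows "((\<lambda>t. (max 0 t) ^ Suc (Suc n)) has_real_derivative (real (n + 2) * (max 0 t) ^ Suc n)) (at t)"
proof -
  consider "t > 0" | "t < 0" | "t = 0" by linarith
  then show ?thesis
  proof cases
    case 1
    have "((\<lambda>t. t ^ Suc (Suc n)) has_real_derivative (real (n + 2) * (max 0 t) ^ Suc n)) (at t)"
      using 1 DERIV_pow[of "Suc (Suc n)" t] by simp
    then show ?thesis
      by (rule has_field_derivative_transform_within_open[where S = "{0<..}"]) (use 1 in auto)
  next
    case 2
    have "((\<lambda>t. 0) has_real_derivative (real (n + 2) * (max 0 t) ^ Suc n)) (at t)"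
      using 2 by (auto intro!: derivative_eq_intros)
    then show ?thesis
      by (rule has_field_derivative_transform_within_open[where S = "{..<0}"]) (use 2 in auto)
  next
    case 3
    have "((\<lambda>h. (max 0 h) ^ Suc (Suc n) / h) \<longlongrightarrow> 0) (at (0::real))"
    proof (rule Lim_null_comparison)
      show "\<forall>\<^sub>F h in at 0. norm ((max 0 h) ^ Suc (Suc n) / h) \<le> \<bar>h\<bar> ^ Suc n"
      proof (rule always_eventually, rule allI)
        fix h :: real
        show "norm ((max 0 h) ^ Suc (Suc n) / h) \<le> \<bar>h\<bar> ^ Suc n"
        proof (cases "0 < h")
          case False
          then have "max 0 h = 0" by simp
          then have "(max 0 h) ^ Suc (Suc n) = 0" by (simp only: power_Suc mult_zero_left)
          then show ?thesis by (simp only:) simp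
        qed simp
      qed
      show "((\<lambda>h. \<bar>h\<bar> ^ Suc n) \<longlongrightarrow> 0) (at (0::real))"
        by (rule tendsto_eq_intros | simp)+
    qed
    then show ?thesis using 3 by (simp add: DERIV_def)
  qed
qed

lemma C1_partials_of_real:
  assumes "\<And>z. (f has_derivative (\<lambda>h. Re h * fx z + Im h * fy z)) (at z)"
    "continuous_on UNIV fx" "continuous_on UNIV fy"
  shows "C1_partials (\<lambda>z. of_real (f z)) (\<lambda>z. of_real (fx z)) (\<lambda>z. of_real (fy z))"
  unfolding C1_partials_def
  using assms has_derivative_of_real[OF assms(1)]
  by (auto intro!: continuous_intros simp: scaleR_conv_of_real)

lemma norm_sq_has_derivative:
  "((\<lambda>z. (norm z / e)\<^sup>2) has_derivative (\<lambda>h. Re h * (2 * Re z / e\<^sup>2) + Im h * (2 * Im z / e\<^sup>2))) (at z)"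
proof -
  have eq: "(\<lambda>z. (norm z / e)\<^sup>2) = (\<lambda>z. ((Re z)\<^sup>2 + (Im z)\<^sup>2) / e\<^sup>2)"
    by (auto simp: power_divide cmod_power2)
  show ?thesis unfolding eq
    unfolding divide_inverse by (auto intro!: derivative_eq_intros simp: algebra_simps)
qed

lemma C1_partials_bump:
  "C1_partials (\<lambda>z. of_real (bump (Suc (Suc n)) e z))
     (\<lambda>z. of_real (- (2 * real (n + 2) / e\<^sup>2) * Re z * bump (Suc n) e z))
     (\<lambda>z. of_real (- (2 * real (n + 2) / e\<^sup>2) * Im z * bump (Suc n) e z))"
proof (rule C1_partials_of_real)
  fix z
  have "((\<lambda>z. 1 - (norm z / e)\<^sup>2) has_derivative (\<lambda>h. - (Re h * (2 * Re z / e\<^sup>2) + Im h * (2 * Im z / e\<^sup>2)))) (at z)"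
    using has_derivative_diff[OF has_derivative_const norm_sq_has_derivative] by simp
  from has_derivative_compose[OF this DERIV_max_power[unfolded has_field_derivative_def]]
  show "(bump (Suc (Suc n)) e has_derivative (\<lambda>h. Re h * (- (2 * real (n + 2) / e\<^sup>2) * Re z * bump (Suc n) e z)
      + Im h * (- (2 * real (n + 2) / e\<^sup>2) * Im z * bump (Suc n) e z))) (at z)"
    unfolding bump_def by (rule has_derivative_eq_rhs) (auto simp: algebra_simps add_divide_distrib)
qed (intro continuous_intros bump_continuous)+

text \<open>With s = (|z| / e)^2 in mind, s times the profile is 1 - (1 - s)^3 on [0, 1] and 1
  beyond. Division by s gives the polynomial 3 - 3 s + s^2, which exceeds 1/s by (s - 1)^3 / s; the
  last term removes this excess for s > 1 and keeps the function continuously differentiable at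
  1.\<close>

definition cauchy_profile :: "real \<Rightarrow> real" where
  "cauchy_profile s = 3 - 3 * s + s\<^sup>2 - (max 0 (s - 1)) ^ 3 / s"

definition cauchy_profile' :: "real \<Rightarrow> real" where
  "cauchy_profile' s = (if s \<le> 1 then 2 * s - 3 else - 1 / s\<^sup>2)"

lemma cauchy_profile_le: "s \<le> 1 \<Longrightarrow> cauchy_profile s = 3 - 3 * s + s\<^sup>2"
  by (simp add: cauchy_profile_def)

lemma cauchy_profile_ge: "1 \<le> s \<Longrightarrow> cauchy_profile s = 1 / s"
  by (simp add: cauchy_profile_def field_simps power2_eq_square power3_eq_cube)

lemma cauchy_profile_DERIV: "(cauchy_profile has_real_derivative cauchy_profile' s) (at s)"
proof (cases "s < 1")
  case True
  have "((\<lambda>s. 3 - 3 * s + s\<^sup>2) has_real_derivative cauchy_profile' s) (at s)"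
    using True by (auto simp: cauchy_profile'_def intro!: derivative_eq_intros)
  then show ?thesis
    by (rule has_field_derivative_transform_within_open[where S = "{..<1}"])
       (use True in \<open>auto simp: cauchy_profile_le\<close>)
next
  case False
  have d: "((\<lambda>s. (max 0 (s - 1)) ^ 3) has_real_derivative (3 * (max 0 (s - 1))\<^sup>2)) (at s)"
    using DERIV_chain2[where f = "\<lambda>t. (max 0 t) ^ Suc (Suc 1)" and g = "\<lambda>s. s - 1" and s = UNIV and x = s,
        OF DERIV_max_power[of 1 "s - 1"] DERIV_diff[OF DERIV_ident DERIV_const]]
    by (simp add: numeral_3_eq_3 numeral_2_eq_2)
  have "((\<lambda>s. 3 - 3 * s + s\<^sup>2 - (max 0 (s - 1)) ^ 3 / s) has_real_derivative
          (0 - 3 * 1 + 2 * s) - (3 * (max 0 (s - 1))\<^sup>2 * s - (max 0 (s - 1)) ^ 3 * 1) / (s * s)) (at s)"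
    using False by (intro DERIV_diff DERIV_add DERIV_divide d) (auto intro!: derivative_eq_intros)
  moreover have "(0 - 3 * 1 + 2 * s) - (3 * (max 0 (s - 1))\<^sup>2 * s - (max 0 (s - 1)) ^ 3 * 1) / (s * s) = cauchy_profile' s"
    using False by (auto simp: cauchy_profile'_def max_def divide_simps power2_eq_square power3_eq_cube) (auto simp: algebra_simps)
  ultimately show ?thesis by (simp add: cauchy_profile_def[abs_def])
qed

lemma cauchy_profile'_continuous: "continuous_on UNIV cauchy_profile'"
proof -
  have "continuous_on ({..1} \<union> {1..}) (\<lambda>s. if s \<le> 1 then 2 * s - 3 else - 1 / s\<^sup>2 :: real)"
    by (rule continuous_on_cases) (auto intro!: continuous_intros)
  moreover have "{..1} \<union> {1..} = (UNIV :: real set)" by auto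
  ultimately show ?thesis unfolding cauchy_profile'_def[abs_def] by (simp only:)
qed

text \<open>The left side is the derivative of s times the profile, that is, of 1 - (1 - s)^3 for s
  \<le> 1 and of a constant beyond.\<close>

lemma cauchy_profile_identity:
  "0 \<le> s \<Longrightarrow> cauchy_profile s + s * cauchy_profile' s = 3 * (max 0 (1 - s))\<^sup>2"
proof (cases "s \<le> 1")
  case True then show ?thesis
    by (simp add: cauchy_profile_le cauchy_profile'_def power2_eq_square algebra_simps)
next
  case False then show ?thesis
    by (simp add: cauchy_profile_ge cauchy_profile'_def power2_eq_square)
qed

lemma cauchy_profile_bounds:
  assumes "0 \<le> s"
  shows "0 \<le> cauchy_profile s" "cauchy_profile s \<le> 3" "s * cauchy_profile s \<le> 1"
    "\<bar>s * cauchy_profile' s\<bar> \<le> 3"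
proof -
  have *: "0 \<le> cauchy_profile s \<and> cauchy_profile s \<le> 3 \<and> s * cauchy_profile s \<le> 1 \<and> \<bar>s * cauchy_profile' s\<bar> \<le> 3"
  proof (cases "s \<le> 1")
    case True
    have "0 \<le> (1 - s) ^ 3" and ss: "0 \<le> s * s" "s * s \<le> s" using True assms by (auto simp: mult_left_le)
    moreover have "s * (3 - 3 * s + s\<^sup>2) = 1 - (1 - s) ^ 3" by (simp add: power2_eq_square power3_eq_cube algebra_simps)
    ultimately have "s * (3 - 3 * s + s\<^sup>2) \<le> 1" by linarith
    moreover have "\<bar>s * (2 * s - 3)\<bar> \<le> 3" "0 \<le> 3 - 3 * s + s\<^sup>2" "3 - 3 * s + s\<^sup>2 \<le> 3"
      using ss True assms unfolding right_diff_distrib abs_le_iff power2_eq_square by linarith+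
    ultimately show ?thesis using True
      by (simp add: cauchy_profile_le cauchy_profile'_def)
  next
    case False
    then show ?thesis
      by (simp add: cauchy_profile_ge cauchy_profile'_def power2_eq_square divide_le_eq)
  qed
  then show "0 \<le> cauchy_profile s" "cauchy_profile s \<le> 3" "s * cauchy_profile s \<le> 1"
    "\<bar>s * cauchy_profile' s\<bar> \<le> 3" by auto
qed

text \<open>Since 1/z = cnj z / |z|^2, only a radial factor has to be smoothed, and it changes only
  inside the disc of radius e.\<close>

definition cauchy_ker :: "real \<Rightarrow> complex \<Rightarrow> complex" where
  "cauchy_ker e z = cnj z * of_real (cauchy_profile ((norm z / e)\<^sup>2) / e\<^sup>2)"

definition cauchy_ker_x :: "real \<Rightarrow> complex \<Rightarrow> complex" where
  "cauchy_ker_x e z = of_real (cauchy_profile ((norm z / e)\<^sup>2) / e\<^sup>2)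
     + cnj z * of_real (cauchy_profile' ((norm z / e)\<^sup>2) * (2 * Re z / e\<^sup>2) / e\<^sup>2)"

definition cauchy_ker_y :: "real \<Rightarrow> complex \<Rightarrow> complex" where
  "cauchy_ker_y e z = - \<i> * of_real (cauchy_profile ((norm z / e)\<^sup>2) / e\<^sup>2)
     + cnj z * of_real (cauchy_profile' ((norm z / e)\<^sup>2) * (2 * Im z / e\<^sup>2) / e\<^sup>2)"

text \<open>This is the dbar derivative of \<open>cauchy_ker e\<close>; the factor 3 comes from
  differentiating 1 - (1 - s)^3. The mass is not normalised to 1.\<close>

definition mollifier :: "real \<Rightarrow> complex \<Rightarrow> real" where
  "mollifier e z = 3 / e\<^sup>2 * bump 2 e z"

lemma C1_partials_cauchy_ker: "C1_partials (cauchy_ker e) (cauchy_ker_x e) (cauchy_ker_y e)"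
proof -
  have A: "C1_partials (\<lambda>z. of_real (cauchy_profile ((norm z / e)\<^sup>2) / e\<^sup>2))
     (\<lambda>z. of_real (cauchy_profile' ((norm z / e)\<^sup>2) * (2 * Re z / e\<^sup>2) / e\<^sup>2))
     (\<lambda>z. of_real (cauchy_profile' ((norm z / e)\<^sup>2) * (2 * Im z / e\<^sup>2) / e\<^sup>2))"
  proof (rule C1_partials_of_real)
    fix z
    from has_derivative_compose[OF norm_sq_has_derivative cauchy_profile_DERIV[unfolded has_field_derivative_def]]
    have "((\<lambda>z. cauchy_profile ((norm z / e)\<^sup>2)) has_derivative
      (\<lambda>h. cauchy_profile' ((norm z / e)\<^sup>2) * (Re h * (2 * Re z / e\<^sup>2) + Im h * (2 * Im z / e\<^sup>2)))) (at z)" .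
    from has_derivative_mult_right[OF this, of "1 / e\<^sup>2"]
    show "((\<lambda>z. cauchy_profile ((norm z / e)\<^sup>2) / e\<^sup>2) has_derivative
      (\<lambda>h. Re h * (cauchy_profile' ((norm z / e)\<^sup>2) * (2 * Re z / e\<^sup>2) / e\<^sup>2) +
           Im h * (cauchy_profile' ((norm z / e)\<^sup>2) * (2 * Im z / e\<^sup>2) / e\<^sup>2))) (at z)"
      by (simp add: algebra_simps add_divide_distrib)
  qed (cases "e = 0"; auto intro!: continuous_intros continuous_on_compose2[OF cauchy_profile'_continuous])+
  have B: "C1_partials cnj (\<lambda>z. 1) (\<lambda>z. - \<i>)"
    unfolding C1_partials_def
  proof (intro conjI allI)
    fix z
    show "(cnj has_derivative (\<lambda>h. Re h *\<^sub>R 1 + Im h *\<^sub>R - \<i>)) (at z)"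
      by (rule has_derivative_eq_rhs[OF bounded_linear_imp_has_derivative[OF bounded_linear_cnj]])
         (auto simp: complex_eq_iff)
  qed auto
  show ?thesis
    using C1_partials_mult[OF B A]
    unfolding cauchy_ker_def[abs_def] cauchy_ker_x_def[abs_def] cauchy_ker_y_def[abs_def]
    by (simp add: add.commute mult.commute)
qed

text \<open>For a radial factor G(|z|^2), dbar of cnj z times G is G + |z|^2 G', which reduces to
  \<open>cauchy_profile_identity\<close>. The combination of partials on the left is twice dbar,
  hence the factor 2.\<close>

lemma cauchy_ker_dbar:
  "cauchy_ker_x e z + \<i> * cauchy_ker_y e z = 2 * of_real (mollifier e z)"
proof -
  define s where "s = (norm z / e)\<^sup>2"
  have z: "cnj z * (of_real (Re z) + \<i> * of_real (Im z)) = of_real ((norm z)\<^sup>2)"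
    unfolding complex_eq[symmetric] complex_norm_square by (rule mult.commute)
  have "cauchy_ker_x e z + \<i> * cauchy_ker_y e z
     = 2 * of_real (cauchy_profile s / e\<^sup>2)
       + (cnj z * (of_real (Re z) + \<i> * of_real (Im z))) * of_real (2 * cauchy_profile' s / e\<^sup>2 / e\<^sup>2)"
    by (simp add: cauchy_ker_x_def cauchy_ker_y_def s_def algebra_simps add_divide_distrib)
  also have "\<dots> = of_real (2 / e\<^sup>2 * (cauchy_profile s + s * cauchy_profile' s))"
  proof -
    have "(norm z)\<^sup>2 * (2 * cauchy_profile' s / e\<^sup>2 / e\<^sup>2) = 2 / e\<^sup>2 * (s * cauchy_profile' s)"
      by (simp add: s_def power_divide)
    then show ?thesis
      unfolding z of_real_mult[symmetric] by (simp add: distrib_left)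
  qed
  also have "\<dots> = 2 * of_real (mollifier e z)"
    by (subst cauchy_profile_identity) (auto simp: s_def mollifier_def bump_def)
  finally show ?thesis .
qed

lemma cauchy_ker_far: "0 < e \<Longrightarrow> e \<le> norm z \<Longrightarrow> cauchy_ker e z = 1 / z"
proof -
  assume e: "0 < e" "e \<le> norm z"
  have "1 \<le> (norm z / e)\<^sup>2" using e by (simp add: le_divide_eq)
  then have "cauchy_ker e z = cnj z * of_real (1 / (norm z / e)\<^sup>2 / e\<^sup>2)"
    by (simp add: cauchy_ker_def cauchy_profile_ge)
  also have "1 / (norm z / e)\<^sup>2 / e\<^sup>2 = 1 / (norm z)\<^sup>2" using e by (simp add: field_simps)
  also have "cnj z * of_real (1 / (norm z)\<^sup>2) = 1 / z"
    using e by (simp add: complex_norm_square[unfolded of_real_power] field_simps)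
  finally show ?thesis .
qed

text \<open>Away from 0 this says that s times the profile is at most 1. It gives the regularised
  potentials the same bound as the potential itself, at every scale.\<close>

lemma cauchy_ker_norm:
  assumes "0 < e"
  shows "norm (cauchy_ker e z) \<le> 1 / norm z"
proof (cases "z = 0")
  case False
  have "norm (cauchy_ker e z) * norm z = (norm z / e)\<^sup>2 * cauchy_profile ((norm z / e)\<^sup>2)"
    using assms cauchy_profile_bounds(1)[of "(norm z / e)\<^sup>2"]
    by (simp add: cauchy_ker_def norm_mult norm_divide norm_power power2_eq_square field_simps)
  also have "\<dots> \<le> 1" by (intro cauchy_profile_bounds) auto
  finally show ?thesis using False by (simp add: field_simps)
qed (simp add: cauchy_ker_def)

lemma cauchy_ker_bounded:
  assumes "0 < e"
  shows "norm (cauchy_ker e z) \<le> 3 / e"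
proof (cases "norm z \<le> e")
  case True
  have "norm (cauchy_ker e z) = norm z * (cauchy_profile ((norm z / e)\<^sup>2) / e\<^sup>2)"
    using cauchy_profile_bounds(1)[of "(norm z / e)\<^sup>2"] by (simp add: cauchy_ker_def norm_mult norm_divide norm_power)
  also have "\<dots> \<le> e * (3 / e\<^sup>2)"
    using True assms cauchy_profile_bounds(1,2)[of "(norm z / e)\<^sup>2"]
    by (intro mult_mono divide_right_mono) auto
  finally show ?thesis using assms by (simp add: power2_eq_square)
next
  case False
  then have "norm (cauchy_ker e z) \<le> 1 / norm z" "1 / norm z \<le> 1 / e"
    using cauchy_ker_norm[OF assms] assms by (auto simp: divide_simps)
  moreover have "1 / e \<le> 3 / e" using assms by (intro divide_right_mono) auto
  ultimately show ?thesis by linarith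
qed

text \<open>The value of the profile contributes 3. In the other term |z| |t| / e^2 \<le> s, so it
  is at most 2 |s * cauchy_profile' s| / e^2 and contributes 6.\<close>

lemma cauchy_ker_partials_bounded:
  assumes "0 < e"
  shows "norm (cauchy_ker_x e z) \<le> 9 / e\<^sup>2" "norm (cauchy_ker_y e z) \<le> 9 / e\<^sup>2"
proof -
  define s where "s = (norm z / e)\<^sup>2"
  have s: "0 \<le> s" by (simp add: s_def)
  have A: "norm (of_real (cauchy_profile s / e\<^sup>2) :: complex) \<le> 3 / e\<^sup>2"
    using cauchy_profile_bounds(1,2)[OF s] by (simp add: norm_divide norm_power divide_right_mono)
  have B: "norm (cnj z * of_real (cauchy_profile' s * (2 * t / e\<^sup>2) / e\<^sup>2)) \<le> 6 / e\<^sup>2" if t: "\<bar>t\<bar> \<le> norm z" for t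
  proof -
    have "norm (cnj z * of_real (cauchy_profile' s * (2 * t / e\<^sup>2) / e\<^sup>2))
      = norm z * \<bar>t\<bar> / e\<^sup>2 * \<bar>cauchy_profile' s\<bar> * 2 / e\<^sup>2"
      using assms by (simp add: norm_mult norm_divide norm_power abs_mult)
    also have "\<dots> \<le> norm z * norm z / e\<^sup>2 * \<bar>cauchy_profile' s\<bar> * 2 / e\<^sup>2"
      using t by (intro divide_right_mono mult_right_mono mult_left_mono) auto
    also have "\<dots> = \<bar>s * cauchy_profile' s\<bar> * 2 / e\<^sup>2"
      using assms by (simp add: s_def power_divide power2_eq_square abs_mult)
    also have "\<dots> \<le> 3 * 2 / e\<^sup>2"
      using cauchy_profile_bounds(4)[OF s] by (intro divide_right_mono mult_right_mono) auto
    finally show ?thesis by simp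
  qed
  show "norm (cauchy_ker_x e z) \<le> 9 / e\<^sup>2"
    unfolding cauchy_ker_x_def s_def[symmetric]
    using norm_triangle_mono[OF A B[OF abs_Re_le_cmod]] by (simp add: add_divide_distrib[symmetric])
  have "norm (- \<i> * of_real (cauchy_profile s / e\<^sup>2)) \<le> 3 / e\<^sup>2"
    using A by (simp add: norm_mult norm_divide)
  then show "norm (cauchy_ker_y e z) \<le> 9 / e\<^sup>2"
    unfolding cauchy_ker_y_def s_def[symmetric]
    using norm_triangle_mono[OF _ B[OF abs_Im_le_cmod]] by (fastforce simp: add_divide_distrib[symmetric])
qed

section \<open>Weyl's lemma\<close>

definition C1_test ::
  "complex set \<Rightarrow> (complex \<Rightarrow> complex) \<Rightarrow> (complex \<Rightarrow> complex) \<Rightarrow> (complex \<Rightarrow> complex) \<Rightarrow> bool" where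
  "C1_test V \<phi> \<phi>x \<phi>y \<longleftrightarrow>
     C1_partials \<phi> \<phi>x \<phi>y \<and> (\<exists>K. compact K \<and> K \<subseteq> V \<and> (\<forall>z. z \<notin> K \<longrightarrow> \<phi> z = 0))"

section \<open>Cut-offs, reflection and the mass of the mollifier\<close>

lemma C1_partials_zero_outside:
  assumes "C1_partials \<phi> \<phi>x \<phi>y" "closed K" "\<And>z. z \<notin> K \<Longrightarrow> \<phi> z = 0" "z \<notin> K"
  shows "\<phi>x z = 0" "\<phi>y z = 0"
proof -
  have "((\<lambda>z. 0) has_derivative (\<lambda>h. Re h *\<^sub>R \<phi>x z + Im h *\<^sub>R \<phi>y z)) (at z)"
    by (rule has_derivative_transform_within_open[OF C1_partialsD(1)[OF assms(1)], of "- K"])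
       (use assms in auto)
  then have eq: "(\<lambda>h. Re h *\<^sub>R \<phi>x z + Im h *\<^sub>R \<phi>y z) = (\<lambda>h. 0)"
    using has_derivative_unique has_derivative_const by blast
  show "\<phi>x z = 0" using fun_cong[OF eq, of 1] by simp
  show "\<phi>y z = 0" using fun_cong[OF eq, of \<i>] by simp
qed

text \<open>\<open>f\<close> may be arbitrary outside \<open>V\<close>: the open sets
  \<open>V\<close> and \<open>- K\<close> cover the plane, and the product vanishes on the
  second.\<close>

lemma continuous_on_cutoff:
  fixes f \<phi> :: "complex \<Rightarrow> complex"
  assumes "open V" "continuous_on V f" "continuous_on UNIV \<phi>" "closed K" "K \<subseteq> V"
    "\<And>z. z \<notin> K \<Longrightarrow> \<phi> z = 0"
  shows "continuous_on UNIV (\<lambda>z. f z * \<phi> z)"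
proof -
  have "continuous_on (V \<union> - K) (\<lambda>z. f z * \<phi> z)"
  proof (rule continuous_on_open_Un)
    show "continuous_on V (\<lambda>z. f z * \<phi> z)"
      using assms by (intro continuous_intros) (auto intro: continuous_on_subset)
    have "continuous_on (- K) (\<lambda>z. 0 :: complex)" by simp
    then show "continuous_on (- K) (\<lambda>z. f z * \<phi> z)"
      by (rule continuous_on_eq) (use assms(6) in auto)
  qed (use assms in auto)
  moreover have "V \<union> - K = UNIV" using assms(5) by auto
  ultimately show ?thesis by (simp only:)
qed

lemma integrable_continuous_compact:
  fixes g :: "complex \<Rightarrow> complex"
  assumes "continuous_on UNIV g" "compact K" "\<And>z. z \<notin> K \<Longrightarrow> g z = 0"
  shows "integrable lborel g"
proof -
  have "integrable lborel (\<lambda>z. indicator K z *\<^sub>R g z)"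
    using assms by (intro borel_integrable_compact) (auto intro: continuous_on_subset)
  also have "(\<lambda>z. indicator K z *\<^sub>R g z) = g"
    using assms(3) by (auto simp: indicator_def)
  finally show ?thesis .
qed

lemma integrable_cutoff:
  fixes f \<phi> :: "complex \<Rightarrow> complex"
  assumes "open V" "continuous_on V f" "continuous_on UNIV \<phi>" "compact K" "K \<subseteq> V"
    "\<And>z. z \<notin> K \<Longrightarrow> \<phi> z = 0"
  shows "integrable lborel (\<lambda>z. f z * \<phi> z)"
  using assms
  by (intro integrable_continuous_compact[of _ K] continuous_on_cutoff[of V f \<phi> K]) (auto intro: compact_imp_closed)

lemma lborel_distr_reflect: "distr lborel borel (\<lambda>v::complex. z - v) = lborel"
  using lborel_affine[of "-1" z] by (simp add: density_1)

lemma integral_reflect: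
  fixes F :: "complex \<Rightarrow> 'b :: {banach, second_countable_topology}"
  assumes "F \<in> borel_measurable borel"
  shows "(LBINT v. F (z - v)) = (LBINT v. F v)"
  using integral_distr[of "\<lambda>v. z - v" lborel borel F] assms by (simp add: lborel_distr_reflect)

lemma integrable_reflect:
  fixes F :: "complex \<Rightarrow> 'b :: {banach, second_countable_topology}"
  assumes "integrable lborel F"
  shows "integrable lborel (\<lambda>v. F (z - v))"
proof -
  have "F \<in> borel_measurable borel" using assms by auto
  then show ?thesis
    using integrable_distr_eq[of "\<lambda>v. z - v" lborel borel F] assms by (simp add: lborel_distr_reflect)
qed

lemma bump_integrable: "0 < n \<Longrightarrow> 0 < e \<Longrightarrow> integrable lborel (bump n e)"
proof -
  assume *: "0 < n" "0 < e"
  have "integrable lborel (\<lambda>z. indicator (cball 0 e) z *\<^sub>R bump n e z)"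
    by (intro borel_integrable_compact continuous_on_subset[OF bump_continuous]) auto
  also have "(\<lambda>z. indicator (cball 0 e) z *\<^sub>R bump n e z) = bump n e"
    using bump_zero[OF *] by (auto simp: indicator_def fun_eq_iff)
  finally show ?thesis .
qed

lemma bump_integral_pos:
  assumes "0 < n" "0 < e" shows "0 < (LBINT z. bump n e z)"
proof -
  have fin: "emeasure lborel (ball (0::complex) (e/2)) < \<infinity>"
    using emeasure_lborel_ball_finite by auto
  have "0 < measure lborel (ball (0::complex) (e/2)) * (3/4) ^ n"
    using content_ball_pos[of "e/2" "0::complex"] assms by simp
  also have "\<dots> = (\<integral>z. indicator (ball 0 (e/2)) z * (3/4) ^ n \<partial>(lborel :: complex measure))"
    by simp
  also have "\<dots> \<le> (LBINT z. bump n e z)"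
  proof (rule integral_mono)
    show "integrable lborel (\<lambda>z::complex. indicator (ball 0 (e/2)) z * (3/4::real) ^ n)"
      using fin by simp
    show "indicator (ball 0 (e/2)) z * (3/4::real) ^ n \<le> bump n e z" for z :: complex
    proof (cases "z \<in> ball 0 (e/2)")
      case True
      have "(norm z / e)\<^sup>2 \<le> (1/2)\<^sup>2"
        using True assms by (intro power_mono) (auto simp: field_simps)
      then have "(3/4::real) \<le> max 0 (1 - (norm z / e)\<^sup>2)"
        by (intro max.coboundedI2) (simp add: power_divide)
      from power_mono[OF this, of n] show ?thesis using True unfolding bump_def by (simp del: max.cobounded1)
    qed (simp add: bump_nonneg)
  qed (rule bump_integrable[OF assms])
  finally show ?thesis .
qed

text \<open>The value is pi, the constant in the equation saying that dbar of 1/z is pi times a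
  point mass. It is kept as a symbol, and potentials are divided by it.\<close>

definition moll_mass :: real where
  "moll_mass = (LBINT z. mollifier 1 z)"

lemma mollifier_facts:
  assumes "0 < e"
  shows "0 \<le> mollifier e z" "mollifier e z \<le> 3 / e\<^sup>2" "e \<le> norm z \<Longrightarrow> mollifier e z = 0"
    "continuous_on UNIV (mollifier e)" "integrable lborel (mollifier e)" "mollifier e (- z) = mollifier e z"
proof -
  show "mollifier e z \<le> 3 / e\<^sup>2" "0 \<le> mollifier e z"
    using assms mult_left_le[OF bump_le1, of "3 / e\<^sup>2" 2 e z] by (auto simp: mollifier_def bump_nonneg)
  show "e \<le> norm z \<Longrightarrow> mollifier e z = 0" using assms bump_zero[of 2 e z] by (simp add: mollifier_def)
  show "continuous_on UNIV (mollifier e)"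
    unfolding mollifier_def by (intro continuous_intros bump_continuous)
  show "integrable lborel (mollifier e)"
    unfolding mollifier_def using assms bump_integrable[of 2 e] by simp
  show "mollifier e (- z) = mollifier e z" by (simp add: mollifier_def bump_def)
qed

lemma moll_mass_pos: "0 < moll_mass"
  using bump_integral_pos[of 2 1] by (simp add: moll_mass_def mollifier_def)

text \<open>The factor 1/e^2 in the mollifier cancels the Jacobian of the dilation by e.\<close>

lemma mollifier_integral:
  assumes "0 < e" shows "(LBINT z. mollifier e z) = moll_mass"
proof -
  have [measurable]: "mollifier e \<in> borel_measurable borel"
    using mollifier_facts(5)[OF assms] by auto
  have "(LBINT z. mollifier e z) =
     (\<integral>z. mollifier e z \<partial>density (distr lborel borel (\<lambda>x. 0 + e *\<^sub>R x)) (\<lambda>_. ennreal (\<bar>e\<bar> ^ DIM(complex))))"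
    using lborel_affine[of e "0::complex"] assms by simp
  also have "\<dots> = (LBINT x. e\<^sup>2 * mollifier e (e *\<^sub>R x))"
    using assms by (subst integral_real_density) (simp_all add: integral_distr)
  also have "(\<lambda>x. e\<^sup>2 * mollifier e (e *\<^sub>R x)) = mollifier 1"
    using assms by (auto simp: mollifier_def bump_def fun_eq_iff)
  finally show ?thesis by (simp add: moll_mass_def)
qed

lemma C1_partials_mollifier:
  "\<exists>mx my. C1_partials (\<lambda>z. of_real (mollifier e z)) mx my \<and>
    (0 < e \<longrightarrow> (\<forall>z. norm (mx z) \<le> 12 / e ^ 3 \<and> norm (my z) \<le> 12 / e ^ 3))"
proof -
  let ?mx = "\<lambda>z. of_real (3 / e\<^sup>2) * of_real (- (2 * real (0 + 2) / e\<^sup>2) * Re z * bump (Suc 0) e z) :: complex"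
  let ?my = "\<lambda>z. of_real (3 / e\<^sup>2) * of_real (- (2 * real (0 + 2) / e\<^sup>2) * Im z * bump (Suc 0) e z) :: complex"
  have "C1_partials (\<lambda>z. of_real (mollifier e z)) ?mx ?my"
    using C1_partials_cmult[OF C1_partials_bump[of 0 e], of "of_real (3 / e\<^sup>2)"]
    by (simp add: mollifier_def[abs_def] numeral_2_eq_2)
  moreover have "norm (of_real (3 / e\<^sup>2) * of_real (- (2 * real (0 + 2) / e\<^sup>2) * t * bump (Suc 0) e z) :: complex) \<le> 12 / e ^ 3"
    if e: "0 < e" and t: "\<bar>t\<bar> \<le> norm z" for t z
  proof -
    have "\<bar>t\<bar> * bump (Suc 0) e z \<le> e * 1"
    proof (cases "norm z \<le> e")
      case True then show ?thesis using t e by (intro mult_mono bump_le1 bump_nonneg) auto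
    next
      case False then show ?thesis using e by (simp add: bump_zero)
    qed
    then have "12 / e ^ 4 * (\<bar>t\<bar> * bump (Suc 0) e z) \<le> 12 / e ^ 4 * (e * 1)"
      using e by (intro mult_left_mono) auto
    moreover have "12 / e ^ 4 * (e * 1) = 12 / e ^ 3" using e by (simp add: power_eq_if)
    moreover have "norm (of_real (3 / e\<^sup>2) * of_real (- (2 * real (0 + 2) / e\<^sup>2) * t * bump (Suc 0) e z) :: complex)
       = \<bar>3 / e\<^sup>2 * (- (2 * real (0 + 2) / e\<^sup>2) * t * bump (Suc 0) e z)\<bar>"
      unfolding of_real_mult[symmetric] norm_of_real ..
    moreover have "\<dots> = 12 / e ^ 4 * (\<bar>t\<bar> * bump (Suc 0) e z)"
      using e bump_nonneg[of "Suc 0" e z] by (simp add: abs_mult power_eq_if)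
    ultimately show ?thesis by (simp only:)
  qed
  ultimately show ?thesis using abs_Re_le_cmod abs_Im_le_cmod by blast
qed

text \<open>The kernel need not be normalised.\<close>

lemma conv_approx:
  fixes \<kappa> :: "complex \<Rightarrow> real"
  assumes \<kappa>: "integrable lborel \<kappa>" "\<And>z. 0 \<le> \<kappa> z" "\<And>z. e \<le> norm z \<Longrightarrow> \<kappa> z = 0"
    and g: "integrable lborel (\<lambda>v. g v * of_real (\<kappa> (z - v)))"
    and d: "\<And>v. norm (z - v) < e \<Longrightarrow> norm (g v - g z) \<le> d"
  shows "norm (conv g (\<lambda>z. of_real (\<kappa> z)) z - g z * of_real (LBINT z. \<kappa> z)) \<le> d * (LBINT z. \<kappa> z)"
proof -
  have km: "\<kappa> \<in> borel_measurable borel" using \<kappa>(1) by auto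
  have ki: "integrable lborel (\<lambda>v. \<kappa> (z - v))" by (rule integrable_reflect[OF \<kappa>(1)])
  have K: "(LBINT v. \<kappa> (z - v)) = (LBINT v. \<kappa> v)" by (rule integral_reflect[OF km])
  have "conv g (\<lambda>z. of_real (\<kappa> z)) z - g z * of_real (LBINT z. \<kappa> z)
    = (LBINT v. g v * of_real (\<kappa> (z - v)) - g z * of_real (\<kappa> (z - v)))"
    using g ki by (simp add: conv_def K[symmetric])
  also have "norm \<dots> \<le> (LBINT v. d * \<kappa> (z - v))"
  proof (rule Bochner_Integration.integral_norm_bound_integral)
    show "integrable lborel (\<lambda>v. g v * of_real (\<kappa> (z - v)) - g z * of_real (\<kappa> (z - v)))"
      using g ki by simp
    show "integrable lborel (\<lambda>v. d * \<kappa> (z - v))" using ki by simp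
    fix v
    show "norm (g v * of_real (\<kappa> (z - v)) - g z * of_real (\<kappa> (z - v))) \<le> d * \<kappa> (z - v)"
    proof (cases "norm (z - v) < e")
      case True
      then show ?thesis
        using d[OF True] \<kappa>(2) by (simp add: left_diff_distrib[symmetric] norm_mult mult_right_mono)
    next
      case False then show ?thesis using \<kappa>(3) by simp
    qed
  qed
  also have "\<dots> = d * (LBINT z. \<kappa> z)" by (simp add: K)
  finally show ?thesis .
qed

text \<open>The weak form of dbar h = 0, as \<open>\<phi>x + \<i> * \<phi>y\<close> is twice the
  dbar derivative of the test function.\<close>

definition weakly_holomorphic_on :: "(complex \<Rightarrow> complex) \<Rightarrow> complex set \<Rightarrow> bool" where
  "weakly_holomorphic_on h V \<longleftrightarrow> (\<forall>\<phi> \<phi>x \<phi>y. C1_test V \<phi> \<phi>x \<phi>y \<longrightarrow>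
     (LBINT z. h z * (\<phi>x z + \<i> * \<phi>y z)) = 0)"

text \<open>Two regularised Cauchy kernels differ by a compactly supported function, so testing with
  the difference shows that the mollification of \<open>h\<close> does not depend on the scale.\<close>

lemma weakly_holomorphic_mean_value:
  assumes V: "open V" "continuous_on V h" and w: "weakly_holomorphic_on h V"
    and r: "0 < r" "cball z r \<subseteq> V"
  shows "conv h (\<lambda>z. of_real (mollifier r z)) z = h z * of_real moll_mass"
proof -
  have int: "integrable lborel (\<lambda>v. h v * of_real (mollifier e (z - v)))" if "0 < e" "e \<le> r" for e
  proof (rule integrable_cutoff[OF V, of _ "cball z r"])
    show "continuous_on UNIV (\<lambda>v. of_real (mollifier e (z - v)) :: complex)"
      by (intro continuous_intros continuous_on_compose2[OF mollifier_facts(4)[OF that(1)]]) auto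
    show "v \<notin> cball z r \<Longrightarrow> of_real (mollifier e (z - v)) = (0::complex)" for v
      using that mollifier_facts(3)[of e "z - v"] by (simp add: dist_norm)
  qed (use r in auto)
  have same: "conv h (\<lambda>z. of_real (mollifier e z)) z = conv h (\<lambda>z. of_real (mollifier r z)) z"
    if e: "0 < e" "e \<le> r" for e
  proof -
    note C = C1_partials_reflect[OF C1_partials_diff[OF C1_partials_cauchy_ker[of e] C1_partials_cauchy_ker[of r]], of z]
    have "C1_test V (\<lambda>v. cauchy_ker e (z - v) - cauchy_ker r (z - v))
      (\<lambda>v. - (cauchy_ker_x e (z - v) - cauchy_ker_x r (z - v)))
      (\<lambda>v. - (cauchy_ker_y e (z - v) - cauchy_ker_y r (z - v)))"
      unfolding C1_test_def
    proof (intro conjI exI[of _ "cball z r"] allI impI)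
      fix v assume "v \<notin> cball z r"
      then show "cauchy_ker e (z - v) - cauchy_ker r (z - v) = 0"
        using e by (simp add: dist_norm cauchy_ker_far)
    qed (use C r in auto)
    then have "0 = (LBINT v. h v * (- (cauchy_ker_x e (z - v) - cauchy_ker_x r (z - v))
        + \<i> * - (cauchy_ker_y e (z - v) - cauchy_ker_y r (z - v))))"
      using w unfolding weakly_holomorphic_on_def by fastforce
    also have "\<dots> = (LBINT v. 2 * (h v * of_real (mollifier r (z - v)) - h v * of_real (mollifier e (z - v))))"
    proof (rule Bochner_Integration.integral_cong[OF refl])
      fix v
      have "- (cauchy_ker_x e (z - v) - cauchy_ker_x r (z - v)) + \<i> * - (cauchy_ker_y e (z - v) - cauchy_ker_y r (z - v))
        = (cauchy_ker_x r (z - v) + \<i> * cauchy_ker_y r (z - v)) - (cauchy_ker_x e (z - v) + \<i> * cauchy_ker_y e (z - v))"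
        by (simp add: algebra_simps)
      then show "h v * (- (cauchy_ker_x e (z - v) - cauchy_ker_x r (z - v)) + \<i> * - (cauchy_ker_y e (z - v) - cauchy_ker_y r (z - v)))
        = 2 * (h v * of_real (mollifier r (z - v)) - h v * of_real (mollifier e (z - v)))"
        unfolding cauchy_ker_dbar by (simp only:) (simp add: algebra_simps)
    qed
    also have "\<dots> = 2 * (conv h (\<lambda>z. of_real (mollifier r z)) z - conv h (\<lambda>z. of_real (mollifier e z)) z)"
      unfolding conv_def integral_mult_right_zero
      by (subst Bochner_Integration.integral_diff) (use int[OF e] int[OF r(1) order_refl] in auto)
    finally show ?thesis by simp
  qed
  \<comment> \<open>By \<open>same\<close> the left side does not change when the scale r is
    replaced by a smaller e, and at a small scale continuity of \<open>h\<close> at \<open>z\<close>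
    makes it small.\<close>
  have "norm (conv h (\<lambda>z. of_real (mollifier r z)) z - h z * of_real moll_mass) \<le> 0"
  proof (rule field_le_epsilon)
    fix d :: real assume d: "0 < d"
    have "z \<in> V" using r by auto
    then have "isCont h z" using V by (simp add: continuous_on_eq_continuous_at)
    then obtain s where s: "0 < s" "\<forall>v. norm (v - z) < s \<longrightarrow> norm (h v - h z) < d / moll_mass"
      unfolding continuous_at_eps_delta dist_norm using divide_pos_pos[OF d moll_mass_pos] by blast
    define e where "e = min s r"
    have e: "0 < e" "e \<le> r" using s r by (auto simp: e_def)
    have "norm (conv h (\<lambda>z. of_real (mollifier e z)) z - h z * of_real (LBINT z. mollifier e z))
      \<le> d / moll_mass * (LBINT z. mollifier e z)"
      using s by (intro conv_approx[where e = e] mollifier_facts e int)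
        (auto simp: e_def norm_minus_commute intro!: less_imp_le)
    then show "norm (conv h (\<lambda>z. of_real (mollifier r z)) z - h z * of_real moll_mass) \<le> 0 + d"
      using moll_mass_pos by (simp add: mollifier_integral[OF e(1)] same[OF e])
  qed
  then show ?thesis by simp
qed

lemma C1_partials_field_differentiable:
  assumes "C1_partials H Hx Hy" "Hx z + \<i> * Hy z = 0"
  shows "H field_differentiable (at z)"
proof -
  have "Hy z = \<i> * Hx z"
    using arg_cong[OF assms(2), of "\<lambda>x. \<i> * x"] by (simp add: distrib_left mult.assoc[symmetric])
  then have "(\<lambda>h. Re h *\<^sub>R Hx z + Im h *\<^sub>R Hy z) = (*) (Hx z)"
    by (auto simp: fun_eq_iff complex_eq_iff algebra_simps)
  then have "(H has_derivative (*) (Hx z)) (at z)" using C1_partialsD(1)[OF assms(1), of z] by (simp only:)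
  then show ?thesis unfolding field_differentiable_def has_field_derivative_def by blast
qed

text \<open>The mean value identity writes \<open>h\<close> locally as a convolution with a C^1
  kernel, so \<open>h\<close> is differentiable. The dbar derivative of this convolution at a point
  is the integral of \<open>h\<close> against that of a translated mollifier, which vanishes by
  assumption.\<close>

theorem weyl_lemma:
  assumes V: "open V" "continuous_on V h" and w: "weakly_holomorphic_on h V"
  shows "h holomorphic_on V"
proof -
  have "h field_differentiable (at z0)" if z0: "z0 \<in> V" for z0
  proof -
    obtain R where R: "0 < R" "cball z0 R \<subseteq> V" using V(1) z0 open_contains_cball by blast
    define r where "r = R / 2"
    have r: "0 < r" "cball z0 (2 * r) \<subseteq> V" using R by (auto simp: r_def)
    obtain mx my where m: "C1_partials (\<lambda>z. of_real (mollifier r z)) mx my"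
      "\<And>z. norm (mx z) \<le> 12 / r ^ 3" "\<And>z. norm (my z) \<le> 12 / r ^ 3"
      using C1_partials_mollifier[of r] r(1) by blast
    \<comment> \<open>\<open>h\<close> is cut off to be integrable on the whole plane. For z within
      r of z0 the mollifier centred at z lives inside the cut, so the convolution does not notice
      it.\<close>
    define a where "a v = indicator (cball z0 (2 * r)) v *\<^sub>R h v" for v
    have a: "integrable lborel a"
      unfolding a_def by (intro borel_integrable_compact continuous_on_subset[OF V(2)] r) auto
    have C: "C1_partials (conv a (\<lambda>z. of_real (mollifier r z))) (conv a mx) (conv a my)"
      by (rule C1_partials_conv[OF a m(1), of "3 / r\<^sup>2" "12 / r ^ 3"])
         (use m mollifier_facts(1,2)[OF r(1)] in auto)
    have sub: "cball z r \<subseteq> cball z0 (2 * r)" if "z \<in> ball z0 r" for z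
    proof
      fix v assume "v \<in> cball z r"
      then show "v \<in> cball z0 (2 * r)"
        using that dist_triangle[of z0 v z] by auto
    qed
    have mz: "z \<in> ball z0 r \<Longrightarrow> v \<notin> cball z0 (2 * r) \<Longrightarrow> mollifier r (z - v) = 0" for z v
      using sub[of z] mollifier_facts(3)[OF r(1), of "z - v"] by (force simp: dist_norm)
    have rep: "h z = conv a (\<lambda>z. of_real (mollifier r z)) z / of_real moll_mass" if z: "z \<in> ball z0 r" for z
    proof -
      have "conv a (\<lambda>z. of_real (mollifier r z)) z = conv h (\<lambda>z. of_real (mollifier r z)) z"
        unfolding conv_def a_def using mz[OF z]
        by (intro Bochner_Integration.integral_cong) (auto simp: indicator_def)
      also have "\<dots> = h z * of_real moll_mass"
        using weakly_holomorphic_mean_value[OF V w r(1), of z] sub[OF z] r(2) by blast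
      finally show ?thesis using moll_mass_pos by simp
    qed
    \<comment> \<open>The Cauchy-Riemann equation at z0: the test function is the reflected
      mollifier \<open>mollifier r (z0 - v)\<close>, whose partials vanish where \<open>a\<close>
      and \<open>h\<close> differ.\<close>
    have cr: "conv a mx z0 + \<i> * conv a my z0 = 0"
    proof -
      have "C1_test V (\<lambda>v. of_real (mollifier r (z0 - v))) (\<lambda>v. - mx (z0 - v)) (\<lambda>v. - my (z0 - v))"
        unfolding C1_test_def using C1_partials_reflect[OF m(1), of z0] mz[of z0] r
        by (intro conjI exI[of _ "cball z0 (2 * r)"]) auto
      then have "0 = (LBINT v. h v * (- mx (z0 - v) + \<i> * - my (z0 - v)))"
        using w unfolding weakly_holomorphic_on_def by fastforce
      also have "\<dots> = (LBINT v. - (a v * mx (z0 - v) + \<i> * (a v * my (z0 - v))))"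
      proof (rule Bochner_Integration.integral_cong[OF refl])
        fix v
        have "mx (z0 - v) = 0 \<and> my (z0 - v) = 0" if "v \<notin> cball z0 (2 * r)"
        proof -
          have "z0 - v \<notin> cball 0 r" using that r(1) by (simp add: dist_norm norm_minus_commute)
          then show ?thesis
            using C1_partials_zero_outside[OF m(1), of "cball 0 r" "z0 - v"] mollifier_facts(3)[OF r(1)]
            by (auto simp: not_le)
        qed
        then show "h v * (- mx (z0 - v) + \<i> * - my (z0 - v)) = - (a v * mx (z0 - v) + \<i> * (a v * my (z0 - v)))"
          by (cases "v \<in> cball z0 (2 * r)") (auto simp: a_def algebra_simps)
      qed
      also have "\<dots> = - (conv a mx z0 + \<i> * conv a my z0)"
        using conv_integrable[OF a C1_partialsD(2)[OF m(1)] m(2)] conv_integrable[OF a C1_partialsD(3)[OF m(1)] m(3)]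
        by (simp add: conv_def)
      finally show ?thesis unfolding eq_commute[of 0] neg_equal_0_iff_equal .
    qed
    have "conv a (\<lambda>z. of_real (mollifier r z)) field_differentiable (at z0)"
      by (rule C1_partials_field_differentiable[OF C cr])
    then have "(\<lambda>z. conv a (\<lambda>z. of_real (mollifier r z)) z / of_real moll_mass) field_differentiable (at z0)"
      by (intro field_differentiable_divide) (use moll_mass_pos in auto)
    then obtain D where "((\<lambda>z. conv a (\<lambda>z. of_real (mollifier r z)) z / of_real moll_mass) has_field_derivative D) (at z0)"
      unfolding field_differentiable_def by blast
    then have "(h has_field_derivative D) (at z0)"
      by (rule has_field_derivative_transform_within_open[of _ _ _ "ball z0 r"]) (use rep r in auto)
    then show ?thesis unfolding field_differentiable_def by blast
  qed
  then show ?thesis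
    unfolding holomorphic_on_def using V(1) field_differentiable_at_within by blast
qed

section \<open>Riesz potentials\<close>

lemma emeasure_ball_complex: "0 \<le> r \<Longrightarrow> emeasure lborel (ball (z::complex) r) = ennreal (pi * r\<^sup>2)"
  by (simp add: emeasure_ball unit_ball_vol_2)

lemma dyadic_scale:
  fixes r \<rho> :: real
  assumes "0 < r" "r < \<rho>"
  shows "\<exists>n. \<rho> / 2 ^ Suc n \<le> r \<and> r < \<rho> / 2 ^ n"
proof -
  obtain N where N: "\<rho> / r < 2 ^ N" using real_arch_pow[of 2 "\<rho> / r"] by auto
  define M where "M = (LEAST n. \<rho> \<le> 2 ^ n * r)"
  have ex: "\<rho> \<le> 2 ^ N * r" using N assms by (simp add: field_simps)
  have M: "\<rho> \<le> 2 ^ M * r" unfolding M_def by (rule LeastI[of _ N]) (rule ex)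
  have "M \<noteq> 0" using M assms by (cases "M = 0") auto
  then obtain n where n: "M = Suc n" by (cases M) auto
  have "\<not> \<rho> \<le> 2 ^ n * r" using not_less_Least[of n "\<lambda>n. \<rho> \<le> 2 ^ n * r"] n unfolding M_def by simp
  then show ?thesis using M n assms by (intro exI[of _ n]) (simp add: field_simps)
qed

text \<open>Dyadic shells around z: on the n-th one the kernel is at most a multiple of 2^(n t), and
  the area is at most a multiple of 4^(-n). The sum is geometric with ratio 2^(t - 2), which is
  below 1 exactly when t < 2.\<close>

lemma riesz_ball_bound:
  assumes t: "0 \<le> t" "t < 2"
  shows "\<exists>C\<ge>0. \<forall>\<rho>>0. \<forall>z::complex.
    (\<integral>\<^sup>+v. indicator (ball z \<rho>) v * ennreal (1 / norm (z - v) powr t) \<partial>lborel) \<le> ennreal (C * \<rho> powr (2 - t))"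
proof -
  define x where "x = (2::real) powr (t - 2)"
  have x: "0 \<le> x" "x < 1" using t by (auto simp: x_def powr_less_one)
  define C where "C = pi * 2 powr t * (1 / (1 - x))"
  have "(\<integral>\<^sup>+v. indicator (ball z \<rho>) v * ennreal (1 / norm (z - v) powr t) \<partial>lborel) \<le> ennreal (C * \<rho> powr (2 - t))"
    if \<rho>: "0 < \<rho>" for \<rho> and z :: complex
  proof -
    \<comment> \<open>The bound of the kernel where the distance to z is at least
      \<open>\<rho> / 2 ^ Suc n\<close>.\<close>
    define c where "c n = (2 ^ Suc n / \<rho>) powr t" for n :: nat
    have "(\<integral>\<^sup>+v. indicator (ball z \<rho>) v * ennreal (1 / norm (z - v) powr t) \<partial>lborel)
      \<le> (\<integral>\<^sup>+v. (\<Sum>n. ennreal (c n) * indicator (ball z (\<rho> / 2 ^ n)) v) \<partial>lborel)"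
    proof (rule nn_integral_mono)
      fix v
      show "indicator (ball z \<rho>) v * ennreal (1 / norm (z - v) powr t)
        \<le> (\<Sum>n. ennreal (c n) * indicator (ball z (\<rho> / 2 ^ n)) v)"
      \<comment> \<open>At v = z the integrand is 0: \<open>0 powr t\<close> is 0, and so is
        division by it.\<close>
      proof (cases "v \<in> ball z \<rho> \<and> v \<noteq> z")
        case True
        define r where "r = norm (z - v)"
        have r: "0 < r" "r < \<rho>" using True by (auto simp: r_def dist_norm)
        from dyadic_scale[OF this] obtain n where n: "\<rho> / 2 ^ Suc n \<le> r" "r < \<rho> / 2 ^ n" by blast
        have "1 / r powr t = (1 / r) powr t" using r by (simp add: powr_divide)
        also have "\<dots> \<le> c n" unfolding c_def
          using n r \<rho> t by (intro powr_mono2) (auto simp: field_simps)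
        finally have "ennreal (1 / r powr t) \<le> ennreal (c n) * indicator (ball z (\<rho> / 2 ^ n)) v"
          using n by (simp add: r_def dist_norm ennreal_leI)
        also have "\<dots> \<le> (\<Sum>n. ennreal (c n) * indicator (ball z (\<rho> / 2 ^ n)) v)"
          using sum_le_suminf[of "\<lambda>n. ennreal (c n) * indicator (ball z (\<rho> / 2 ^ n)) v" "{n}"]
          by (simp del: sum_mult_indicator sum.inter_filter)
        finally show ?thesis using True by (simp add: r_def)
      qed (auto simp: indicator_def)
    qed
    also have "\<dots> = (\<Sum>n. ennreal (c n) * ennreal (pi * (\<rho> / 2 ^ n)\<^sup>2))"
    proof -
      have [measurable]: "(\<lambda>v. indicator (ball z r) v :: ennreal) \<in> borel_measurable borel" for r
        by (intro borel_measurable_indicator) auto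
      show ?thesis
        using \<rho> by (subst nn_integral_suminf) (simp_all add: nn_integral_cmult emeasure_ball_complex del: nn_integral_const)
    qed
    also have "\<dots> = (\<Sum>n. ennreal (pi * 2 powr t * \<rho> powr (2 - t) * x ^ n))"
    proof (rule suminf_cong)
      fix n
      have "c n * (pi * (\<rho> / 2 ^ n)\<^sup>2) = pi * 2 powr t * \<rho> powr (2 - t) * x ^ n"
      proof -
        have "c n = 2 powr t * (2 powr real n) powr t / \<rho> powr t"
          using \<rho> by (simp add: c_def powr_divide powr_mult powr_realpow)
        moreover have "(\<rho> / 2 ^ n)\<^sup>2 = \<rho> powr 2 * (2 powr real n) powr - 2"
          using \<rho> by (simp add: power_divide powr_minus_divide powr_realpow)
        moreover have "x ^ n = (2 powr real n) powr t * (2 powr real n) powr - 2"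
          unfolding x_def by (simp add: powr_add[symmetric] powr_powr powr_realpow[symmetric] algebra_simps)
        moreover have "\<rho> powr (2 - t) = \<rho> powr 2 / \<rho> powr t" by (simp add: powr_diff)
        ultimately show ?thesis by simp
      qed
      then show "ennreal (c n) * ennreal (pi * (\<rho> / 2 ^ n)\<^sup>2) = ennreal (pi * 2 powr t * \<rho> powr (2 - t) * x ^ n)"
        by (subst ennreal_mult'[symmetric]) (simp add: c_def, simp only:)
    qed
    also have "\<dots> = ennreal (pi * 2 powr t * \<rho> powr (2 - t) * (1 / (1 - x)))"
      using x by (intro suminf_ennreal_eq sums_mult geometric_sums) auto
    finally show ?thesis by (simp add: C_def mult_ac)
  qed
  moreover have "0 \<le> C" using x by (simp add: C_def)
  ultimately show ?thesis by blast
qed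

text \<open>Young's inequality in a crude form: according to whether 1 / r^s is below A^(q - 1) or
  not, one of the two terms on the right dominates alone. The exponent of r is s times the conjugate
  exponent of q.\<close>

lemma young_powr:
  fixes A r s q :: real
  assumes "0 < A" "0 < r" "1 < q"
  shows "A / r powr s \<le> A powr q + 1 / r powr (s * q / (q - 1))"
proof (cases "1 / r powr s \<le> A powr (q - 1)")
  case True
  have "A / r powr s \<le> A * A powr (q - 1)"
    using mult_left_mono[OF True, of A] assms by simp
  also have "\<dots> = A powr q" using assms by (simp add: powr_mult_base)
  finally show ?thesis using assms by (simp add: add_increasing2)
next
  case False
  have "A = (A powr (q - 1)) powr (1 / (q - 1))" using assms by (simp add: powr_powr)
  also have "\<dots> \<le> (1 / r powr s) powr (1 / (q - 1))"
    using False assms by (intro powr_mono2) auto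
  also have "\<dots> = 1 / r powr (s / (q - 1))" using assms by (simp add: powr_divide powr_powr)
  finally have "A / r powr s \<le> 1 / r powr (s / (q - 1)) / r powr s" by (intro divide_right_mono) auto
  also have "\<dots> = 1 / r powr (s * q / (q - 1))"
  proof -
    have "s / (q - 1) + s = s * q / (q - 1)" using assms by (simp add: field_simps)
    then show ?thesis by (simp add: powr_add[symmetric])
  qed
  finally show ?thesis by (simp add: add_increasing)
qed

text \<open>Measuring only the set where |a| > 1 lets one finite exponent serve all cases: for
  bounded W this set is null, and for finite p the integral is at most that of |W|^p.\<close>

definition unit_excess :: "real \<Rightarrow> (complex \<Rightarrow> complex) \<Rightarrow> ennreal" where
  "unit_excess q a = (\<integral>\<^sup>+v. indicator {v. 1 < norm (a v)} v * ennreal (norm (a v) powr q) \<partial>lborel)"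

text \<open>Where |a| \<le> 1, the kernel integrates to O(\<rho>). Where |a| > 1, the excess
  controls \<open>a\<close> far from z, and near z \<open>young_powr\<close> trades it for a kernel
  of exponent s q / (q - 1), which is locally integrable because that exponent is below 2.\<close>

lemma potential_bound:
  fixes q s :: real
  assumes q: "1 < q" and s: "1 \<le> s" "s * q / (q - 1) < 2"
  shows "\<exists>C\<ge>0. \<forall>\<rho>\<ge>1. \<forall>a z. a \<in> borel_measurable borel \<longrightarrow> (\<forall>v. v \<notin> ball 0 \<rho> \<longrightarrow> a v = 0) \<longrightarrow>
     unit_excess q a \<le> 1 \<longrightarrow>
     (\<integral>\<^sup>+v. ennreal (norm (a v) / norm (z - v) powr s) \<partial>lborel) \<le> ennreal (C * \<rho>)"
proof -
  define t where "t = s * q / (q - 1)"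
  have t: "0 \<le> t" "t < 2" using q s by (auto simp: t_def)
  have st: "s \<le> t" using q s by (simp add: t_def field_simps)
  have s2: "0 \<le> s" "s < 2" using st t s by auto
  obtain C1 where C1: "0 \<le> C1" "\<And>\<rho> (z::complex). 0 < \<rho> \<Longrightarrow>
     (\<integral>\<^sup>+v. indicator (ball z \<rho>) v * ennreal (1 / norm (z - v) powr 1) \<partial>lborel) \<le> ennreal (C1 * \<rho> powr (2 - 1))"
    using riesz_ball_bound[of 1] by auto
  obtain C2 where C2: "0 \<le> C2" "\<And>\<rho> (z::complex). 0 < \<rho> \<Longrightarrow>
     (\<integral>\<^sup>+v. indicator (ball z \<rho>) v * ennreal (1 / norm (z - v) powr s) \<partial>lborel) \<le> ennreal (C2 * \<rho> powr (2 - s))"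
    using riesz_ball_bound[OF s2] by auto
  obtain C3 where C3: "0 \<le> C3" "\<And>\<rho> (z::complex). 0 < \<rho> \<Longrightarrow>
     (\<integral>\<^sup>+v. indicator (ball z \<rho>) v * ennreal (1 / norm (z - v) powr t) \<partial>lborel) \<le> ennreal (C3 * \<rho> powr (2 - t))"
    using riesz_ball_bound[OF t] by auto
  have "(\<integral>\<^sup>+v. ennreal (norm (a v) / norm (z - v) powr s) \<partial>lborel) \<le> ennreal ((C1 + C2 + C3 + pi + 1) * \<rho>)"
    if \<rho>: "1 \<le> \<rho>" and am[measurable]: "a \<in> borel_measurable borel" and a0: "\<And>v. v \<notin> ball 0 \<rho> \<Longrightarrow> a v = 0"
      and ex: "unit_excess q a \<le> 1" for \<rho> a z
  proof -
    \<comment> \<open>The first three majorants treat |a| \<le> 1 at distance below 1, between 1 and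
      \<rho>, and at least \<rho> from z. The third occurs because z need not lie near the support;
      it uses 1/r \<le> 1/\<rho> on a disc of area pi \<rho>^2. The last two treat |a| > 1:
      \<open>?E\<close> alone at distance at least 1, both together nearer to z.\<close>
    let ?A = "\<lambda>v. indicator (ball z 1) v * ennreal (1 / norm (z - v) powr s)"
    let ?B = "\<lambda>v. indicator (ball z \<rho>) v * ennreal (1 / norm (z - v) powr 1)"
    let ?D = "\<lambda>v. indicator (ball (0::complex) \<rho>) v * ennreal (1 / \<rho>) :: ennreal"
    let ?E = "\<lambda>v. indicator {v. 1 < norm (a v)} v * ennreal (norm (a v) powr q)"
    let ?F = "\<lambda>v. indicator (ball z 1) v * ennreal (1 / norm (z - v) powr t)"
    have "(\<integral>\<^sup>+v. ennreal (norm (a v) / norm (z - v) powr s) \<partial>lborel)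
      \<le> (\<integral>\<^sup>+v. ?A v + (?B v + (?D v + (?E v + ?F v))) \<partial>lborel)"
    proof (rule nn_integral_mono)
      fix v :: complex
      define r where "r = norm (z - v)"
      define A where "A = norm (a v)"
      show "ennreal (norm (a v) / norm (z - v) powr s) \<le> ?A v + (?B v + (?D v + (?E v + ?F v)))"
      proof (cases "A = 0 \<or> r = 0")
        case False
        then have Ar: "0 < A" "0 < r" "v \<in> ball 0 \<rho>" using a0 by (auto simp: A_def r_def)
        have r1: "1 / r powr s \<le> 1 / r" if "1 \<le> r"
          using that s powr_mono[of 1 s r] by (simp add: frac_le)
        consider "A \<le> 1" "r < 1" | "A \<le> 1" "1 \<le> r" "r < \<rho>" | "A \<le> 1" "\<rho> \<le> r" | "1 < A" "1 \<le> r" | "1 < A" "r < 1"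
          by linarith
        then show ?thesis
        proof cases
          case 1
          have "A / r powr s \<le> 1 / r powr s" using 1 by (intro divide_right_mono) auto
          then have "ennreal (A / r powr s) \<le> ?A v" using 1 by (simp add: r_def dist_norm ennreal_leI)
          then show ?thesis unfolding A_def r_def by (rule order_trans) simp
        next
          case 2
          have "A / r powr s \<le> 1 / r powr s" using 2 by (intro divide_right_mono) auto
          then have "A / r powr s \<le> 1 / r powr 1" using r1 2 Ar by simp
          then have "ennreal (A / r powr s) \<le> ?B v" using 2 by (simp add: r_def dist_norm ennreal_leI)
          then show ?thesis unfolding A_def r_def by (rule order_trans) (simp add: add_increasing)
        next
          case 3
          have "A / r powr s \<le> 1 / r powr s" using 3 by (intro divide_right_mono) auto
          also have "\<dots> \<le> 1 / \<rho>" using r1 3 \<rho> by (intro order_trans[OF r1] frac_le) auto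
          finally have "ennreal (A / r powr s) \<le> ?D v" using Ar by (simp add: ennreal_leI)
          then show ?thesis unfolding A_def r_def by (rule order_trans) (simp add: add_increasing)
        next
          case 4
          have "1 \<le> r powr s" using 4 s2 by (simp add: ge_one_powr_ge_zero)
          then have "A / r powr s \<le> A / 1" using Ar by (intro divide_left_mono) auto
          also have "\<dots> \<le> A powr q" using 4 q powr_mono[of 1 q A] by simp
          finally have "ennreal (A / r powr s) \<le> ?E v" using 4 by (simp add: A_def ennreal_leI)
          then show ?thesis unfolding A_def r_def by (rule order_trans) (simp add: add_increasing)
        next
          case 5
          have "A / r powr s \<le> A powr q + 1 / r powr t" unfolding t_def by (rule young_powr) (use Ar q in auto)
          then have "ennreal (A / r powr s) \<le> ?E v + ?F v"
            using 5 Ar by (simp add: A_def r_def dist_norm ennreal_leI ennreal_plus[symmetric] del: ennreal_plus)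
          then show ?thesis unfolding A_def r_def by (rule order_trans) (simp add: add_increasing)
        qed
      qed (auto simp: A_def r_def)
    qed
    also have "\<dots> = (\<integral>\<^sup>+v. ?A v \<partial>lborel) + ((\<integral>\<^sup>+v. ?B v \<partial>lborel) + ((\<integral>\<^sup>+v. ?D v \<partial>lborel) + ((\<integral>\<^sup>+v. ?E v \<partial>lborel) + (\<integral>\<^sup>+v. ?F v \<partial>lborel))))"
    proof -
      have m: "?A \<in> borel_measurable lborel" "?B \<in> borel_measurable lborel" "?D \<in> borel_measurable lborel"
        "?E \<in> borel_measurable lborel" "?F \<in> borel_measurable lborel"
        by (intro borel_measurable_times_ennreal borel_measurable_indicator; measurable)+
      have "(\<integral>\<^sup>+v. A v + (B v + (D v + (E v + F v))) \<partial>lborel) = integral\<^sup>N lborel A +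
          (integral\<^sup>N lborel B + (integral\<^sup>N lborel D + (integral\<^sup>N lborel E + integral\<^sup>N lborel F)))"
        if "A \<in> borel_measurable lborel" "B \<in> borel_measurable lborel" "D \<in> borel_measurable lborel"
        "E \<in> borel_measurable lborel" "F \<in> borel_measurable lborel" for A B D E F :: "complex \<Rightarrow> ennreal"
        using that by (simp add: nn_integral_add)
      from this[OF m] show ?thesis .
    qed
    also have "\<dots> \<le> ennreal C2 + (ennreal (C1 * \<rho>) + (ennreal (pi * \<rho>) + (1 + ennreal C3)))"
    proof (intro add_mono)
      show "integral\<^sup>N lborel ?A \<le> ennreal C2" using C2(2)[of 1 z] by simp
      show "integral\<^sup>N lborel ?B \<le> ennreal (C1 * \<rho>)" using C1(2)[of \<rho> z] \<rho> by simp
      show "integral\<^sup>N lborel ?D \<le> ennreal (pi * \<rho>)"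
      proof -
        have "integral\<^sup>N lborel ?D = emeasure lborel (ball (0::complex) \<rho>) * ennreal (1 / \<rho>)"
          by (subst nn_integral_multc) (auto intro!: borel_measurable_indicator)
        also have "\<dots> = ennreal (pi * \<rho>)"
          using \<rho> by (simp add: emeasure_ball_complex ennreal_mult'[symmetric] power2_eq_square)
        finally show ?thesis by simp
      qed
      show "integral\<^sup>N lborel ?E \<le> 1" using ex by (simp add: unit_excess_def)
      show "integral\<^sup>N lborel ?F \<le> ennreal C3" using C3(2)[of 1 z] by simp
    qed
    also have "\<dots> = ennreal (C2 + (C1 * \<rho> + (pi * \<rho> + (1 + C3))))"
      using C1(1) C2(1) C3(1) \<rho> by (simp add: ennreal_plus)
    also have "\<dots> \<le> ennreal ((C1 + C2 + C3 + pi + 1) * \<rho>)"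
    proof (rule ennreal_leI)
      have "C2 * 1 \<le> C2 * \<rho>" "C3 * 1 \<le> C3 * \<rho>" using C2(1) C3(1) \<rho> by (intro mult_left_mono; simp)+
      then show "C2 + (C1 * \<rho> + (pi * \<rho> + (1 + C3))) \<le> (C1 + C2 + C3 + pi + 1) * \<rho>"
        using \<rho> by (simp add: distrib_right)
    qed
    finally show ?thesis .
  qed
  moreover have "0 \<le> C1 + C2 + C3 + pi + 1" using C1(1) C2(1) C3(1) by simp
  ultimately show ?thesis by blast
qed

section \<open>Comparison in the annulus\<close>

text \<open>The comparison function is the Green's function \<open>G\<close> of the exterior of the disc of radius
  \<open>3/2\<close> with pole \<open>z0\<close>, corrected by \<open>(1 - 1/N) log (2|z|/3)\<close> so that it becomes nonpositive on
  \<open>|z| = 10 R\<close>; as \<open>N\<close> is about \<open>log R\<close>, it keeps a value of order \<open>1 / log R\<close> at distance \<open>3\<close>.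
  Integer exponents make the comparison an application of the maximum modulus principle.\<close>

lemma three_boundary_estimate:
  fixes h :: "complex \<Rightarrow> complex" and R E c m :: real and j N :: nat
  assumes R: "8 \<le> R" and z0: "norm z0 = R"
    and hol: "h holomorphic_on {z. 1 < norm z \<and> norm z < 20 * R}"
    and hE: "\<And>z. 1 < norm z \<Longrightarrow> norm z < 20 * R \<Longrightarrow> norm (h z) \<le> E"
    and hm: "\<And>z. dist z0 z = 1 / 2 \<Longrightarrow> norm (h z) \<le> m"
    and hc: "c \<le> norm (h (of_real (3 / R) * z0))"
    and N: "1 \<le> N" "7 * R \<le> 8 ^ N" and j: "E < c * 2 ^ j" "0 \<le> c" "0 \<le> E"
  shows "c * 2 ^ j \<le> m * R ^ (3 * j * N)"
proof -
  \<comment> \<open>|G| is 1 on |z| = 3/2, where 9/4 = z * cnj z, and G has its pole at z0; log |G|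
    is the Green's function.\<close>
  define G where "G z = (9 / 4 - z * cnj z0) / (3 / 2 * (z - z0))" for z
  \<comment> \<open>log |H| - log |h| is j N times the comparison function, which explains the
    exponents N and N - 1 inside the power j.\<close>
  define H where "H z = h z * (G z ^ N * (3 / 2 / z) ^ (N - 1)) ^ j" for z
  define S where "S = {z. 3 / 2 < norm z \<and> norm z < 10 * R} - cball z0 (1 / 2)"
  define T where "T = {z. 3 / 2 \<le> norm z \<and> norm z \<le> 10 * R} - ball z0 (1 / 2)"
  define z1 where "z1 = of_real (3 / R) * z0"
  have S: "open S"
    unfolding S_def by (intro open_Diff open_Collect_conj open_Collect_less continuous_intros) auto
  have T: "closed T"
    unfolding T_def by (intro closed_Diff closed_Collect_conj closed_Collect_le continuous_intros) auto
  have clos: "closure S \<subseteq> T" by (rule closure_minimal[OF _ T]) (auto simp: S_def T_def)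
  have TD: "T \<subseteq> {z. 1 < norm z \<and> norm z < 20 * R} - {z0}" using R by (auto simp: T_def)
  have front: "norm z = 3 / 2 \<or> norm z = 10 * R \<or> dist z0 z = 1 / 2" "z \<in> T" if "z \<in> frontier S" for z
  proof -
    have "z \<in> closure S" "z \<notin> S" using that S by (auto simp: frontier_def interior_open)
    then show "z \<in> T" using clos by auto
    then show "norm z = 3 / 2 \<or> norm z = 10 * R \<or> dist z0 z = 1 / 2"
      using \<open>z \<notin> S\<close> by (auto simp: S_def T_def)
  qed
  have holH: "H holomorphic_on T"
    unfolding H_def G_def using TD
    by (intro holomorphic_intros holomorphic_on_subset[OF hol]) auto
  have le: "norm (H z) \<le> max E (m * R ^ (3 * j * N))" if "z \<in> S" for z
  proof (rule maximum_modulus_frontier[of H S])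
    show "H holomorphic_on interior S"
      using clos closure_subset[of S] by (intro holomorphic_on_subset[OF holH]) (auto dest: interiorE)
    show "continuous_on (closure S) H"
      by (rule continuous_on_subset[OF holomorphic_on_imp_continuous_on[OF holH] clos])
    show "bounded S" by (rule bounded_subset[OF bounded_ball[of 0 "10 * R"]]) (auto simp: S_def)
    show "z \<in> S" by fact
    fix w assume w: "w \<in> frontier S"
    note wT = front(2)[OF w]
    have wD: "1 < norm w" "norm w < 20 * R" "w \<noteq> z0" using TD wT by auto
    have nH: "norm (H w) = norm (h w) * (norm (G w) ^ N * (3 / 2 / norm w) ^ (N - 1)) ^ j"
      by (simp add: H_def norm_mult norm_power norm_divide)
    have nG: "norm (G w) = norm (9 / 4 - w * cnj z0) / (3 / 2 * norm (w - z0))"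
      unfolding G_def norm_divide norm_mult by simp
    consider "norm w = 3 / 2" | "norm w = 10 * R" | "dist z0 w = 1 / 2" using front(1)[OF w] by blast
    then show "norm (H w) \<le> max E (m * R ^ (3 * j * N))"
    proof cases
      case 1
      have "9 / 4 - w * cnj z0 = w * cnj (w - z0)"
      proof -
        have "w * cnj w = of_real ((norm w)\<^sup>2)" by (simp only: complex_norm_square)
        then have "w * cnj w = 9 / 4" using 1 by (simp add: power_divide)
        then show ?thesis by (simp add: right_diff_distrib)
      qed
      then have "norm (9 / 4 - w * cnj z0) = norm w * norm (w - z0)" by (simp only: norm_mult complex_mod_cnj)
      then have "norm (G w) = 1" unfolding nG using 1 wD by simp
      moreover have "3 / 2 / norm w = 1" unfolding 1 by simp
      ultimately have "norm (H w) = norm (h w)" unfolding nH by (simp only: power_one mult_1_right)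
      then show ?thesis using hE[OF wD(1,2)] by simp
    next
      case 2
      have a: "norm (9 / 4 - w * cnj z0) \<le> 9 / 4 + 10 * R * R"
        using norm_triangle_ineq4[of "9/4" "w * cnj z0"] 2 z0 by (simp add: norm_mult)
      have b: "9 * R \<le> norm (w - z0)" using norm_triangle_ineq2[of w z0] 2 z0 by simp
      have "norm (G w) \<le> (9 / 4 + 10 * R * R) / (3 / 2 * (9 * R))"
        unfolding nG using a b R by (intro frac_le) auto
      then have "norm (G w) * (3 / 2 / norm w) \<le> (9 / 4 + 10 * R * R) / (3 / 2 * (9 * R)) * (3 / 2 / (10 * R))"
        unfolding 2 using R by (intro mult_right_mono) auto
      also have "\<dots> \<le> 1 / 8"
      proof -
        have "8 * 8 \<le> R * R" using R by (intro mult_mono) auto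
        then show ?thesis using R by (simp add: field_simps)
      qed
      finally have g8: "norm (G w) * (3 / 2 / norm w) \<le> 1 / 8" .
      obtain n where n: "N = Suc n" using N(1) by (cases N) auto
      have x: "0 < 3 / 2 / norm w" using R 2 by simp
      \<comment> \<open>Pairing the factors gives (1/8)^N, with one factor 3/2 / |w| too many. Its
        inverse is 20 R / 3, which \<open>7 * R \<le> 8 ^ N\<close> absorbs.\<close>
      have "norm (G w) ^ N * (3 / 2 / norm w) ^ (N - 1) = (norm (G w) * (3 / 2 / norm w)) ^ N / (3 / 2 / norm w)"
        using x unfolding power_mult_distrib n by simp
      also have "\<dots> \<le> (1 / 8) ^ N / (3 / 2 / norm w)"
        using g8 x by (intro divide_right_mono power_mono mult_nonneg_nonneg) auto
      also have "\<dots> \<le> 1" using N(2) R 2 by (simp add: power_divide field_simps)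
      finally have "(norm (G w) ^ N * (3 / 2 / norm w) ^ (N - 1)) ^ j \<le> 1"
        using x by (intro power_le_one mult_nonneg_nonneg zero_le_power) auto
      then have "norm (H w) \<le> E * 1" unfolding nH
        using hE[OF wD(1,2)] x j(3) by (intro mult_mono zero_le_power mult_nonneg_nonneg) auto
      then show ?thesis by simp
    next
      case 3
      then have d: "norm (w - z0) = 1 / 2" by (simp add: dist_norm norm_minus_commute)
      have w1: "norm w \<le> R + 1 / 2" using norm_triangle_ineq[of "w - z0" z0] d z0 by simp
      have w2: "R - 1 / 2 \<le> norm w" using norm_triangle_ineq2[of z0 "z0 - w"] d z0 by (simp add: norm_minus_commute)
      have "norm (9 / 4 - w * cnj z0) \<le> 9 / 4 + norm w * R"
        using norm_triangle_ineq4[of "9/4" "w * cnj z0"] z0 by (simp add: norm_mult)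
      also have "\<dots> \<le> 9 / 4 + (R + 1 / 2) * R" using w1 R by (intro add_left_mono mult_right_mono) auto
      finally have "norm (G w) \<le> (9 / 4 + (R + 1 / 2) * R) / (3 / 4)" unfolding nG d by simp
      also have "\<dots> \<le> R ^ 3"
      proof -
        have "8 * (R * R) \<le> R ^ 3" using R by (simp add: power3_eq_cube mult_right_mono)
        moreover have "8 * R \<le> R * R" using R by (simp add: mult_right_mono)
        moreover have "(R + 1 / 2) * R = R * R + R / 2" by (simp add: algebra_simps)
        ultimately have "9 / 4 + (R + 1 / 2) * R \<le> R ^ 3 * (3 / 4)" using R by linarith
        then show ?thesis by (simp add: divide_le_eq)
      qed
      finally have g: "norm (G w) \<le> R ^ 3" .
      have "(3 / 2 / norm w) ^ (N - 1) \<le> 1" using w2 R by (intro power_le_one) (auto simp: divide_le_eq)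
      then have "norm (G w) ^ N * (3 / 2 / norm w) ^ (N - 1) \<le> (R ^ 3) ^ N * 1"
        using g R by (intro mult_mono power_mono) auto
      then have "(norm (G w) ^ N * (3 / 2 / norm w) ^ (N - 1)) ^ j \<le> ((R ^ 3) ^ N) ^ j"
        by (intro power_mono) auto
      also have "\<dots> = R ^ (3 * j * N)" by (simp add: power_mult[symmetric] mult_ac)
      finally have "(norm (G w) ^ N * (3 / 2 / norm w) ^ (N - 1)) ^ j \<le> R ^ (3 * j * N)" .
      then have "norm (H w) \<le> m * R ^ (3 * j * N)" unfolding nH
        using hm[OF 3] order_trans[OF norm_ge_zero hm[OF 3]] by (intro mult_mono) auto
      then show ?thesis by simp
    qed
  qed
  have nz1: "norm z1 = 3" using z0 R by (simp add: z1_def norm_mult norm_divide)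
  have dz1: "norm (z1 - z0) = R - 3"
  proof -
    have "z1 - z0 = of_real (3 / R - 1) * z0" by (simp add: z1_def algebra_simps)
    then have "norm (z1 - z0) = \<bar>3 / R - 1\<bar> * R" using z0 by (simp only: norm_mult norm_of_real)
    also have "\<dots> = R - 3" using R by (simp add: abs_if field_simps)
    finally show ?thesis .
  qed
  have "z1 \<in> S" using nz1 dz1 R by (auto simp: S_def dist_norm norm_minus_commute)
  then have fin: "norm (H z1) \<le> max E (m * R ^ (3 * j * N))" by (rule le)
  have "z1 * cnj z0 = of_real (3 * R)"
  proof -
    have "z1 * cnj z0 = of_real (3 / R) * (z0 * cnj z0)" by (simp add: z1_def)
    also have "\<dots> = of_real (3 / R * R\<^sup>2)" unfolding complex_norm_square[symmetric] z0 by simp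
    finally show ?thesis using R by (simp add: power2_eq_square)
  qed
  then have "9 / 4 - z1 * cnj z0 = of_real (9 / 4 - 3 * R)" by simp
  then have "norm (9 / 4 - z1 * cnj z0) = 3 * R - 9 / 4" using R by (simp only: norm_of_real abs_if, simp)
  then have "norm (G z1) = (3 * R - 9 / 4) / (3 / 2 * (R - 3))"
    unfolding G_def norm_divide norm_mult dz1 by simp
  also have "\<dots> \<ge> 2" using R by (simp add: le_divide_eq)
  finally have G2: "2 \<le> norm (G z1)" .
  obtain n where n: "N = Suc n" using N(1) by (cases N) auto
  \<comment> \<open>At distance 3 the two factors are at least 2 and equal to 1/2. The exponents N
    and N - 1 therefore leave a gain of 2, which the power j amplifies to 2^j.\<close>
  have "(2::real) = 2 ^ N * (1 / 2) ^ (N - 1)" unfolding n by (simp add: power_divide)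
  also have "\<dots> \<le> norm (G z1) ^ N * (1 / 2) ^ (N - 1)" using G2 by (intro mult_right_mono power_mono) auto
  finally have "2 ^ j \<le> (norm (G z1) ^ N * (1 / 2) ^ (N - 1)) ^ j" by (intro power_mono) auto
  then have "c * 2 ^ j \<le> norm (h z1) * (norm (G z1) ^ N * (1 / 2) ^ (N - 1)) ^ j"
    using hc j(2) by (intro mult_mono) (auto simp: z1_def)
  also have "\<dots> = norm (H z1)" using nz1 by (simp add: H_def norm_mult norm_power norm_divide)
  \<comment> \<open>The alternative E in the maximum is excluded by \<open>E < c * 2 ^ j\<close>, so
    the bound from the circle around z0 must be the active one.\<close>
  finally show ?thesis using fin j(1) by linarith
qed

section \<open>The Cauchy potential\<close>

text \<open>\<open>moll_mass\<close> appears in the bounds so that the potential, which is divided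
  by it, is bounded by \<open>K\<close> itself. The integral with exponent
  \<open>1 + \<delta>\<close> controls the distance from the potential to its
  regularisation.\<close>

definition cauchy_potential :: "(complex \<Rightarrow> complex) \<Rightarrow> real \<Rightarrow> real \<Rightarrow> bool" where
  "cauchy_potential a \<delta> K \<longleftrightarrow> integrable lborel a \<and> 0 < \<delta> \<and> 0 \<le> K \<and>
     (\<forall>z. (\<integral>\<^sup>+v. ennreal (norm (a v) / norm (z - v)) \<partial>lborel) \<le> ennreal (K * moll_mass)) \<and>
     (\<forall>z. (\<integral>\<^sup>+v. ennreal (norm (a v) / norm (z - v) powr (1 + \<delta>)) \<partial>lborel) \<le> ennreal (K * moll_mass))"

lemma exp_lipschitz:
  assumes "norm x \<le> K" "norm y \<le> K"
  shows "norm (exp x - exp y) \<le> exp K * norm (x - y :: complex)"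
proof (rule field_differentiable_bound[of "cball 0 K" exp exp])
  show "(exp has_field_derivative exp z) (at z within cball 0 K)" for z :: complex
    by (auto intro!: derivative_eq_intros)
  show "norm (exp z) \<le> exp K" if "z \<in> cball 0 K" for z :: complex
    using that norm_exp[of z] by (auto intro: order_trans)
qed (use assms in auto)

text \<open>The kernels agree outside radius e. Inside, the difference is at most 1 / |z|, and the
  factor (e / |z|)^\<delta> is at least 1 there.\<close>

lemma cauchy_ker_diff:
  assumes "0 < e" "0 < \<delta>"
  shows "norm (cauchy_ker e z - 1 / z) \<le> e powr \<delta> / norm z powr (1 + \<delta>)"
proof -
  consider "z = 0" | "e \<le> norm z" | "z \<noteq> 0" "norm z < e" by linarith
  then show ?thesis
  proof cases
    case 3
    define s where "s = (norm z / e)\<^sup>2"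
    have "s \<le> 1" using 3 assms by (auto simp: s_def intro!: power_le_one)
    have s: "0 \<le> s" by (simp add: s_def)
    have "(cauchy_ker e z - 1 / z) * z = of_real (s * cauchy_profile s - 1)"
    proof -
      have "cauchy_ker e z * z = (z * cnj z) * of_real (cauchy_profile s / e\<^sup>2)"
        by (simp add: cauchy_ker_def s_def)
      also have "\<dots> = of_real ((norm z)\<^sup>2 * (cauchy_profile s / e\<^sup>2))"
        unfolding complex_norm_square[symmetric] by simp
      also have "(norm z)\<^sup>2 * (cauchy_profile s / e\<^sup>2) = s * cauchy_profile s"
        by (simp add: s_def power_divide)
      finally show ?thesis using 3 by (simp add: left_diff_distrib)
    qed
    then have "norm (cauchy_ker e z - 1 / z) * norm z = \<bar>s * cauchy_profile s - 1\<bar>"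
      by (simp only: norm_mult[symmetric] norm_of_real)
    also have "\<dots> \<le> 1" using cauchy_profile_bounds(1,3)[OF s] s by (auto simp: abs_le_iff add_increasing)
    finally have "norm (cauchy_ker e z - 1 / z) \<le> 1 / norm z" using 3 by (simp add: field_simps)
    also have "\<dots> \<le> (e / norm z) powr \<delta> * (1 / norm z)"
    proof -
      have "1 \<le> (e / norm z) powr \<delta>" using 3 assms by (intro ge_one_powr_ge_zero) (auto simp: field_simps)
      from mult_right_mono[OF this, of "1 / norm z"] show ?thesis by simp
    qed
    also have "\<dots> = e powr \<delta> / norm z powr (1 + \<delta>)"
      using 3 assms by (simp add: powr_divide powr_add)
    finally show ?thesis .
  next
    case 1 then show ?thesis by (simp add: cauchy_ker_def)
  next
    case 2 then show ?thesis using assms by (simp add: cauchy_ker_far)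
  qed
qed

lemma compact_support_bounded:
  fixes g :: "complex \<Rightarrow> complex"
  assumes "continuous_on UNIV g" "compact Q" "\<And>z. z \<notin> Q \<Longrightarrow> g z = 0"
  shows "\<exists>B>0. \<forall>z. norm (g z) \<le> B"
proof -
  have "bounded (g ` Q)"
    by (intro compact_imp_bounded compact_continuous_image continuous_on_subset[OF assms(1)] assms(2)) auto
  then obtain B where B: "0 < B" "\<forall>x\<in>g ` Q. norm x \<le> B" using bounded_pos by blast
  have "norm (g z) \<le> B" for z using B assms(3)[of z] by (cases "z \<in> Q") auto
  then show ?thesis using B(1) by blast
qed

lemma uniformly_continuous_compact_support:
  fixes g :: "complex \<Rightarrow> complex"
  assumes "continuous_on UNIV g" "compact K" "\<And>z. z \<notin> K \<Longrightarrow> g z = 0" "0 < d"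
  obtains s where "0 < s" "\<And>z w. dist z w < s \<Longrightarrow> dist (g z) (g w) < d"
proof -
  obtain B where B: "K \<subseteq> cball 0 B" 
    using bounded_subset_ballD[OF compact_imp_bounded[OF assms(2)], of 0] ball_subset_cball by blast
  have uc: "uniformly_continuous_on (cball 0 (B + 1)) g"
    by (intro compact_uniformly_continuous continuous_on_subset[OF assms(1)]) auto
  obtain s where s: "0 < s"
    "\<forall>z\<in>cball 0 (B + 1). \<forall>w\<in>cball 0 (B + 1). dist w z < s \<longrightarrow> dist (g w) (g z) < d"
    using uc[unfolded uniformly_continuous_on_def, rule_format, OF assms(4)] by blast
  show ?thesis
  proof (rule that[of "min s 1"])
    fix z w :: complex assume zw: "dist z w < min s 1"
    show "dist (g z) (g w) < d"
    proof (cases "z \<in> cball 0 (B + 1) \<and> w \<in> cball 0 (B + 1)")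
      case False
      have "norm z \<le> norm w + dist z w" "norm w \<le> norm z + dist z w"
        using norm_triangle_sub[of z w] norm_triangle_sub[of w z] norm_minus_commute[of z w] unfolding dist_norm by linarith+
      moreover have "B + 1 < norm z \<or> B + 1 < norm w" "dist z w < 1" using False zw unfolding mem_cball_0 by linarith+
      ultimately have "B < norm z" "B < norm w" by linarith+
      then have "z \<notin> K" "w \<notin> K" using B by auto
      then show ?thesis using assms(3,4) by simp
    next
      case True
      then show ?thesis using s(2)[rule_format, of w z] zw by simp
    qed
  qed (use s(1) in simp)
qed

lemma integrable_conv_pair:
  fixes g a :: "complex \<Rightarrow> complex" and \<kappa> :: "complex \<Rightarrow> complex"
  assumes a: "integrable lborel a" and g: "integrable lborel g"
    and k: "continuous_on UNIV \<kappa>" "\<And>z. norm (\<kappa> z) \<le> B"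
  shows "integrable (lborel \<Otimes>\<^sub>M lborel) (\<lambda>(z, v). g z * (a v * \<kappa> (z - v)))"
proof (rule Bochner_Integration.integrable_bound[where f = "\<lambda>(z, v). B * (g z * a v)"])
  have am[measurable]: "a \<in> borel_measurable borel" and gm[measurable]: "g \<in> borel_measurable borel" and km[measurable]: "\<kappa> \<in> borel_measurable borel"
    using a g k(1) by (auto intro: borel_measurable_continuous_onI)
  have m: "(\<lambda>(z, v). B * (g z * a v)) \<in> borel_measurable (lborel \<Otimes>\<^sub>M lborel)" by measurable
  show "integrable (lborel \<Otimes>\<^sub>M lborel) (\<lambda>(z, v). B * (g z * a v))"
  proof (rule lborel_pair.Fubini_integrable)
    show "(\<lambda>(z, v). B * (g z * a v)) \<in> borel_measurable (lborel \<Otimes>\<^sub>M lborel)" by (rule m)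
    show "integrable lborel (\<lambda>z. \<integral>v. norm (case (z, v) of (z, v) \<Rightarrow> B * (g z * a v)) \<partial>lborel)"
      using g by (simp add: norm_mult)
    show "AE z in lborel. integrable lborel (\<lambda>v. case (z, v) of (z, v) \<Rightarrow> B * (g z * a v))"
      using a by simp
  qed
  show "(\<lambda>(z, v). g z * (a v * \<kappa> (z - v))) \<in> borel_measurable (lborel \<Otimes>\<^sub>M lborel)" by measurable
  have "0 \<le> B" using order_trans[OF norm_ge_zero k(2)] .
  have "norm (g z * (a v * \<kappa> (z - v))) \<le> norm (B * (g z * a v))" for z v
    using mult_left_mono[OF k(2)[of "z - v"], of "norm (g z) * norm (a v)"] \<open>0 \<le> B\<close>
    by (simp add: norm_mult mult_ac)
  then show "AE x in lborel \<Otimes>\<^sub>M lborel. norm (case x of (z, v) \<Rightarrow> g z * (a v * \<kappa> (z - v)))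
      \<le> norm (case x of (z, v) \<Rightarrow> B * (g z * a v))"
    by (intro AE_I2) (simp split: prod.splits)
qed

text \<open>Fubini and the evenness of the mollifier. It moves the mollification from
  \<open>a\<close>, which has no continuity, to \<open>g\<close>, which will be continuous.\<close>

lemma conv_mollifier_adjoint:
  fixes a g :: "complex \<Rightarrow> complex"
  assumes a: "integrable lborel a" and g: "integrable lborel g" and e: "0 < e"
  shows "(LBINT z. g z * conv a (\<lambda>z. of_real (mollifier e z)) z)
    = (LBINT v. a v * conv g (\<lambda>z. of_real (mollifier e z)) v)"
proof -
  let ?\<kappa> = "\<lambda>z. of_real (mollifier e z) :: complex"
  have \<kappa>: "continuous_on UNIV ?\<kappa>" "\<And>z. norm (?\<kappa> z) \<le> 3 / e\<^sup>2"
    using mollifier_facts[OF e] by (auto intro!: continuous_intros)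
  have "(LBINT z. g z * conv a ?\<kappa> z) = (LBINT z. (LBINT v. g z * (a v * ?\<kappa> (z - v))))"
    by (simp add: conv_def)
  also have "\<dots> = (LBINT v. (LBINT z. g z * (a v * ?\<kappa> (z - v))))"
    by (rule lborel_pair.Fubini_integral[symmetric, OF integrable_conv_pair[OF a g \<kappa>]])
  also have "\<dots> = (LBINT v. a v * conv g ?\<kappa> v)"
  proof (rule Bochner_Integration.integral_cong[OF refl])
    fix v
    have "(\<lambda>z. g z * (a v * ?\<kappa> (z - v))) = (\<lambda>z. a v * (g z * ?\<kappa> (v - z)))"
    proof
      fix z
      show "g z * (a v * ?\<kappa> (z - v)) = a v * (g z * ?\<kappa> (v - z))"
        using mollifier_facts(6)[OF e, of "v - z"] by simp
    qed
    then show "(LBINT z. g z * (a v * ?\<kappa> (z - v))) = a v * conv g ?\<kappa> v"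
      by (simp only: conv_def integral_mult_right_zero)
  qed
  finally show ?thesis .
qed

text \<open>The weak form of dbar f = a f, with both sides doubled as
  \<open>\<phi>x + \<i> * \<phi>y\<close> is twice dbar of the test function.\<close>

definition weak_dbar_eq :: "(complex \<Rightarrow> complex) \<Rightarrow> (complex \<Rightarrow> complex) \<Rightarrow> complex set \<Rightarrow> bool" where
  "weak_dbar_eq f a D \<longleftrightarrow> (\<forall>\<phi> \<phi>x \<phi>y. C1_test D \<phi> \<phi>x \<phi>y \<longrightarrow>
     (LBINT z. f z * (\<phi>x z + \<i> * \<phi>y z)) = - (LBINT z. 2 * a z * f z * \<phi> z))"

text \<open>This is how a bound |u| \<le> M on V enters the complex argument: f = u_x - i u_y, and
  the derivatives are moved onto the test function. The function u itself no longer appears.\<close>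

definition gradient_bound :: "(complex \<Rightarrow> complex) \<Rightarrow> real \<Rightarrow> complex set \<Rightarrow> bool" where
  "gradient_bound f M V \<longleftrightarrow> (\<forall>\<psi> \<psi>x \<psi>y. C1_test V \<psi> \<psi>x \<psi>y \<longrightarrow>
     norm (LBINT z. f z * \<psi> z) \<le> M * (LBINT z. norm (\<psi>x z) + norm (\<psi>y z)))"

lemma integral_le_measure:
  fixes g :: "complex \<Rightarrow> real"
  assumes "integrable lborel g" "\<And>v. g v \<le> L" "\<And>v. v \<notin> cball z r \<Longrightarrow> g v = 0" "0 \<le> r"
  shows "(LBINT v. g v) \<le> L * (pi * r\<^sup>2)"
proof -
  have m: "measure lborel (cball z r) = pi * r\<^sup>2"
    using assms(4) by (simp add: content_cball unit_ball_vol_2)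
  have i: "integrable lborel (\<lambda>v. L * indicator (cball z r) v)"
    using emeasure_lborel_cball_finite[of z r] by (intro integrable_mult_right integrable_real_indicator) auto
  have "(LBINT v. g v) \<le> (LBINT v. L * indicator (cball z r) v)"
    by (rule integral_mono[OF assms(1) i]) (use assms(2,3) in \<open>auto simp: indicator_def\<close>)
  then show ?thesis using m by simp
qed

lemma cauchy_potential_of_excess:
  fixes q :: real
  assumes q: "2 < q"
  shows "\<exists>\<delta> \<kappa>. 0 < \<delta> \<and> \<delta> < 1 \<and> 1 \<le> \<kappa> \<and> (\<forall>R\<ge>1. \<forall>a. a \<in> borel_measurable borel \<longrightarrow>
     (\<forall>z. z \<notin> ball 0 (20 * R) \<longrightarrow> a z = 0) \<longrightarrow> unit_excess q a \<le> 1 \<longrightarrow>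
     cauchy_potential a \<delta> (\<kappa> * R) \<and> (LBINT z. norm (a z)) / moll_mass \<le> 20 * R * (\<kappa> * R))"
proof -
  \<comment> \<open>The requirement (1 + \<delta>) q / (q - 1) < 2 reads \<delta> < 1 - 2/q; this is
    half of that bound, positive because q > 2.\<close>
  define \<delta> where "\<delta> = 1 / 2 - 1 / q"
  have \<delta>: "0 < \<delta>" "\<delta> < 1" using q by (auto simp: \<delta>_def field_simps)
  have s1: "1 * q / (q - 1) < 2" using q by (simp add: divide_less_eq)
  have s2: "(1 + \<delta>) * q / (q - 1) < 2"
  proof -
    have "(1 + \<delta>) * q = 3 / 2 * q - 1" using q by (simp add: \<delta>_def field_simps)
    then show ?thesis using q by (simp add: divide_less_eq)
  qed
  have q1: "1 < q" using q by simp
  obtain C1 where C1: "0 \<le> C1" "\<And>\<rho> a z. 1 \<le> \<rho> \<Longrightarrow> a \<in> borel_measurable borel \<Longrightarrow> (\<And>v. v \<notin> ball 0 \<rho> \<Longrightarrow> a v = 0) \<Longrightarrow>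
     unit_excess q a \<le> 1 \<Longrightarrow> (\<integral>\<^sup>+v. ennreal (norm (a v) / norm (z - v) powr 1) \<partial>lborel) \<le> ennreal (C1 * \<rho>)"
    using potential_bound[OF q1 order_refl s1] by blast
  have s3: "1 \<le> 1 + \<delta>" using \<delta> by simp
  obtain C2 where C2: "0 \<le> C2" "\<And>\<rho> a z. 1 \<le> \<rho> \<Longrightarrow> a \<in> borel_measurable borel \<Longrightarrow> (\<And>v. v \<notin> ball 0 \<rho> \<Longrightarrow> a v = 0) \<Longrightarrow>
     unit_excess q a \<le> 1 \<Longrightarrow> (\<integral>\<^sup>+v. ennreal (norm (a v) / norm (z - v) powr (1 + \<delta>)) \<partial>lborel) \<le> ennreal (C2 * \<rho>)"
    using potential_bound[OF q1 s3 s2] by blast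
  define \<kappa> where "\<kappa> = 20 * (C1 + C2) / moll_mass + 1"
  have \<kappa>: "1 \<le> \<kappa>" using C1(1) C2(1) moll_mass_pos by (simp add: \<kappa>_def)
  have "cauchy_potential a \<delta> (\<kappa> * R) \<and> (LBINT z. norm (a z)) / moll_mass \<le> 20 * R * (\<kappa> * R)"
    if R: "1 \<le> R" and am[measurable]: "a \<in> borel_measurable borel" and a0: "\<And>z. z \<notin> ball 0 (20 * R) \<Longrightarrow> a z = 0"
      and ex: "unit_excess q a \<le> 1" for R a
  proof -
    have R20: "1 \<le> 20 * R" using R by simp
    have cK: "C * (20 * R) \<le> \<kappa> * R * moll_mass" if "C \<le> C1 + C2" for C
    proof -
      have "C * (20 * R) \<le> (C1 + C2) * (20 * R)" using that R by (intro mult_right_mono) auto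
      also have "\<dots> = (20 * (C1 + C2) / moll_mass) * R * moll_mass" using moll_mass_pos by simp
      also have "\<dots> \<le> \<kappa> * R * moll_mass"
        using moll_mass_pos R by (intro mult_right_mono) (auto simp: \<kappa>_def)
      finally show ?thesis .
    qed
    have p1: "(\<integral>\<^sup>+v. ennreal (norm (a v) / norm (z - v)) \<partial>lborel) \<le> ennreal (\<kappa> * R * moll_mass)" for z
      using order_trans[OF C1(2)[OF R20 am a0 ex, of z] ennreal_leI[OF cK[of C1]]] C2(1) by simp
    have p2: "(\<integral>\<^sup>+v. ennreal (norm (a v) / norm (z - v) powr (1 + \<delta>)) \<partial>lborel) \<le> ennreal (\<kappa> * R * moll_mass)" for z
      using order_trans[OF C2(2)[OF R20 am a0 ex, of z] ennreal_leI[OF cK[of C2]]] C1(1) by simp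
    have nz: "AE v in lborel. v \<noteq> (0::complex)" by (rule AE_lborel_singleton)
    \<comment> \<open>On the support |v| < 20 R, so 1 \<le> 20 R / |v|, and the L^1 norm is
      controlled by the potential integral at the origin.\<close>
    have L: "(\<integral>\<^sup>+v. ennreal (norm (a v)) \<partial>lborel) \<le> ennreal (20 * R * (\<kappa> * R * moll_mass))"
    proof -
      have "(\<integral>\<^sup>+v. ennreal (norm (a v)) \<partial>lborel) \<le> (\<integral>\<^sup>+v. ennreal (20 * R) * ennreal (norm (a v) / norm (0 - v)) \<partial>lborel)"
        using nz
      proof (intro nn_integral_mono_AE, eventually_elim)
        fix v :: complex assume nz: "v \<noteq> 0"
        have "norm (a v) \<le> 20 * R * (norm (a v) / norm (0 - v))"
        proof (cases "v \<in> ball 0 (20 * R)")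
          case True
          then have "norm (a v) * norm v \<le> norm (a v) * (20 * R)" by (intro mult_left_mono) auto
          then show ?thesis using nz by (simp add: field_simps)
        qed (simp add: a0)
        then show "ennreal (norm (a v)) \<le> ennreal (20 * R) * ennreal (norm (a v) / norm (0 - v))"
          using R by (subst ennreal_mult'[symmetric]) (auto intro: ennreal_leI)
      qed
      also have "\<dots> = ennreal (20 * R) * (\<integral>\<^sup>+v. ennreal (norm (a v) / norm (0 - v)) \<partial>lborel)"
        by (rule nn_integral_cmult) measurable
      also have "\<dots> \<le> ennreal (20 * R) * ennreal (\<kappa> * R * moll_mass)" by (intro mult_left_mono p1) auto
      finally show ?thesis using R by (simp add: ennreal_mult'[symmetric])
    qed
    have ai: "integrable lborel a"
      by (rule integrableI_bounded) (use L in \<open>auto intro: le_less_trans\<close>)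
    have "ennreal (LBINT v. norm (a v)) \<le> ennreal (20 * R * (\<kappa> * R * moll_mass))"
      using L ai by (subst nn_integral_eq_integral[symmetric]) auto
    then have "(LBINT v. norm (a v)) \<le> 20 * R * (\<kappa> * R) * moll_mass"
      using R \<kappa> moll_mass_pos by (subst (asm) ennreal_le_iff) (auto simp: mult_ac)
    then have "(LBINT v. norm (a v)) / moll_mass \<le> 20 * R * (\<kappa> * R)"
      using moll_mass_pos by (simp add: divide_le_eq)
    moreover have "cauchy_potential a \<delta> (\<kappa> * R)"
      using ai \<delta> \<kappa> R p1 p2 by (simp add: cauchy_potential_def)
    ultimately show ?thesis by blast
  qed
  then show ?thesis using \<delta> \<kappa> by (intro exI[of _ \<delta>] exI[of _ \<kappa>]) blast
qed

context
  fixes a :: "complex \<Rightarrow> complex" and \<delta> K :: real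
  assumes a_int: "integrable lborel a" and \<delta>: "0 < \<delta>" and K: "0 \<le> K"
    and pot1: "\<And>z. (\<integral>\<^sup>+v. ennreal (norm (a v) / norm (z - v)) \<partial>lborel) \<le> ennreal (K * moll_mass)"
    and pot2: "\<And>z. (\<integral>\<^sup>+v. ennreal (norm (a v) / norm (z - v) powr (1 + \<delta>)) \<partial>lborel) \<le> ennreal (K * moll_mass)"
begin

text \<open>The solution w of dbar w = a given by the fundamental solution 1 / (pi z).\<close>

definition potential :: "complex \<Rightarrow> complex" where
  "potential z = conv a (\<lambda>z. 1 / z) z / of_real moll_mass"

definition potential_reg :: "real \<Rightarrow> complex \<Rightarrow> complex" where
  "potential_reg e z = conv a (cauchy_ker e) z / of_real moll_mass"

definition potential_reg_x :: "real \<Rightarrow> complex \<Rightarrow> complex" where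
  "potential_reg_x e z = conv a (cauchy_ker_x e) z / of_real moll_mass"

definition potential_reg_y :: "real \<Rightarrow> complex \<Rightarrow> complex" where
  "potential_reg_y e z = conv a (cauchy_ker_y e) z / of_real moll_mass"

lemma riesz_integral:
  assumes "(\<integral>\<^sup>+v. ennreal (norm (a v) / norm (z - v) powr s) \<partial>lborel) \<le> ennreal (K * moll_mass)"
  shows "integrable lborel (\<lambda>v. norm (a v) / norm (z - v) powr s)"
    "(LBINT v. norm (a v) / norm (z - v) powr s) \<le> K * moll_mass"
proof -
  have [measurable]: "a \<in> borel_measurable borel" using a_int by auto
  show *: "integrable lborel (\<lambda>v. norm (a v) / norm (z - v) powr s)"
    using assms by (intro integrableI_nonneg) (auto intro: le_less_trans)
  have "ennreal (LBINT v. norm (a v) / norm (z - v) powr s) \<le> ennreal (K * moll_mass)"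
    using assms nn_integral_eq_integral[OF *] by simp
  then show "(LBINT v. norm (a v) / norm (z - v) powr s) \<le> K * moll_mass"
    using K moll_mass_pos by (simp add: ennreal_le_iff)
qed

text \<open>One estimate for three kernels: \<open>cauchy_ker e\<close> and 1/z with s = 1, and
  their difference with s = 1 + \<delta>.\<close>

lemma conv_bound:
  assumes k: "k \<in> borel_measurable borel" "\<And>z. norm (k z) \<le> c / norm z powr s" and c: "0 \<le> c"
    and s: "\<And>z. (\<integral>\<^sup>+v. ennreal (norm (a v) / norm (z - v) powr s) \<partial>lborel) \<le> ennreal (K * moll_mass)"
  shows "integrable lborel (\<lambda>v. a v * k (z - v))" "norm (conv a k z) \<le> c * K * moll_mass"
proof -
  have [measurable]: "a \<in> borel_measurable borel" using a_int by auto
  note R = riesz_integral[OF s, of z]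
  have le: "norm (a v * k (z - v)) \<le> c * (norm (a v) / norm (z - v) powr s)" for v
    using mult_left_mono[OF k(2)[of "z - v"], of "norm (a v)"] by (simp add: norm_mult mult_ac)
  have [measurable]: "(\<lambda>v. k (z - v)) \<in> borel_measurable borel"
    using k(1) by measurable
  show int: "integrable lborel (\<lambda>v. a v * k (z - v))"
  proof (rule Bochner_Integration.integrable_bound)
    show "integrable lborel (\<lambda>v. c * (norm (a v) / norm (z - v) powr s))" by (intro integrable_mult_right R(1))
    show "AE v in lborel. norm (a v * k (z - v)) \<le> norm (c * (norm (a v) / norm (z - v) powr s))"
    proof (rule AE_I2)
      fix v
      show "norm (a v * k (z - v)) \<le> norm (c * (norm (a v) / norm (z - v) powr s))"
        using order_trans[OF le[of v] abs_ge_self] by (simp only: real_norm_def)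
    qed
  qed measurable
  have "norm (conv a k z) \<le> (LBINT v. c * (norm (a v) / norm (z - v) powr s))"
    unfolding conv_def
    by (intro Bochner_Integration.integral_norm_bound_integral int integrable_mult_right R(1) le)
  also have "\<dots> \<le> c * (K * moll_mass)"
    unfolding integral_mult_right_zero by (rule mult_left_mono[OF R(2) c])
  finally show "norm (conv a k z) \<le> c * K * moll_mass" by simp
qed

lemma pot1': "(\<integral>\<^sup>+v. ennreal (norm (a v) / norm (z - v) powr 1) \<partial>lborel) \<le> ennreal (K * moll_mass)"
  using pot1[of z] by simp

lemma cauchy_ker_meas: "cauchy_ker e \<in> borel_measurable borel"
  by (intro borel_measurable_continuous_onI C1_partialsD(4)[OF C1_partials_cauchy_ker])

lemma norm_potential_reg: "0 < e \<Longrightarrow> norm (potential_reg e z) \<le> K"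
  using conv_bound(2)[OF cauchy_ker_meas, of e 1 1 z] cauchy_ker_norm pot1' moll_mass_pos
  by (simp add: potential_reg_def norm_divide divide_le_eq)

lemma norm_potential: "norm (potential z) \<le> K"
  using conv_bound(2)[of "\<lambda>z. 1 / z" 1 1 z] pot1' moll_mass_pos
  by (simp add: potential_def norm_divide divide_le_eq)

lemma potential_reg_close:
  assumes e: "0 < e" shows "norm (potential_reg e z - potential z) \<le> e powr \<delta> * K"
proof -
  let ?k = "\<lambda>z. cauchy_ker e z - 1 / z"
  have int: "integrable lborel (\<lambda>v. a v * cauchy_ker e (z - v))" "integrable lborel (\<lambda>v. a v * (1 / (z - v)))"
    using conv_bound(1)[OF cauchy_ker_meas, of e 1 1 z] conv_bound(1)[of "\<lambda>z. 1 / z" 1 1 z]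
      cauchy_ker_norm[OF e] pot1' by (simp_all add: norm_divide)
  have "conv a ?k z = conv a (cauchy_ker e) z - conv a (\<lambda>z. 1 / z) z"
    unfolding conv_def right_diff_distrib using int by (rule Bochner_Integration.integral_diff)
  moreover have "norm (conv a ?k z) \<le> e powr \<delta> * K * moll_mass"
    using cauchy_ker_diff[OF e \<delta>] cauchy_ker_meas pot2 by (intro conv_bound(2)[where s = "1 + \<delta>"]) auto
  ultimately show ?thesis
    using moll_mass_pos
    by (simp add: potential_def potential_reg_def diff_divide_distrib[symmetric] norm_divide divide_le_eq)
qed

lemma exp_potential_close:
  assumes e: "0 < e"
  shows "norm (exp (- potential_reg e z) - exp (- potential z)) \<le> exp K * K * e powr \<delta>"
proof -
  have "norm (exp (- potential_reg e z) - exp (- potential z)) \<le> exp K * norm (- potential_reg e z - - potential z)"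
    using norm_potential_reg[OF e] norm_potential by (intro exp_lipschitz) auto
  also have "norm (- potential_reg e z - - potential z) = norm (potential_reg e z - potential z)"
    by (simp only: minus_diff_minus norm_minus_cancel)
  also have "exp K * \<dots> \<le> exp K * (e powr \<delta> * K)"
    using potential_reg_close[OF e] by simp
  finally show ?thesis by (simp add: mult_ac)
qed

lemma norm_exp_potential: "norm (exp (- potential z)) \<le> exp K"
  "0 < e \<Longrightarrow> norm (exp (- potential_reg e z)) \<le> exp K"
  using norm_exp[of "- potential z"] norm_potential[of z] norm_exp[of "- potential_reg e z"] norm_potential_reg[of e z]
  by (auto intro: order_trans)

lemma C1_partials_potential_reg:
  assumes "0 < e"
  shows "C1_partials (potential_reg e) (potential_reg_x e) (potential_reg_y e)"
  using C1_partials_cmult[OF C1_partials_conv[OF a_int C1_partials_cauchy_ker cauchy_ker_bounded[OF assms]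
       cauchy_ker_partials_bounded[OF assms]], of "1 / of_real moll_mass"]
  by (simp add: potential_reg_def[abs_def] potential_reg_x_def[abs_def] potential_reg_y_def[abs_def])

text \<open>A crude bound, the supremum of the kernel's partials times the L^1 norm of
  \<open>a\<close>. The loss of e^-2 is balanced later by the choice of e as a power of M.\<close>

lemma norm_potential_reg_partials:
  assumes "0 < e"
  shows "norm (potential_reg_x e z) \<le> 9 / e\<^sup>2 * (LBINT v. norm (a v)) / moll_mass"
    "norm (potential_reg_y e z) \<le> 9 / e\<^sup>2 * (LBINT v. norm (a v)) / moll_mass"
proof -
  have *: "norm (conv a k z) \<le> B * (LBINT v. norm (a v))"
    if k: "continuous_on UNIV k" "\<And>z. norm (k z) \<le> B" for k B
  proof -
    have "norm (conv a k z) \<le> (LBINT v. B * norm (a v))"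
      unfolding conv_def using a_int mult_right_mono[OF k(2) norm_ge_zero]
      by (intro Bochner_Integration.integral_norm_bound_integral conv_integrable[OF a_int k])
         (auto simp: norm_mult mult.commute)
    then show ?thesis by simp
  qed
  note D = C1_partialsD[OF C1_partials_cauchy_ker]
  show "norm (potential_reg_x e z) \<le> 9 / e\<^sup>2 * (LBINT v. norm (a v)) / moll_mass"
    "norm (potential_reg_y e z) \<le> 9 / e\<^sup>2 * (LBINT v. norm (a v)) / moll_mass"
    unfolding potential_reg_x_def potential_reg_y_def norm_divide norm_of_real abs_of_pos[OF moll_mass_pos]
    by (intro divide_right_mono *[OF D(2) cauchy_ker_partials_bounded(1)[OF assms]]
         *[OF D(3) cauchy_ker_partials_bounded(2)[OF assms]] less_imp_le[OF moll_mass_pos])+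
qed

text \<open>Regularising the kernel amounts to replacing \<open>a\<close> by its average over discs
  of radius e in dbar w = a.\<close>

lemma potential_reg_dbar:
  assumes "0 < e"
  shows "potential_reg_x e z + \<i> * potential_reg_y e z
    = 2 / of_real moll_mass * conv a (\<lambda>z. of_real (mollifier e z)) z"
proof -
  note D = C1_partialsD[OF C1_partials_cauchy_ker]
  have "conv a (cauchy_ker_x e) z + \<i> * conv a (cauchy_ker_y e) z
    = (LBINT v. a v * cauchy_ker_x e (z - v) + \<i> * (a v * cauchy_ker_y e (z - v)))"
    using conv_integrable[OF a_int D(2) cauchy_ker_partials_bounded(1)[OF assms]]
      conv_integrable[OF a_int D(3) cauchy_ker_partials_bounded(2)[OF assms]]
    by (simp add: conv_def)
  also have "\<dots> = (LBINT v. 2 * (a v * of_real (mollifier e (z - v))))"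
  proof (rule Bochner_Integration.integral_cong[OF refl])
    fix v
    have "a v * cauchy_ker_x e (z - v) + \<i> * (a v * cauchy_ker_y e (z - v))
       = a v * (cauchy_ker_x e (z - v) + \<i> * cauchy_ker_y e (z - v))" by (simp add: algebra_simps)
    then show "a v * cauchy_ker_x e (z - v) + \<i> * (a v * cauchy_ker_y e (z - v))
       = 2 * (a v * of_real (mollifier e (z - v)))" unfolding cauchy_ker_dbar by simp
  qed
  also have "\<dots> = 2 * conv a (\<lambda>z. of_real (mollifier e z)) z" by (simp add: conv_def)
  finally show ?thesis
    by (simp add: potential_reg_x_def potential_reg_y_def add_divide_distrib[symmetric])
qed

lemma powr_tendsto: "((\<lambda>e. c * e powr \<delta>) \<longlongrightarrow> 0) (at_right 0)"
  using \<delta> by (intro tendsto_mult_right_zero tendsto_zero_powrI[OF tendsto_ident_at tendsto_const])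
    (auto simp: eventually_at_filter)

lemma potential_continuous: "continuous_on UNIV potential"
proof (rule uniform_limit_theorem[where F = "at_right 0" and f = potential_reg])
  show "\<forall>\<^sub>F e in at_right 0. continuous_on UNIV (potential_reg e)"
    using eventually_at_right_less[of 0]
    by eventually_elim (rule C1_partialsD(4)[OF C1_partials_potential_reg])
  have lim: "((\<lambda>e. e powr \<delta> * K) \<longlongrightarrow> 0) (at_right 0)"
    using powr_tendsto[of K] by (simp add: mult.commute)
  show "uniform_limit UNIV potential_reg potential (at_right 0)"
  proof (rule uniform_limitI)
    fix d :: real assume "0 < d"
    with lim have "\<forall>\<^sub>F e in at_right 0. e powr \<delta> * K < d" by (rule order_tendstoD)
    with eventually_at_right_less[of 0]
    show "\<forall>\<^sub>F e in at_right 0. \<forall>z\<in>UNIV. dist (potential_reg e z) (potential z) < d"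
      by eventually_elim (auto simp: dist_norm intro: le_less_trans[OF potential_reg_close])
  qed
qed simp

section \<open>The similarity principle\<close>

lemma C1_test_exp_potential:
  assumes e: "0 < e" and t: "C1_test D \<phi> \<phi>x \<phi>y"
  shows "C1_test D (\<lambda>z. \<phi> z * exp (- potential_reg e z))
     (\<lambda>z. \<phi> z * (- potential_reg_x e z * exp (- potential_reg e z)) + \<phi>x z * exp (- potential_reg e z))
     (\<lambda>z. \<phi> z * (- potential_reg_y e z * exp (- potential_reg e z)) + \<phi>y z * exp (- potential_reg e z))"
proof -
  obtain Q where "compact Q" "Q \<subseteq> D" "\<forall>z. z \<notin> Q \<longrightarrow> \<phi> z = 0"
    using t unfolding C1_test_def by auto
  then show ?thesis
    unfolding C1_test_def
    by (intro conjI exI[of _ Q] C1_partials_mult C1_partials_exp C1_partials_potential_reg[OF e])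
       (use t in \<open>auto simp: C1_test_def\<close>)
qed

text \<open>Testing the equation with \<open>\<phi> exp (- w\<^sub>e)\<close>, where \<open>w\<^sub>e\<close> is the regularised potential,
  leaves an error of the form \<open>\<integral> a (\<eta>\<^sub>e * g - g)\<close> with \<open>g\<close> continuous and compactly supported;
  no approximation of \<open>a\<close> itself is needed.\<close>

lemma similarity_weak:
  assumes D: "open D" "continuous_on D f" and eq: "weak_dbar_eq f a D"
  shows "weakly_holomorphic_on (\<lambda>z. f z * exp (- potential z)) D"
    unfolding weakly_holomorphic_on_def
  proof (intro allI impI)
    have [measurable]: "a \<in> borel_measurable borel" using a_int by auto
    fix \<phi> \<phi>x \<phi>y assume t: "C1_test D \<phi> \<phi>x \<phi>y"
    then obtain Q where Q: "compact Q" "Q \<subseteq> D" "\<And>z. z \<notin> Q \<Longrightarrow> \<phi> z = 0" and C: "C1_partials \<phi> \<phi>x \<phi>y"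
      unfolding C1_test_def by auto
    note Q' = C1_partials_zero_outside[OF C compact_imp_closed[OF Q(1)] Q(3)]
    define F where "F z = f z * \<phi> z" for z
    define G where "G z = f z * (\<phi>x z + \<i> * \<phi>y z)" for z
    have Fc: "continuous_on UNIV F"
      unfolding F_def using C1_partialsD(4)[OF C] Q D
      by (intro continuous_on_cutoff[of D f \<phi> Q]) (auto intro: compact_imp_closed)
    have Gc: "continuous_on UNIV G"
      unfolding G_def using C1_partialsD(2,3)[OF C] Q D Q'
      by (intro continuous_on_cutoff[of D f _ Q]) (auto intro: compact_imp_closed intro!: continuous_intros)
    have F0: "z \<notin> Q \<Longrightarrow> F z = 0" and G0: "z \<notin> Q \<Longrightarrow> G z = 0" for z
      using Q(3) Q' by (auto simp: F_def G_def)
    have Gi: "integrable lborel G" by (rule integrable_continuous_compact[OF Gc Q(1) G0])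
    obtain B where B: "0 < B" and "\<forall>z. norm (F z) \<le> B"
      using compact_support_bounded[OF Fc Q(1) F0] by blast
    then have FB: "norm (F z) \<le> B" for z by simp
    define A where "A = (LBINT v. norm (a v))"
    define I where "I = (LBINT v. norm (G v))"
    have AI: "0 \<le> A" "0 \<le> I" by (auto simp: A_def I_def)
    have key: "norm (LBINT z. G z * exp (- potential z)) \<le> (I + 2 * A * (2 * B + 1)) * d" if d: "0 < d" for d
    proof -
      define g0 where "g0 z = F z * exp (- potential z)" for z
      obtain s where s: "0 < s" "\<And>z w. dist z w < s \<Longrightarrow> dist (g0 z) (g0 w) < d"
        by (rule uniformly_continuous_compact_support[of g0 Q d])
           (use Q F0 d in \<open>auto simp: g0_def intro!: continuous_intros Fc potential_continuous\<close>)
      have "\<forall>\<^sub>F e in at_right 0. exp K * K * e powr \<delta> < d" using powr_tendsto d by (rule order_tendstoD)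
      moreover have "\<forall>\<^sub>F e in at_right 0. e < s" using s(1) by (intro eventually_at_rightI[of 0 s]) auto
      ultimately have "\<forall>\<^sub>F e in at_right 0. 0 < e \<and> e < s \<and> exp K * K * e powr \<delta> < d"
        using eventually_at_right_less[of 0] by eventually_elim auto
      then obtain e where e: "0 < e" "e < s" "exp K * K * e powr \<delta> < d"
        using eventually_happens trivial_limit_at_right_real by blast
      define E where "E z = exp (- potential_reg e z)" for z
      define g where "g z = F z * E z" for z
      have Ec: "continuous_on UNIV E"
        unfolding E_def by (intro continuous_intros C1_partialsD(4)[OF C1_partials_potential_reg[OF e(1)]])
      have gc: "continuous_on UNIV g" unfolding g_def by (intro continuous_intros Fc Ec)
      have gi: "integrable lborel g" by (rule integrable_continuous_compact[OF gc Q(1)]) (simp add: g_def F0)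
      have EE: "norm (E z - exp (- potential z)) \<le> d" for z
        using exp_potential_close[OF e(1), of z] e(3) by (simp add: E_def)
      have gg: "norm (g z - g0 z) \<le> B * d" for z
      proof -
        have "norm (g z - g0 z) = norm (F z) * norm (E z - exp (- potential z))"
          by (simp add: g_def g0_def right_diff_distrib[symmetric] norm_mult)
        also have "\<dots> \<le> B * d" by (intro mult_mono FB EE) (use B in auto)
        finally show ?thesis .
      qed
      \<comment> \<open>\<open>g\<close> depends on e, so its oscillation at scale e cannot come
        from its own modulus of continuity. It is compared with \<open>g0\<close>, whose modulus was
        fixed before e; the two comparisons cost B d each and the oscillation of \<open>g0\<close>
        costs d.\<close>
      have osc: "norm (g w - g z) \<le> (2 * B + 1) * d" if "norm (z - w) < e" for z w
      proof -
        have "dist z w < s" using that e by (simp add: dist_norm)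
        then have "norm (g0 w - g0 z) < d" using s(2)[of z w] by (simp add: dist_norm norm_minus_commute)
        moreover have eq: "g w - g z = (g w - g0 w) + (g0 w - g0 z) - (g z - g0 z)" by simp
        have "norm (g w - g z) \<le> norm (g w - g0 w) + norm (g0 w - g0 z) + norm (g z - g0 z)"
          by (subst eq) (rule order_trans[OF norm_triangle_ineq4 add_right_mono[OF norm_triangle_ineq]])
        ultimately show ?thesis using gg[of w] gg[of z] by (simp add: algebra_simps)
      qed
      let ?\<eta> = "\<lambda>z. of_real (mollifier e z) :: complex"
      have \<eta>: "continuous_on UNIV ?\<eta>" "\<And>z. norm (?\<eta> z) \<le> 3 / e\<^sup>2"
        using mollifier_facts[OF e(1)] by (auto intro!: continuous_intros)
      have mc: "norm (conv g ?\<eta> v - g v * of_real moll_mass) \<le> (2 * B + 1) * d * moll_mass" for v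
        unfolding mollifier_integral[OF e(1), symmetric]
        by (intro conv_approx[where e = e] mollifier_facts e conv_integrable[OF gi \<eta>] osc)
      have cont_conv: "continuous_on UNIV (conv g ?\<eta>)" by (rule conv_continuous[OF gi \<eta>])
      have ai: "integrable lborel (\<lambda>v. a v * (conv g ?\<eta> v - g v * of_real moll_mass))"
      proof (rule Bochner_Integration.integrable_bound)
        show "integrable lborel (\<lambda>v. ((2 * B + 1) * d * moll_mass) * norm (a v))" using a_int by simp
        have "(\<lambda>v. conv g ?\<eta> v - g v * of_real moll_mass) \<in> borel_measurable borel"
          by (intro borel_measurable_continuous_onI continuous_intros cont_conv gc)
        then show "(\<lambda>v. a v * (conv g ?\<eta> v - g v * of_real moll_mass)) \<in> borel_measurable lborel"
          by simp
        show "AE v in lborel. norm (a v * (conv g ?\<eta> v - g v * of_real moll_mass))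
           \<le> norm (((2 * B + 1) * d * moll_mass) * norm (a v))"
        proof (rule AE_I2)
          fix v
          have "norm (a v) * norm (conv g ?\<eta> v - g v * of_real moll_mass) \<le> norm (a v) * ((2 * B + 1) * d * moll_mass)"
            by (intro mult_left_mono mc) auto
          also have "\<dots> \<le> \<bar>((2 * B + 1) * d * moll_mass) * norm (a v)\<bar>" by (simp add: mult.commute)
          finally show "norm (a v * (conv g ?\<eta> v - g v * of_real moll_mass))
           \<le> norm (((2 * B + 1) * d * moll_mass) * norm (a v))" by (simp only: norm_mult real_norm_def)
        qed
      qed
      have ag: "integrable lborel (\<lambda>v. a v * g v)"
      proof (rule Bochner_Integration.integrable_bound)
        show "integrable lborel (\<lambda>v. (B * exp K) * norm (a v))" using a_int by simp
        have "g \<in> borel_measurable borel" by (intro borel_measurable_continuous_onI gc)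
        then show "(\<lambda>v. a v * g v) \<in> borel_measurable lborel" by simp
        have "norm (a v * g v) \<le> norm (B * exp K * norm (a v))" for v
        proof -
          have "norm (g v) \<le> B * exp K"
            unfolding g_def norm_mult E_def by (intro mult_mono FB norm_exp_potential e) (use B in auto)
          from mult_left_mono[OF this, of "norm (a v)"] B show ?thesis by (simp add: norm_mult abs_mult mult_ac)
        qed
        then show "AE v in lborel. norm (a v * g v) \<le> norm (B * exp K * norm (a v))" by simp
      qed
      have cg: "integrable lborel (\<lambda>z. g z * conv a ?\<eta> z)"
      proof (rule integrable_continuous_compact[OF _ Q(1)])
        show "continuous_on UNIV (\<lambda>z. g z * conv a ?\<eta> z)"
          by (intro continuous_intros gc conv_continuous[OF a_int \<eta>])
      qed (simp add: g_def F0)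
      have GE: "integrable lborel (\<lambda>z. G z * E z)"
        by (rule integrable_continuous_compact[OF _ Q(1)]) (auto simp: G0 intro!: continuous_intros Gc Ec)
      have GP: "integrable lborel (\<lambda>z. G z * exp (- potential z))"
        by (rule integrable_continuous_compact[OF _ Q(1)]) (auto simp: G0 intro!: continuous_intros Gc potential_continuous)
      have weak: "(LBINT z. G z * E z - 2 / of_real moll_mass * (g z * conv a ?\<eta> z)) = - (LBINT z. 2 * (a z * g z))"
      proof -
        have "(LBINT z. f z * ((\<phi> z * (- potential_reg_x e z * exp (- potential_reg e z)) + \<phi>x z * exp (- potential_reg e z))
            + \<i> * (\<phi> z * (- potential_reg_y e z * exp (- potential_reg e z)) + \<phi>y z * exp (- potential_reg e z))))
           = - (LBINT z. 2 * a z * f z * (\<phi> z * exp (- potential_reg e z)))"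
          using eq C1_test_exp_potential[OF e(1) t] unfolding weak_dbar_eq_def by blast
        also have "(\<lambda>z. 2 * a z * f z * (\<phi> z * exp (- potential_reg e z))) = (\<lambda>z. 2 * (a z * g z))"
          by (simp add: g_def F_def E_def mult_ac)
        also have "(\<lambda>z. f z * ((\<phi> z * (- potential_reg_x e z * exp (- potential_reg e z)) + \<phi>x z * exp (- potential_reg e z))
            + \<i> * (\<phi> z * (- potential_reg_y e z * exp (- potential_reg e z)) + \<phi>y z * exp (- potential_reg e z))))
          = (\<lambda>z. G z * E z - g z * (potential_reg_x e z + \<i> * potential_reg_y e z))"
          by (simp add: G_def g_def F_def E_def algebra_simps)
        finally show ?thesis
          unfolding potential_reg_dbar[OF e(1)] mult.left_commute[of "g _" "2 / of_real moll_mass"] .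
      qed
      have alg: "A' = 2 / of_real moll_mass * (X - of_real moll_mass * Y)"
        if "A' - 2 / of_real moll_mass * X = - (2 * Y)" for A' X Y :: complex
      proof -
        have "A' = 2 / of_real moll_mass * X - 2 * Y"
          using that by (simp add: diff_eq_eq)
        then show ?thesis using moll_mass_pos by (simp add: right_diff_distrib)
      qed
      have "(LBINT z. G z * E z - 2 / of_real moll_mass * (g z * conv a ?\<eta> z))
         = (LBINT z. G z * E z) - 2 / of_real moll_mass * (LBINT z. g z * conv a ?\<eta> z)"
        unfolding integral_mult_right_zero[symmetric]
        by (rule Bochner_Integration.integral_diff[OF GE integrable_mult_right[OF cg]])
      then have "(LBINT z. G z * E z)
         = 2 / of_real moll_mass * ((LBINT v. a v * conv g ?\<eta> v) - of_real moll_mass * (LBINT z. a z * g z))"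
        using weak unfolding conv_mollifier_adjoint[OF a_int gi e(1)] integral_mult_right_zero
        by (intro alg) (simp only:)
      also have "(LBINT v. a v * conv g ?\<eta> v) - of_real moll_mass * (LBINT z. a z * g z)
         = (LBINT v. a v * (conv g ?\<eta> v - g v * of_real moll_mass))"
      proof -
        have agJ: "integrable lborel (\<lambda>v. of_real moll_mass * (a v * g v))" using ag by (rule integrable_mult_right)
        have eq1: "(\<lambda>v. a v * (conv g ?\<eta> v - g v * of_real moll_mass) + of_real moll_mass * (a v * g v)) = (\<lambda>v. a v * conv g ?\<eta> v)"
          by (simp add: fun_eq_iff right_diff_distrib)
        show ?thesis
          using Bochner_Integration.integral_add[OF ai agJ] unfolding eq1 integral_mult_right_zero by simp
      qed
      finally have GEeq: "(LBINT z. G z * E z) = 2 / of_real moll_mass * (LBINT v. a v * (conv g ?\<eta> v - g v * of_real moll_mass))" .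
      have "norm (LBINT v. a v * (conv g ?\<eta> v - g v * of_real moll_mass)) \<le> (LBINT v. ((2 * B + 1) * d * moll_mass) * norm (a v))"
      proof (rule Bochner_Integration.integral_norm_bound_integral[OF ai])
        show "integrable lborel (\<lambda>v. ((2 * B + 1) * d * moll_mass) * norm (a v))"
          by (intro integrable_mult_right integrable_norm a_int)
        show "norm (a v * (conv g ?\<eta> v - g v * of_real moll_mass)) \<le> ((2 * B + 1) * d * moll_mass) * norm (a v)" for v
          using mult_left_mono[OF mc[of v] norm_ge_zero[of "a v"]]
          unfolding norm_mult[symmetric] mult.commute[of "norm (a v)" "(2 * B + 1) * d * moll_mass"] .
      qed
      also have "\<dots> = (2 * B + 1) * d * moll_mass * A" by (simp add: A_def)
      finally have b1: "norm (LBINT z. G z * E z) \<le> 2 * A * (2 * B + 1) * d"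
        unfolding GEeq norm_mult norm_divide using moll_mass_pos by (simp add: field_simps)
      have "norm (LBINT z. G z * (exp (- potential z) - E z)) \<le> (LBINT z. d * norm (G z))"
      proof (rule Bochner_Integration.integral_norm_bound_integral)
        show "integrable lborel (\<lambda>z. G z * (exp (- potential z) - E z))"
          using Bochner_Integration.integrable_diff[OF GP GE] by (simp only: right_diff_distrib)
        show "integrable lborel (\<lambda>z. d * norm (G z))" using Gi by simp
        show "norm (G z * (exp (- potential z) - E z)) \<le> d * norm (G z)" for z
          using mult_left_mono[OF EE[of z] norm_ge_zero[of "G z"]]
          by (simp add: norm_mult norm_minus_commute mult.commute)
      qed
      also have "\<dots> = I * d" by (simp add: I_def)
      finally have b2: "norm (LBINT z. G z * (exp (- potential z) - E z)) \<le> I * d" .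
      have "(LBINT z. G z * exp (- potential z)) = (LBINT z. G z * E z) + (LBINT z. G z * (exp (- potential z) - E z))"
        unfolding right_diff_distrib Bochner_Integration.integral_diff[OF GP GE] by simp
      then have "norm (LBINT z. G z * exp (- potential z)) \<le> 2 * A * (2 * B + 1) * d + I * d"
        using norm_triangle_mono[OF b1 b2] by simp
      then show ?thesis by (simp only: distrib_right add.commute)
    qed
    have "norm (LBINT z. G z * exp (- potential z)) \<le> 0"
    proof (rule field_le_epsilon)
      fix d :: real assume "0 < d"
      define c where "c = I + 2 * A * (2 * B + 1) + 1"
      have c: "0 < c" using AI B by (simp add: c_def add_nonneg_pos)
      have "norm (LBINT z. G z * exp (- potential z)) \<le> (I + 2 * A * (2 * B + 1)) * (d / c)"
        using key[of "d / c"] \<open>0 < d\<close> c by simp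
      also have "\<dots> \<le> c * (d / c)" using \<open>0 < d\<close> c by (intro mult_right_mono) (auto simp: c_def)
      finally show "norm (LBINT z. G z * exp (- potential z)) \<le> 0 + d" using c by simp
    qed
    moreover have "(\<lambda>z. f z * exp (- potential z) * (\<phi>x z + \<i> * \<phi>y z)) = (\<lambda>z. G z * exp (- potential z))"
      by (simp add: fun_eq_iff G_def mult.assoc mult.commute[of "exp _"])
    ultimately show "(LBINT z. f z * exp (- potential z) * (\<phi>x z + \<i> * \<phi>y z)) = 0"
      by (simp only: norm_le_zero_iff)
  qed

theorem similarity_principle:
  assumes D: "open D" "continuous_on D f" and eq: "weak_dbar_eq f a D"
  shows "(\<lambda>z. f z * exp (- potential z)) holomorphic_on D"
proof (rule weyl_lemma[OF D(1) _ similarity_weak[OF assms]])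
  have "continuous_on UNIV (\<lambda>z. exp (- potential z))"
    by (intro continuous_intros potential_continuous)
  then show "continuous_on D (\<lambda>z. f z * exp (- potential z))"
    by (intro continuous_intros D continuous_on_subset[OF potential_continuous]) auto
qed

section \<open>Bounding the holomorphic factor by the solution\<close>

text \<open>The value of the holomorphic factor is its mean against the mollifier of radius r.
  Replacing exp (-w) by its regularisation costs the first term, as |f| \<le> 1. The remaining
  integral tests f with a C^1 function, so \<open>gradient_bound\<close> gives the second.\<close>

lemma holomorphic_factor_bound:
  assumes D: "open D" "continuous_on D f" and eq: "weak_dbar_eq f a D"
    and f1: "\<And>z. z \<in> D \<Longrightarrow> norm (f z) \<le> 1"
    and V: "gradient_bound f M V" "0 \<le> M"
    and r: "0 < r" "cball z r \<subseteq> D" "cball z r \<subseteq> V" and e: "0 < e"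
  shows "norm (f z * exp (- potential z)) * moll_mass \<le>
     exp K * (K * e powr \<delta> * moll_mass +
       M * (2 * pi * (12 / r + 27 / e\<^sup>2 * (LBINT v. norm (a v)) / moll_mass)))"
proof -
  let ?h = "\<lambda>z. f z * exp (- potential z)"
  let ?m = "\<lambda>v. of_real (mollifier r (z - v)) :: complex"
  define E where "E v = exp (- potential_reg e v)" for v
  define A where "A = (LBINT v. norm (a v)) / moll_mass"
  have A: "0 \<le> A" using moll_mass_pos by (simp add: A_def)
  note hol = similarity_principle[OF D eq]
  have hc: "continuous_on D ?h" using hol by (rule holomorphic_on_imp_continuous_on)
  obtain mx my where m: "C1_partials (\<lambda>z. of_real (mollifier r z)) mx my"
    "\<And>z. norm (mx z) \<le> 12 / r ^ 3" "\<And>z. norm (my z) \<le> 12 / r ^ 3"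
    using C1_partials_mollifier[of r] r(1) by blast
  note mf = mollifier_facts[OF r(1)]
  have mc: "continuous_on UNIV ?m"
    by (intro continuous_intros continuous_on_compose2[OF mf(4)]) auto
  have m0: "?m v = 0" if "v \<notin> cball z r" for v
    using that mf(3)[of "z - v"] by (simp add: dist_norm)
  have Ec: "continuous_on UNIV E"
    unfolding E_def by (intro continuous_intros C1_partialsD(4)[OF C1_partials_potential_reg[OF e]])
  have t0: "C1_test V ?m (\<lambda>v. - mx (z - v)) (\<lambda>v. - my (z - v))"
    unfolding C1_test_def using C1_partials_reflect[OF m(1), of z] m0 r
    by (intro conjI exI[of _ "cball z r"]) auto
  define px where "px v = ?m v * (- potential_reg_x e v * E v) + - mx (z - v) * E v" for v
  define py where "py v = ?m v * (- potential_reg_y e v * E v) + - my (z - v) * E v" for v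
  have t: "C1_test V (\<lambda>v. ?m v * E v) px py"
    using C1_test_exp_potential[OF e t0] unfolding px_def[abs_def] py_def[abs_def] E_def .
  then have C: "C1_partials (\<lambda>v. ?m v * E v) px py" by (simp add: C1_test_def)
  have pb: "norm (?m v * (- w * E v) + - k * E v) \<le> exp K * (3 / r\<^sup>2 * (9 / e\<^sup>2 * A) + 12 / r ^ 3)"
    if "norm w \<le> 9 / e\<^sup>2 * A" "norm k \<le> 12 / r ^ 3" for w k v
  proof -
    have "norm (?m v * (- w * E v) + - k * E v) = norm (?m v * w + k) * norm (E v)"
    proof -
      have "?m v * (- w * E v) + - k * E v = - ((?m v * w + k) * E v)" by (simp add: algebra_simps)
      then show ?thesis by (simp only: norm_minus_cancel norm_mult)
    qed
    also have "\<dots> \<le> (3 / r\<^sup>2 * (9 / e\<^sup>2 * A) + 12 / r ^ 3) * exp K"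
    proof (rule mult_mono)
      have "norm (?m v * w) \<le> 3 / r\<^sup>2 * (9 / e\<^sup>2 * A)"
        unfolding norm_mult norm_of_real abs_of_nonneg[OF mf(1)]
        by (intro mult_mono mf(2) that(1)) auto
      then show "norm (?m v * w + k) \<le> 3 / r\<^sup>2 * (9 / e\<^sup>2 * A) + 12 / r ^ 3"
        using that(2) by (rule norm_triangle_mono)
      show "norm (E v) \<le> exp K" unfolding E_def by (rule norm_exp_potential(2)[OF e])
      show "0 \<le> 3 / r\<^sup>2 * (9 / e\<^sup>2 * A) + 12 / r ^ 3" using A r(1) by simp
    qed simp
    finally show ?thesis by (simp only: mult.commute)
  qed
  have wb: "norm (potential_reg_x e v) \<le> 9 / e\<^sup>2 * A" "norm (potential_reg_y e v) \<le> 9 / e\<^sup>2 * A" for v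
    using norm_potential_reg_partials[OF e, of v] by (auto simp: A_def)
  have p0: "v \<notin> cball z r \<Longrightarrow> px v = 0" "v \<notin> cball z r \<Longrightarrow> py v = 0" for v
    using C1_partials_zero_outside[OF C closed_cball[of z r]] m0 by auto
  have pi1: "integrable lborel (\<lambda>v. norm (px v) + norm (py v))"
    by (intro Bochner_Integration.integrable_add integrable_norm integrable_continuous_compact[of _ "cball z r"]
          C1_partialsD(2,3)[OF C] p0) auto
  have "(LBINT v. norm (px v) + norm (py v))
      \<le> (exp K * (3 / r\<^sup>2 * (9 / e\<^sup>2 * A) + 12 / r ^ 3) + exp K * (3 / r\<^sup>2 * (9 / e\<^sup>2 * A) + 12 / r ^ 3)) * (pi * r\<^sup>2)"
  proof (rule integral_le_measure[OF pi1])
    show "norm (px v) + norm (py v) \<le> exp K * (3 / r\<^sup>2 * (9 / e\<^sup>2 * A) + 12 / r ^ 3) + exp K * (3 / r\<^sup>2 * (9 / e\<^sup>2 * A) + 12 / r ^ 3)" for v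
      unfolding px_def py_def by (intro add_mono pb wb m)
    show "v \<notin> cball z r \<Longrightarrow> norm (px v) + norm (py v) = 0" for v using p0[of v] by simp
  qed (use r in auto)
  \<comment> \<open>Each partial of the test function is at most exp K times 3/r^2 * 9/e^2 * A, from
    differentiating the exponential, plus 12/r^3, from the mollifier. The 2 counts the two partials,
    and pi r^2 is the area of the support.\<close>
  also have "\<dots> = exp K * (2 * pi * (12 / r + 27 / e\<^sup>2 * A))"
    using r(1) e by (simp add: field_simps power2_eq_square power3_eq_cube)
  finally have g1: "(LBINT v. norm (px v) + norm (py v)) \<le> exp K * (2 * pi * (12 / r + 27 / e\<^sup>2 * A))" .
  have "norm (LBINT v. f v * (?m v * E v)) \<le> M * (LBINT v. norm (px v) + norm (py v))"
    using V(1) t unfolding gradient_bound_def by blast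
  also have "\<dots> \<le> M * (exp K * (2 * pi * (12 / r + 27 / e\<^sup>2 * A)))"
    by (rule mult_left_mono[OF g1 V(2)])
  finally have I1: "norm (LBINT v. f v * (?m v * E v)) \<le> M * (exp K * (2 * pi * (12 / r + 27 / e\<^sup>2 * A)))" .
  have i1: "integrable lborel (\<lambda>v. f v * (?m v * E v))"
    by (rule integrable_cutoff[OF D _ _ r(2)]) (use m0 in \<open>auto intro!: continuous_intros mc Ec\<close>)
  have i2: "integrable lborel (\<lambda>v. f v * (?m v * exp (- potential v)))"
    by (rule integrable_cutoff[OF D _ _ r(2)]) (use m0 in \<open>auto intro!: continuous_intros mc potential_continuous\<close>)
  have mi: "integrable lborel (\<lambda>v. mollifier r (z - v))" by (rule integrable_reflect[OF mf(5)])
  have "norm (LBINT v. f v * (?m v * exp (- potential v)) - f v * (?m v * E v))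
     \<le> (LBINT v. (exp K * K * e powr \<delta>) * mollifier r (z - v))"
  proof (rule Bochner_Integration.integral_norm_bound_integral)
    show "integrable lborel (\<lambda>v. f v * (?m v * exp (- potential v)) - f v * (?m v * E v))"
      by (rule Bochner_Integration.integrable_diff[OF i2 i1])
    show "integrable lborel (\<lambda>v. (exp K * K * e powr \<delta>) * mollifier r (z - v))"
      by (rule integrable_mult_right[OF mi])
    fix v
    show "norm (f v * (?m v * exp (- potential v)) - f v * (?m v * E v)) \<le> (exp K * K * e powr \<delta>) * mollifier r (z - v)"
    proof (cases "v \<in> cball z r")
      case True
      have "f v * (?m v * exp (- potential v)) - f v * (?m v * E v) = f v * ((exp (- potential v) - E v) * ?m v)"
        by (simp add: algebra_simps)
      then have "norm (f v * (?m v * exp (- potential v)) - f v * (?m v * E v))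
         = norm (f v) * (norm (exp (- potential v) - E v) * mollifier r (z - v))"
        by (simp only: norm_mult norm_of_real abs_of_nonneg[OF mf(1)])
      also have "\<dots> \<le> 1 * ((exp K * K * e powr \<delta>) * mollifier r (z - v))"
      proof (intro mult_mono mult_nonneg_nonneg norm_ge_zero mf(1) order_refl)
        show "norm (f v) \<le> 1" using f1 True r(2) by blast
        show "norm (exp (- potential v) - E v) \<le> exp K * K * e powr \<delta>"
          using exp_potential_close[OF e, of v] by (simp add: E_def norm_minus_commute)
      qed (use K in auto)
      finally show ?thesis by simp
    next
      case False then show ?thesis using m0[OF False] by simp
    qed
  qed
  also have "\<dots> = exp K * K * e powr \<delta> * moll_mass"
    using integral_reflect[of "mollifier r" z] mollifier_integral[OF r(1)] mf(5) by simp
  finally have I2: "norm (LBINT v. f v * (?m v * exp (- potential v)) - f v * (?m v * E v)) \<le> exp K * K * e powr \<delta> * moll_mass" .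
  have "weakly_holomorphic_on ?h D" by (rule similarity_weak[OF D eq])
  then have "?h z * of_real moll_mass = conv ?h (\<lambda>z. of_real (mollifier r z)) z"
    using weakly_holomorphic_mean_value[OF D(1) hc _ r(1,2)] by simp
  also have "\<dots> = (LBINT v. f v * (?m v * exp (- potential v)))"
    unfolding conv_def by (simp only: mult.assoc mult.commute[of "exp _" "of_real _"])
  also have "\<dots> = (LBINT v. f v * (?m v * exp (- potential v)) - f v * (?m v * E v)) + (LBINT v. f v * (?m v * E v))"
    by (simp only: Bochner_Integration.integral_diff[OF i2 i1] diff_add_cancel)
  finally have "norm (?h z * of_real moll_mass) \<le> exp K * K * e powr \<delta> * moll_mass + M * (exp K * (2 * pi * (12 / r + 27 / e\<^sup>2 * A)))"
    using norm_triangle_mono[OF I2 I1] by simp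
  then show ?thesis
    using moll_mass_pos by (simp add: norm_mult A_def distrib_left mult_ac)
qed

text \<open>Feeds the holomorphic factor into \<open>three_boundary_estimate\<close>. As |w| \<le>
  K, it is at most exp K throughout and at least C0 exp (-K) at distance 3, so the condition there
  becomes \<open>exp (2 * K) < C0 * 2 ^ j\<close>.\<close>

lemma three_sphere_factor:
  assumes R: "8 \<le> R" and z0: "norm z0 = R"
    and D: "D = {z. 1 < norm z \<and> norm z < 20 * R}"
    and f: "continuous_on D f" "\<And>z. z \<in> D \<Longrightarrow> norm (f z) \<le> 1"
    and eq: "weak_dbar_eq f a D" and V: "gradient_bound f M (ball z0 1)"
    and M: "0 < M" "M < 1" and \<delta>1: "\<delta> < 1"
    and C0: "0 < C0" "C0 \<le> norm (f (of_real (3 / R) * z0))"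
    and KR: "1 \<le> K" "(LBINT z. norm (a z)) / moll_mass \<le> 20 * K\<^sup>2"
    and N: "1 \<le> N" "7 * R \<le> 8 ^ N" and j: "exp (2 * K) < C0 * 2 ^ j"
  shows "1 \<le> (1 + 1176 * pi / moll_mass) * exp (2 * K) * M powr (\<delta> / 3) * R ^ (3 * j * N)"
proof -
  let ?h = "\<lambda>z. f z * exp (- potential z)"
  \<comment> \<open>With r = 1/4 one has 12/r = 48, and the L^1 bound gives 27 * 20 = 540; 1176 is
    twice the sum 588.\<close>
  define B where "B = 1 + 1176 * pi / moll_mass"
  have B: "1 \<le> B" using moll_mass_pos by (simp add: B_def)
  have oD: "open D" unfolding D by (intro open_Collect_conj open_Collect_less continuous_intros)
  \<comment> \<open>This makes M / e^2 = M^(1/3) and e^\<delta> = M^(\<delta>/3). As M < 1 and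
    \<delta> < 1, both are at most \<mu>, and so is M.\<close>
  define e where "e = M powr (1 / 3)"
  have e: "0 < e" using M by (simp add: e_def)
  define \<mu> where "\<mu> = M powr (\<delta> / 3)"
  have ed: "e powr \<delta> = \<mu>" by (simp add: e_def \<mu>_def powr_powr)
  have M13: "M powr (1 / 3) \<le> \<mu>" unfolding \<mu>_def using M \<delta> \<delta>1 by (intro powr_mono') auto
  have Me: "M / e\<^sup>2 = M powr (1 / 3)"
  proof -
    have "e\<^sup>2 = M powr (2 / 3)" using M by (simp add: e_def powr_power)
    then have "M / e\<^sup>2 = M powr 1 / M powr (2 / 3)" using M by simp
    also have "\<dots> = M powr (1 / 3)" by (simp only: powr_diff[symmetric]) simp
    finally show ?thesis .
  qed
  have Mmu: "M \<le> \<mu>"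
    using M \<delta> \<delta>1 powr_mono'[of "\<delta> / 3" 1 M] by (simp add: \<mu>_def)
  have mu0: "0 \<le> \<mu>" by (simp add: \<mu>_def)
  have K1: "1 \<le> K\<^sup>2" "K \<le> K\<^sup>2" using mult_mono[OF KR(1) KR(1)] mult_left_mono[OF KR(1), of K] KR(1) by (simp_all add: power2_eq_square)
  have hm: "norm (?h z) \<le> B * K\<^sup>2 * exp K * \<mu>" if "dist z0 z = 1 / 2" for z
  proof -
    have s1: "cball z (1 / 4) \<subseteq> ball z0 1"
    proof
      fix y assume "y \<in> cball z (1 / 4)"
      then show "y \<in> ball z0 1" using that dist_triangle[of z0 y z] by auto
    qed
    have s2: "ball z0 1 \<subseteq> D"
    proof
      fix y assume "y \<in> ball z0 1"
      then have "norm (y - z0) < 1" by (simp add: dist_norm norm_minus_commute)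
      then show "y \<in> D" unfolding D using norm_triangle_ineq[of "y - z0" z0] norm_triangle_ineq2[of z0 "z0 - y"] z0 R
        by (auto simp: norm_minus_commute)
    qed
    have "norm (?h z) * moll_mass \<le> exp K * (K * e powr \<delta> * moll_mass +
       M * (2 * pi * (12 / (1 / 4) + 27 / e\<^sup>2 * (LBINT v. norm (a v)) / moll_mass)))"
      using M s1 s2 by (intro holomorphic_factor_bound[OF oD f(1) eq f(2) V _ _ _ s1 e]) auto
    also have "M * (2 * pi * (12 / (1 / 4) + 27 / e\<^sup>2 * (LBINT v. norm (a v)) / moll_mass))
      = 2 * pi * (48 * M + 27 * (M / e\<^sup>2) * ((LBINT v. norm (a v)) / moll_mass))"
      by (simp add: algebra_simps)
    also have "exp K * (K * e powr \<delta> * moll_mass + \<dots>) \<le> exp K * (K\<^sup>2 * \<mu> * moll_mass + 2 * pi * (48 * (K\<^sup>2 * \<mu>) + 27 * \<mu> * (20 * K\<^sup>2)))"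
    proof (intro mult_left_mono add_mono)
      show "K * e powr \<delta> * moll_mass \<le> K\<^sup>2 * \<mu> * moll_mass"
        unfolding ed using K1 mu0 moll_mass_pos by (intro mult_right_mono) auto
      show "M \<le> K\<^sup>2 * \<mu>" using mult_right_mono[OF K1(1) mu0] Mmu by simp
      show "27 * (M / e\<^sup>2) * ((LBINT v. norm (a v)) / moll_mass) \<le> 27 * \<mu> * (20 * K\<^sup>2)"
        unfolding Me using M13 mu0 KR moll_mass_pos by (intro mult_mono) auto
    qed auto
    also have "\<dots> = B * K\<^sup>2 * exp K * \<mu> * moll_mass"
      using moll_mass_pos by (simp add: B_def field_simps)
    finally show ?thesis using moll_mass_pos by simp
  qed
  have hE: "norm (?h z) \<le> exp K" if "1 < norm z" "norm z < 20 * R" for z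
    using mult_mono[OF f(2) norm_exp_potential(1), of z z] that by (simp add: D norm_mult)
  have hc: "C0 * exp (- K) \<le> norm (?h (of_real (3 / R) * z0))"
  proof -
    have "exp (- K) \<le> norm (exp (- potential w))" for w
      using norm_potential[of w] abs_Re_le_cmod[of "potential w"] by simp
    then show ?thesis unfolding norm_mult using C0 by (intro mult_mono) auto
  qed
  have jj: "exp K < C0 * exp (- K) * 2 ^ j"
  proof -
    have "exp K = exp (2 * K) * exp (- K)" by (simp add: exp_add[symmetric])
    also have "\<dots> < C0 * 2 ^ j * exp (- K)" using j by (intro mult_strict_right_mono) auto
    finally show ?thesis by (simp add: mult_ac)
  qed
  have hol: "?h holomorphic_on {z. 1 < norm z \<and> norm z < 20 * R}"
    using similarity_principle[OF oD f(1) eq] by (simp add: D)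
  have le: "C0 * exp (- K) * 2 ^ j \<le> B * K\<^sup>2 * exp K * \<mu> * R ^ (3 * j * N)"
    by (rule three_boundary_estimate[where h = ?h, OF R z0 hol hE hm hc N jj]) (use C0 in auto)
  \<comment> \<open>By \<open>jj\<close> the left side of \<open>le\<close> exceeds exp K, which
    then cancels against the exp K on the right.\<close>
  have "exp K * 1 \<le> exp K * (B * K\<^sup>2 * \<mu> * R ^ (3 * j * N))"
    using less_imp_le[OF less_le_trans[OF jj le]] by (simp only: mult_1_right mult_ac)
  then have "1 \<le> B * K\<^sup>2 * \<mu> * R ^ (3 * j * N)" by (simp only: mult_le_cancel_left_pos exp_gt_zero)
  also have "\<dots> \<le> B * exp (2 * K) * \<mu> * R ^ (3 * j * N)"
  proof (intro mult_right_mono mult_left_mono)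
    have "K \<le> exp K" using exp_ge_add_one_self[of K] by linarith
    then have "K\<^sup>2 \<le> (exp K)\<^sup>2" using KR(1) by (intro power_mono) auto
    then show "K\<^sup>2 \<le> exp (2 * K)" by (simp add: exp_double)
  qed (use B mu0 R in auto)
  finally show ?thesis by (simp only: B_def \<mu>_def)
qed

end

section \<open>The bound for the complex equation\<close>

text \<open>In \<open>three_sphere_factor\<close> K and j are of order R and N is of order ln R, so
  R^(3 j N) = exp (3 j N ln R) is where R (ln R)^2 arises. Taking logarithms and dividing by
  \<delta>/3 gives the bound for M.\<close>

theorem complex_landis_bound:
  fixes q C0 :: real
  assumes q: "2 < q" and C0: "0 < C0"
  shows "\<exists>C>0. \<exists>R0\<ge>8. \<forall>R\<ge>R0. \<forall>f a z0 M.
    norm z0 = R \<longrightarrow> continuous_on {z. 1 < norm z \<and> norm z < 20 * R} f \<longrightarrow>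
    (\<forall>z. 1 < norm z \<longrightarrow> norm z < 20 * R \<longrightarrow> norm (f z) \<le> 1) \<longrightarrow>
    C0 \<le> norm (f (of_real (3 / R) * z0)) \<longrightarrow>
    a \<in> borel_measurable borel \<longrightarrow> (\<forall>z. norm z < 20 * R \<or> a z = 0) \<longrightarrow> unit_excess q a \<le> 1 \<longrightarrow>
    weak_dbar_eq f a {z. 1 < norm z \<and> norm z < 20 * R} \<longrightarrow>
    gradient_bound f M (ball z0 1) \<longrightarrow> 0 < M \<longrightarrow> exp (- C * R * (ln R)\<^sup>2) \<le> M"
proof -
  obtain \<delta> \<kappa> where d01: "0 < \<delta>" "\<delta> < 1" and \<kappa>: "1 \<le> \<kappa>" and pot: "\<And>R a. 1 \<le> R \<Longrightarrow> a \<in> borel_measurable borel \<Longrightarrow>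
     (\<And>z. z \<notin> ball 0 (20 * R) \<Longrightarrow> a z = 0) \<Longrightarrow> unit_excess q a \<le> 1 \<Longrightarrow>
     cauchy_potential a \<delta> (\<kappa> * R) \<and> (LBINT z. norm (a z)) / moll_mass \<le> 20 * R * (\<kappa> * R)"
    using cauchy_potential_of_excess[OF q] by blast
  obtain j0 where j0: "1 / C0 < 2 ^ j0" using real_arch_pow[of 2 "1 / C0"] by auto
  define B where "B = 1 + 1176 * pi / moll_mass"
  have B: "1 \<le> B" using moll_mass_pos by (simp add: B_def)
  \<comment> \<open>The summands bound ln B, 2 K and 3 j N ln R in units of R (ln R)^2; the 9 is 3
    from the exponent times 3 from N \<le> 3 ln R.\<close>
  define L where "L = ln B + 2 * \<kappa> + 9 * (4 * \<kappa> + 1 + real j0)"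
  have L: "0 < L" using B \<kappa> by (simp add: L_def add_nonneg_pos)
  define C where "C = 3 / \<delta> * L"
  have "exp (- C * R * (ln R)\<^sup>2) \<le> M"
    if R: "8 \<le> R" and z0: "norm z0 = R" and f: "continuous_on {z. 1 < norm z \<and> norm z < 20 * R} f"
      "\<And>z. 1 < norm z \<Longrightarrow> norm z < 20 * R \<Longrightarrow> norm (f z) \<le> 1" and f3: "C0 \<le> norm (f (of_real (3 / R) * z0))"
      and a: "a \<in> borel_measurable borel" "\<And>z. norm z < 20 * R \<or> a z = 0" "unit_excess q a \<le> 1"
      and eq: "weak_dbar_eq f a {z. 1 < norm z \<and> norm z < 20 * R}"
      and V: "gradient_bound f M (ball z0 1)" and M: "0 < M" for R f a z0 M
  proof (cases "M < 1")
    case False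
    have "exp (- C * R * (ln R)\<^sup>2) \<le> 1" using L d01 R by (simp add: C_def)
    moreover have "1 \<le> M" using False by simp
    ultimately show ?thesis by (rule order_trans)
  next
    case True
    define K where "K = \<kappa> * R"
    have KR: "R \<le> K" using mult_right_mono[OF \<kappa>, of R] R by (simp add: K_def)
    have P: "cauchy_potential a \<delta> K" "(LBINT z. norm (a z)) / moll_mass \<le> 20 * R * K"
      using pot[of R a] R a by (auto simp: K_def)
    have cp: "integrable lborel a" "0 < \<delta>" "0 \<le> K"
      "\<And>z. (\<integral>\<^sup>+v. ennreal (norm (a v) / norm (z - v)) \<partial>lborel) \<le> ennreal (K * moll_mass)"
      "\<And>z. (\<integral>\<^sup>+v. ennreal (norm (a v) / norm (z - v) powr (1 + \<delta>)) \<partial>lborel) \<le> ennreal (K * moll_mass)"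
      using P(1) by (simp_all add: cauchy_potential_def)
    have aK: "(LBINT z. norm (a z)) / moll_mass \<le> 20 * K\<^sup>2"
    proof -
      have "20 * R * K \<le> 20 * K * K" using KR R by (intro mult_right_mono) auto
      then show ?thesis using P(2) by (simp add: power2_eq_square)
    qed
    \<comment> \<open>As exp (1/2) \<le> 2, the power 2^(4 K) beats exp (2 K); \<open>j0\<close>
      takes care of 1 / C0 and makes the inequality strict.\<close>
    define j where "j = nat \<lceil>4 * K\<rceil> + j0"
    \<comment> \<open>Then 7 R \<le> e^N \<le> 8^N. Also N \<le> ln 7 + ln R + 1 \<le> 3 ln R,
      because R \<ge> 8.\<close>
    define N where "N = nat \<lceil>ln (7 * R)\<rceil>"
    have ln8: "1 \<le> ln R"
    proof -
      have "exp 1 \<le> R" using exp_le R by linarith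
      then show ?thesis using R by (simp add: ln_ge_iff)
    qed
    have ln7: "ln (7 * R) = ln 7 + ln R" using R by (simp add: ln_mult)
    have ln7': "0 < ln (7::real)" "ln (7::real) \<le> ln R" using R by auto
    have N1: "1 \<le> N" using ln7 ln8 ln7'(1) unfolding N_def by linarith
    have Nle: "real N \<le> 3 * ln R" using ln7 ln8 ln7' unfolding N_def by linarith
    have N8: "7 * R \<le> 8 ^ N"
    proof -
      have "7 * R = exp (ln (7 * R))" using R by simp
      also have "\<dots> \<le> exp (real N)" unfolding N_def by (simp add: real_nat_ceiling_ge)
      also have "\<dots> = exp 1 ^ N" by (simp add: exp_of_nat_mult[symmetric])
      also have "\<dots> \<le> 8 ^ N" using exp_le by (intro power_mono) auto
      finally show ?thesis .
    qed
    have jj: "exp (2 * K) < C0 * 2 ^ j"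
    proof -
      have e2: "exp (1/2 :: real) \<le> 2"
      proof -
        have "(exp (1/2 :: real))\<^sup>2 = exp 1" by (simp add: exp_double[symmetric])
        also have "\<dots> \<le> 2\<^sup>2" using exp_le by simp
        finally show ?thesis by (rule power2_le_imp_le) simp
      qed
      have "exp (2 * K) \<le> exp (real (nat \<lceil>4 * K\<rceil>) * (1 / 2))"
        using real_nat_ceiling_ge[of "4 * K"] by simp
      also have "\<dots> = exp (1 / 2) ^ nat \<lceil>4 * K\<rceil>" by (rule exp_of_nat_mult)
      also have "\<dots> \<le> 2 ^ nat \<lceil>4 * K\<rceil>" using e2 by (intro power_mono) auto
      also have "\<dots> = (1 / C0) * (C0 * 2 ^ nat \<lceil>4 * K\<rceil>)" using C0 by simp
      also have "\<dots> < 2 ^ j0 * (C0 * 2 ^ nat \<lceil>4 * K\<rceil>)" using j0 C0 by (intro mult_strict_right_mono) auto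
      finally show ?thesis by (simp add: j_def power_add mult_ac)
    qed
    have "1 \<le> B * exp (2 * K) * M powr (\<delta> / 3) * R ^ (3 * j * N)"
      unfolding B_def using KR R f
      by (intro three_sphere_factor[OF cp R z0 refl f(1) _ eq V M True d01(2) C0 f3 _ aK N1 N8 jj]) auto
    then have "ln 1 \<le> ln (B * exp (2 * K) * M powr (\<delta> / 3) * R ^ (3 * j * N))"
      by (intro ln_mono) auto
    also have "\<dots> = ln B + 2 * K + \<delta> / 3 * ln M + real (3 * j * N) * ln R"
      using B M R by (simp add: ln_mult ln_powr ln_realpow)
    finally have l: "- (\<delta> / 3 * ln M) \<le> ln B + 2 * K + real (3 * j * N) * ln R" by simp
    define Q where "Q = R * (ln R)\<^sup>2"
    have ll: "1 \<le> (ln R)\<^sup>2" using ln8 by simp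
    have RQ: "R \<le> Q" using mult_left_mono[OF ll, of R] R by (simp add: Q_def)
    have Q1: "1 \<le> Q" using RQ R by linarith
    have jle: "real j \<le> (4 * \<kappa> + 1 + real j0) * R"
    proof -
      have "real j \<le> 4 * K + 1 + real j0" using KR R unfolding j_def by linarith
      also have "\<dots> \<le> 4 * K + 1 * R + real j0 * R" using R by (intro add_mono) (auto simp: mult_left_le intro: mult_left_mono[of 1 R "real j0", simplified])
      finally show ?thesis by (simp add: K_def algebra_simps)
    qed
    have "real (3 * j * N) * ln R = 3 * (real j * (real N * ln R))" by simp
    also have "\<dots> \<le> 3 * (((4 * \<kappa> + 1 + real j0) * R) * ((3 * ln R) * ln R))"
      using jle Nle ln8 by (intro mult_left_mono mult_mono mult_right_mono) auto
    also have "\<dots> = 9 * (4 * \<kappa> + 1 + real j0) * Q" by (simp add: Q_def power2_eq_square)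
    finally have t3: "real (3 * j * N) * ln R \<le> 9 * (4 * \<kappa> + 1 + real j0) * Q" .
    have t1: "ln B \<le> ln B * Q" using mult_left_mono[OF Q1, of "ln B"] B by simp
    have t2: "2 * K \<le> 2 * \<kappa> * Q" using mult_left_mono[OF RQ, of "2 * \<kappa>"] \<kappa> by (simp add: K_def)
    have "- (\<delta> / 3 * ln M) \<le> L * Q" using l t1 t2 t3 by (simp add: L_def distrib_right)
    then have "- (C * Q) \<le> ln M" using d01 by (simp add: C_def field_simps)
    then have "exp (- (C * Q)) \<le> exp (ln M)" by (simp only: exp_le_cancel_iff)
    then show ?thesis using M by (simp add: Q_def mult.assoc)
  qed
  moreover have "0 < C" using L d01 by (simp add: C_def)
  ultimately show ?thesis by (intro exI[of _ C] conjI exI[of _ 8]) auto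
qed

section \<open>Weak gradients are curl free\<close>

lemma C1_compact_bounds:
  assumes "C1_partials k kx ky" "compact Q" "\<And>z. z \<notin> Q \<Longrightarrow> k z = 0"
  shows "\<exists>B. \<forall>z. norm (k z) \<le> B \<and> norm (kx z) \<le> B \<and> norm (ky z) \<le> B"
proof -
  note D = C1_partialsD[OF assms(1)]
  note Z = C1_partials_zero_outside[OF assms(1) compact_imp_closed[OF assms(2)] assms(3)]
  obtain B0 B1 B2 where "\<forall>z. norm (k z) \<le> B0" "\<forall>z. norm (kx z) \<le> B1" "\<forall>z. norm (ky z) \<le> B2"
    using compact_support_bounded[OF D(4) assms(2,3)] compact_support_bounded[OF D(2) assms(2) Z(1)]
      compact_support_bounded[OF D(3) assms(2) Z(2)] by blast
  then show ?thesis
    by (intro exI[of _ "max B0 (max B1 B2)"]) (auto simp: le_max_iff_disj)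
qed

lemma conv_commute:
  assumes "continuous_on UNIV a" "continuous_on UNIV k"
  shows "conv a k = conv k a"
proof
  fix z
  have m: "(\<lambda>v. k v * a (z - v)) \<in> borel_measurable borel"
    by (intro borel_measurable_continuous_onI continuous_intros assms continuous_on_compose2[OF assms(1)]) auto
  show "conv a k z = conv k a z"
    using integral_reflect[OF m, of z] by (simp add: conv_def mult.commute)
qed

lemma conv_support:
  assumes "\<And>z. z \<notin> Q \<Longrightarrow> a z = 0" "\<And>z. z \<notin> cball 0 e \<Longrightarrow> k z = 0"
    "z \<notin> {x + y | x y. x \<in> Q \<and> y \<in> cball 0 e}"
  shows "conv a k z = 0"
proof -
  have "a v * k (z - v) = 0" for v
  proof (cases "v \<in> Q")
    case True
    have "z - v \<notin> cball 0 e"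
    proof
      assume "z - v \<in> cball 0 e"
      then have "v + (z - v) \<in> {x + y | x y. x \<in> Q \<and> y \<in> cball 0 e}" using True by blast
      then show False using assms(3) by simp
    qed
    then show ?thesis using assms(2) by simp
  qed (use assms(1) in simp)
  then show ?thesis unfolding conv_def by (simp only: integral_zero)
qed

text \<open>The same \<open>kxy\<close> occurs as the y-partial of \<open>kx\<close> and as the
  x-partial of \<open>ky\<close>. This symmetry of the second derivatives is what the curl identity
  rests on.\<close>

lemma C1_partials_bump_partials:
  assumes "0 < e"
  shows "\<exists>kx ky kxx kxy kyy.
    C1_partials (\<lambda>z. of_real (bump 3 e z)) kx ky \<and> C1_partials kx kxx kxy \<and> C1_partials ky kxy kyy \<and>
    (\<forall>z. z \<notin> cball 0 e \<longrightarrow> kx z = 0 \<and> ky z = 0)"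
proof -
  have b3: "(3::nat) = Suc (Suc (Suc 0))" "(2::nat) = Suc (Suc 0)" by simp_all
  define c where "c = - (6 / e\<^sup>2)"
  define d where "d = - (4 / e\<^sup>2)"
  have Re: "C1_partials (\<lambda>z. of_real (c * Re z)) (\<lambda>z. of_real c) (\<lambda>z. of_real 0)"
    by (rule C1_partials_of_real) (auto intro!: derivative_eq_intros simp: mult.commute)
  have Im: "C1_partials (\<lambda>z. of_real (c * Im z)) (\<lambda>z. of_real 0) (\<lambda>z. of_real c)"
    by (rule C1_partials_of_real) (auto intro!: derivative_eq_intros simp: mult.commute)
  have b: "C1_partials (\<lambda>z. of_real (bump 2 e z)) (\<lambda>z. of_real (d * Re z * bump (Suc 0) e z))
     (\<lambda>z. of_real (d * Im z * bump (Suc 0) e z))"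
    using C1_partials_bump[of 0 e] by (simp add: d_def b3)
  have k: "C1_partials (\<lambda>z. of_real (bump 3 e z)) (\<lambda>z. of_real (c * Re z) * of_real (bump 2 e z))
     (\<lambda>z. of_real (c * Im z) * of_real (bump 2 e z))"
    using C1_partials_bump[of 1 e] by (simp add: c_def b3)
  have eq: "(\<lambda>z. of_real (c * Im z) * of_real (d * Re z * bump (Suc 0) e z) + of_real 0 * of_real (bump 2 e z) :: complex)
    = (\<lambda>z. of_real (c * Re z) * of_real (d * Im z * bump (Suc 0) e z) + of_real 0 * of_real (bump 2 e z))"
    by (simp add: fun_eq_iff)
  have z: "bump 2 e z = 0" if "z \<notin> cball 0 e" for z
    using bump_zero[of 2 e z] assms that by simp
  show ?thesis
    by (intro exI, rule conjI[OF k conjI[OF C1_partials_mult[OF Re b]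
          conjI[OF C1_partials_mult[OF Im b, unfolded eq]]]]) (use z in simp)
qed

text \<open>A weak gradient is curl free against \<open>C\<^sup>1\<close> test functions. The integration by parts needs
  two derivatives on the test function, which is mollified for that purpose.\<close>

lemma weak_gradient_curl_free:
  fixes u p q :: "complex \<Rightarrow> complex"
  assumes V: "open V"
    and px: "\<And>\<psi> \<psi>x \<psi>y. C1_test V \<psi> \<psi>x \<psi>y \<Longrightarrow> (LBINT z. u z * \<psi>x z) = - (LBINT z. p z * \<psi> z)"
    and qy: "\<And>\<psi> \<psi>x \<psi>y. C1_test V \<psi> \<psi>x \<psi>y \<Longrightarrow> (LBINT z. u z * \<psi>y z) = - (LBINT z. q z * \<psi> z)"
    and pc: "continuous_on V p" "continuous_on V q"
    and t: "C1_test V \<psi> \<psi>x \<psi>y"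
  shows "(LBINT z. p z * \<psi>y z) = (LBINT z. q z * \<psi>x z)"
proof -
  obtain Q where Q: "compact Q" "Q \<subseteq> V" "\<And>z. z \<notin> Q \<Longrightarrow> \<psi> z = 0" and C: "C1_partials \<psi> \<psi>x \<psi>y"
    using t unfolding C1_test_def by auto
  note D = C1_partialsD[OF C]
  note Z = C1_partials_zero_outside[OF C compact_imp_closed[OF Q(1)] Q(3)]
  obtain s where s: "0 < s" "(\<Union>x\<in>Q. cball x s) \<subseteq> V"
    using compact_subset_open_imp_cball_epsilon_subset[OF Q(1) V Q(2)] by blast
  \<comment> \<open>A compact neighbourhood of the support inside V that contains the supports of
    all mollified test functions with scale at most s.\<close>
  define Q1 where "Q1 = {x + y | x y. x \<in> Q \<and> y \<in> cball 0 s}"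
  have Q1: "compact Q1" "Q1 \<subseteq> V" "Q \<subseteq> Q1"
  proof -
    show "compact Q1" unfolding Q1_def by (intro compact_sums Q) auto
    show "Q1 \<subseteq> V" using s(2) by (force simp: Q1_def dist_norm)
    show "Q \<subseteq> Q1" using s(1) by (force simp: Q1_def intro: exI[of _ 0])
  qed
  obtain B where B: "\<And>z. norm (\<psi> z) \<le> B" "\<And>z. norm (\<psi>x z) \<le> B" "\<And>z. norm (\<psi>y z) \<le> B"
    using C1_compact_bounds[OF C Q(1,3)] by blast
  have psi_i: "integrable lborel \<psi>" "integrable lborel \<psi>x" "integrable lborel \<psi>y"
    by (intro integrable_continuous_compact[OF _ Q(1)] D Q(3) Z; assumption)+
  have ipq: "integrable lborel (\<lambda>z. g z * indicator Q1 z)" if "continuous_on V g" for g :: "complex \<Rightarrow> complex"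
    using borel_integrable_compact[OF Q1(1) continuous_on_subset[OF that Q1(2)]]
    by (rule Bochner_Integration.integrable_cong[OF refl, THEN iffD1, rotated]) (auto simp: indicator_def)
  define P where "P = (LBINT z. norm (p z * indicator Q1 z)) + (LBINT z. norm (q z * indicator Q1 z))"
  have P0: "0 \<le> P" by (simp add: P_def)
  have key: "norm ((LBINT z. p z * \<psi>y z) - (LBINT z. q z * \<psi>x z)) \<le> d * P" if d: "0 < d" for d
  proof -
    obtain s1 where s1: "0 < s1" "\<And>z w. dist z w < s1 \<Longrightarrow> dist (\<psi>x z) (\<psi>x w) < d"
      by (rule uniformly_continuous_compact_support[OF D(2) Q(1) Z(1) d]) auto
    obtain s2 where s2: "0 < s2" "\<And>z w. dist z w < s2 \<Longrightarrow> dist (\<psi>y z) (\<psi>y w) < d"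
      by (rule uniformly_continuous_compact_support[OF D(3) Q(1) Z(2) d]) auto
    define e where "e = min s (min s1 s2)"
    have e: "0 < e" "e \<le> s" "e \<le> s1" "e \<le> s2" using s(1) s1(1) s2(1) by (auto simp: e_def)
    define M where "M = (LBINT z. bump 3 e z)"
    have M: "0 < M" unfolding M_def by (rule bump_integral_pos) (use e in auto)
    let ?k = "\<lambda>z. of_real (bump 3 e z) :: complex"
    obtain kx ky kxx kxy kyy where k: "C1_partials ?k kx ky" "C1_partials kx kxx kxy" "C1_partials ky kxy kyy"
      "\<forall>z. z \<notin> cball 0 e \<longrightarrow> kx z = 0 \<and> ky z = 0"
      using C1_partials_bump_partials[OF e(1)] by (elim exE conjE)
    have k4: "z \<notin> cball 0 e \<Longrightarrow> kx z = 0" and k5: "z \<notin> cball 0 e \<Longrightarrow> ky z = 0" for z using k(4) by simp_all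
    have k0: "z \<notin> cball 0 e \<Longrightarrow> ?k z = 0" for z using bump_zero[of 3 e z] e(1) by simp
    obtain B1 where B1: "\<And>z. norm (?k z) \<le> B1" "\<And>z. norm (kx z) \<le> B1" "\<And>z. norm (ky z) \<le> B1"
      using C1_compact_bounds[OF k(1) compact_cball k0] by blast
    obtain B2 where B2: "\<And>z. norm (kx z) \<le> B2" "\<And>z. norm (kxx z) \<le> B2" "\<And>z. norm (kxy z) \<le> B2"
      using C1_compact_bounds[OF k(2) compact_cball k4] by blast
    obtain B3 where B3: "\<And>z. norm (ky z) \<le> B3" "\<And>z. norm (kxy z) \<le> B3" "\<And>z. norm (kyy z) \<le> B3"
      using C1_compact_bounds[OF k(3) compact_cball k5] by blast
    have supp: "conv \<phi> g z = 0" if "\<And>z. z \<notin> Q \<Longrightarrow> \<phi> z = 0" "\<And>z. z \<notin> cball 0 e \<Longrightarrow> g z = 0" "z \<notin> Q1" for \<phi> g z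
      by (rule conv_support[of Q \<phi> s g]) (use that e in \<open>auto simp: Q1_def\<close>)
    have tx: "C1_test V (conv \<psi> kx) (conv \<psi> kxx) (conv \<psi> kxy)"
      unfolding C1_test_def
      by (intro conjI exI[of _ Q1] allI impI C1_partials_conv[OF psi_i(1) k(2) B2] Q1 supp[OF Q(3) k4])
    have ty: "C1_test V (conv \<psi> ky) (conv \<psi> kxy) (conv \<psi> kyy)"
      unfolding C1_test_def
      by (intro conjI exI[of _ Q1] allI impI C1_partials_conv[OF psi_i(1) k(3) B3] Q1 supp[OF Q(3) k5])
    \<comment> \<open>Both integrals equal minus the integral of u times
      \<open>conv \<psi> kxy\<close>: the left one by the x-equation for
      \<open>conv \<psi> ky\<close>, the right one by the y-equation for
      \<open>conv \<psi> kx\<close>.\<close>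
    have "(LBINT z. p z * conv \<psi> ky z) = (LBINT z. q z * conv \<psi> kx z)"
      using px[OF ty] qy[OF tx] by simp
    \<comment> \<open>The derivatives return to \<psi>, since the mollification is only wanted on
      \<open>\<psi>x\<close> and \<open>\<psi>y\<close>, which are continuous and can be
      approximated uniformly.\<close>
    moreover have "conv \<psi> kx = conv \<psi>x ?k" "conv \<psi> ky = conv \<psi>y ?k"
    proof -
      note kc = C1_partialsD(4)[OF k(1)]
      have ki: "integrable lborel ?k" by (rule integrable_continuous_compact[OF kc compact_cball k0])
      have 1: "C1_partials (conv \<psi> ?k) (conv \<psi> kx) (conv \<psi> ky)"
        by (rule C1_partials_conv[OF psi_i(1) k(1) B1])
      have 2: "C1_partials (conv \<psi> ?k) (conv ?k \<psi>x) (conv ?k \<psi>y)"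
        unfolding conv_commute[OF D(4) kc] by (rule C1_partials_conv[OF ki C B])
      show "conv \<psi> kx = conv \<psi>x ?k" "conv \<psi> ky = conv \<psi>y ?k"
        using C1_partials_unique[OF 1 2] conv_commute[OF D(2) kc] conv_commute[OF D(3) kc] by auto
    qed
    ultimately have E: "(LBINT z. p z * conv \<psi>y ?k z) = (LBINT z. q z * conv \<psi>x ?k z)" by simp
    have est: "norm ((LBINT z. g z * conv \<phi> ?k z) - (LBINT z. g z * \<phi> z) * of_real M)
        \<le> d * M * (LBINT z. norm (g z * indicator Q1 z))"
      if g: "continuous_on V g" and \<phi>: "continuous_on UNIV \<phi>" "\<And>z. z \<notin> Q \<Longrightarrow> \<phi> z = 0" "integrable lborel \<phi>"
        and osc: "\<And>z w. dist z w < e \<Longrightarrow> dist (\<phi> z) (\<phi> w) < d" for g \<phi> :: "complex \<Rightarrow> complex"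
    proof -
      note kc = C1_partialsD(4)[OF k(1)]
      have cc: "continuous_on UNIV (conv \<phi> ?k)" by (rule conv_continuous[OF \<phi>(3) kc B1(1)])
      have i1: "integrable lborel (\<lambda>z. g z * conv \<phi> ?k z)"
        by (rule integrable_cutoff[OF V g cc Q1(1,2)]) (rule supp[OF \<phi>(2) k0])
      have i2: "integrable lborel (\<lambda>z. g z * \<phi> z * of_real M)"
        by (intro integrable_mult_left integrable_cutoff[OF V g \<phi>(1) Q(1,2)] \<phi>(2))
      have "norm ((LBINT z. g z * conv \<phi> ?k z) - (LBINT z. g z * \<phi> z) * of_real M)
        = norm (LBINT z. g z * conv \<phi> ?k z - g z * \<phi> z * of_real M)"
        using Bochner_Integration.integral_diff[OF i1 i2] by simp
      also have "\<dots> \<le> (LBINT z. d * M * norm (g z * indicator Q1 z))"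
      proof (rule Bochner_Integration.integral_norm_bound_integral)
        show "integrable lborel (\<lambda>z. g z * conv \<phi> ?k z - g z * \<phi> z * of_real M)"
          by (rule Bochner_Integration.integrable_diff[OF i1 i2])
        show "integrable lborel (\<lambda>z. d * M * norm (g z * indicator Q1 z))"
          by (intro integrable_mult_right integrable_norm ipq g)
        fix z
        show "norm (g z * conv \<phi> ?k z - g z * \<phi> z * of_real M) \<le> d * M * norm (g z * indicator Q1 z)"
        proof (cases "z \<in> Q1")
          case True
          have "norm (conv \<phi> ?k z - \<phi> z * of_real M) \<le> d * M"
            unfolding M_def
          proof (rule conv_approx[where e = e])
            show "integrable lborel (bump 3 e)" by (rule bump_integrable) (use e in auto)
            show "0 \<le> bump 3 e z" for z by (rule bump_nonneg)
            show "e \<le> norm z \<Longrightarrow> bump 3 e z = 0" for z using bump_zero[of 3 e z] e(1) by simp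
            show "integrable lborel (\<lambda>v. \<phi> v * of_real (bump 3 e (z - v)))"
              by (rule conv_integrable[OF \<phi>(3) kc B1(1)])
            show "norm (\<phi> v - \<phi> z) \<le> d" if "norm (z - v) < e" for v
              using osc[of v z] that by (simp add: dist_norm norm_minus_commute)
          qed
          then have "norm (g z) * norm (conv \<phi> ?k z - \<phi> z * of_real M) \<le> norm (g z) * (d * M)"
            by (intro mult_left_mono) auto
          moreover have "g z * conv \<phi> ?k z - g z * \<phi> z * of_real M = g z * (conv \<phi> ?k z - \<phi> z * of_real M)"
            by (simp add: algebra_simps)
          ultimately show ?thesis using True by (simp add: norm_mult mult.commute)
        next
          case False
          then have "z \<notin> Q" using Q1(3) by auto
          then show ?thesis using supp[OF \<phi>(2) k0 False] \<phi>(2)[of z] False by simp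
        qed
      qed
      finally show ?thesis by simp
    qed
    have "norm ((LBINT z. p z * conv \<psi>y ?k z) - (LBINT z. p z * \<psi>y z) * of_real M) \<le> d * M * (LBINT z. norm (p z * indicator Q1 z))"
      using s2(2) e(4) by (intro est pc D Z psi_i) auto
    moreover have "norm ((LBINT z. q z * conv \<psi>x ?k z) - (LBINT z. q z * \<psi>x z) * of_real M) \<le> d * M * (LBINT z. norm (q z * indicator Q1 z))"
      using s1(2) e(3) by (intro est pc D Z psi_i) auto
    ultimately have "norm (((LBINT z. q z * conv \<psi>x ?k z) - (LBINT z. q z * \<psi>x z) * of_real M)
        - ((LBINT z. p z * conv \<psi>y ?k z) - (LBINT z. p z * \<psi>y z) * of_real M)) \<le> d * M * P"
      unfolding P_def distrib_left by (intro order_trans[OF norm_triangle_ineq4]) linarith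
    also have "((LBINT z. q z * conv \<psi>x ?k z) - (LBINT z. q z * \<psi>x z) * of_real M)
        - ((LBINT z. p z * conv \<psi>y ?k z) - (LBINT z. p z * \<psi>y z) * of_real M)
        = ((LBINT z. p z * \<psi>y z) - (LBINT z. q z * \<psi>x z)) * of_real M"
      unfolding E by (simp add: algebra_simps)
    finally have "norm ((LBINT z. p z * \<psi>y z) - (LBINT z. q z * \<psi>x z)) * M \<le> d * P * M"
      using M by (simp add: norm_mult mult_ac)
    then show ?thesis using M by simp
  qed
  have "norm ((LBINT z. p z * \<psi>y z) - (LBINT z. q z * \<psi>x z)) \<le> 0"
  proof (rule field_le_epsilon)
    fix d :: real assume d: "0 < d"
    have "norm ((LBINT z. p z * \<psi>y z) - (LBINT z. q z * \<psi>x z)) \<le> d / (P + 1) * P"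
      using key[of "d / (P + 1)"] d P0 by simp
    also have "\<dots> \<le> d" using d P0 by (simp add: field_simps)
    finally show "norm ((LBINT z. p z * \<psi>y z) - (LBINT z. q z * \<psi>x z)) \<le> 0 + d" by simp
  qed
  then show ?thesis by simp
qed

section \<open>Passage to the complex plane\<close>

definition to_complex :: "real^2 \<Rightarrow> complex" where
  "to_complex x = Complex (x $ 1) (x $ 2)"

definition of_complex :: "complex \<Rightarrow> real^2" where
  "of_complex z = vector [Re z, Im z]"

lemma of_to_complex [simp]: "of_complex (to_complex x) = x"
  by (simp add: of_complex_def to_complex_def vec_eq_iff forall_2)

lemma to_of_complex [simp]: "to_complex (of_complex z) = z"
  by (simp add: of_complex_def to_complex_def)

lemma norm_to_complex [simp]: "norm (to_complex x) = norm x"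
  by (simp add: to_complex_def norm_vec_def L2_set_def sum_2 cmod_def)

lemma norm_of_complex [simp]: "norm (of_complex z) = norm z"
  using norm_to_complex[of "of_complex z"] by simp

lemma bounded_linear_to_complex: "bounded_linear to_complex"
proof (rule bounded_linear_intro[where K = 1])
  show "norm (to_complex x) \<le> norm x * 1" for x by simp
qed (auto simp: to_complex_def complex_eq_iff)

lemma bounded_linear_of_complex: "bounded_linear of_complex"
proof (rule bounded_linear_intro[where K = 1])
  show "norm (of_complex z) \<le> norm z * 1" for z by simp
qed (auto simp: of_complex_def vec_eq_iff forall_2)

lemma continuous_on_to_complex: "continuous_on A to_complex"
  by (rule linear_continuous_on[OF bounded_linear_to_complex])

lemma continuous_on_of_complex: "continuous_on A of_complex"
  by (rule linear_continuous_on[OF bounded_linear_of_complex])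

lemma to_complex_measurable [measurable]: "to_complex \<in> borel_measurable borel"
  by (intro borel_measurable_continuous_onI continuous_on_to_complex)

text \<open>Boxes pull back to boxes with the same side lengths, and Lebesgue measure is determined
  by its values on boxes.\<close>

lemma distr_to_complex: "distr lborel borel to_complex = lborel"
proof (rule lborel_eqI[symmetric])
  fix l u :: complex assume lu: "\<And>b. b \<in> Basis \<Longrightarrow> l \<bullet> b \<le> u \<bullet> b"
  have le: "Re l \<le> Re u" "Im l \<le> Im u" using lu[of 1] lu[of \<i>] by (auto simp: Basis_complex_def)
  have B: "(Basis :: (real^2) set) = {axis 1 1, axis 2 1}"
    by (auto simp: Basis_vec_def UNIV_2)
  have ne: "axis 1 1 \<noteq> (axis 2 1 :: real^2)" by (simp add: axis_eq_axis)
  have "emeasure (distr lborel borel to_complex) (box l u) = emeasure lborel (to_complex -` box l u)"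
    by (subst emeasure_distr) auto
  also have "to_complex -` box l u = box (of_complex l) (of_complex u)"
    by (auto simp: mem_box_cart forall_2 of_complex_def to_complex_def in_box_complex_iff)
  also have "emeasure lborel \<dots> = (\<Prod>b\<in>Basis. (of_complex u - of_complex l) \<bullet> b)"
    using le by (intro emeasure_lborel_box) (auto simp: B inner_axis of_complex_def)
  also have "(\<Prod>b\<in>Basis. (of_complex u - of_complex l) \<bullet> b) = (\<Prod>b\<in>Basis. (u - l) \<bullet> b)"
    using ne by (simp add: B inner_axis of_complex_def Basis_complex_def)
  finally show "emeasure (distr lborel borel to_complex) (box l u) = ennreal (\<Prod>b\<in>Basis. (u - l) \<bullet> b)" .
qed simp

lemma AE_to_complex:
  assumes "Measurable.pred borel P" "AE x in lebesgue. P (to_complex x)"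
  shows "AE z in lborel. P z"
proof -
  have "AE x in lborel. P (to_complex x)" using assms(2) by (simp add: AE_completion_iff)
  then have "AE z in distr lborel borel to_complex. P z"
    using assms(1) by (subst AE_distr_iff) auto
  then show ?thesis unfolding distr_to_complex .
qed

lemma exterior_eq: "interior (- ball 0 1) = {x::real^2. 1 < norm x}"
  by (auto simp: interior_complement)

text \<open>The Borel function \<open>F0\<close> on the complex plane represents the Lebesgue measurable
  function \<open>F\<close> on the exterior domain.\<close>

definition exterior_rep :: "(real^2 \<Rightarrow> real) \<Rightarrow> (complex \<Rightarrow> real) \<Rightarrow> bool" where
  "exterior_rep F F0 \<longleftrightarrow> F \<in> borel_measurable (lebesgue_on {x. 1 < norm x}) \<and> F0 \<in> borel_measurable borel \<and>
     (\<forall>z. norm z \<le> 1 \<longrightarrow> F0 z = 0) \<and> (AE x in lebesgue. 1 < norm x \<longrightarrow> F x = F0 (to_complex x))"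

lemma open_exterior: "open {x::'a::real_normed_vector. 1 < norm x}"
  by (intro open_Collect_less continuous_intros)

lemma exterior_lebesgue: "{x::real^2. 1 < norm x} \<in> sets lebesgue"
  using open_exterior by (intro sets_completionI_sets) (simp add: borel_open)

lemma exterior_rep_AE:
  assumes "exterior_rep F F0"
  shows "AE x in lebesgue. indicator {x. 1 < norm x} x *\<^sub>R F x = F0 (to_complex x)"
  using assms unfolding exterior_rep_def
  by (auto elim!: eventually_mono simp: indicator_def)

text \<open>The chain is: extend \<open>F\<close> by zero, replace it by the Borel function almost
  everywhere, drop the completion, and push forward to the complex plane.\<close>

lemma exterior_rep_integral:
  assumes r: "exterior_rep F F0"
  shows "(\<integral>x. F x \<partial>lebesgue_on {x. 1 < norm x}) = (LBINT z. F0 z)"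
    "integrable (lebesgue_on {x. 1 < norm x}) F \<longleftrightarrow> integrable lborel F0"
proof -
  have m[measurable]: "F0 \<in> borel_measurable borel" using r by (simp add: exterior_rep_def)
  have ml: "(\<lambda>x. F0 (to_complex x)) \<in> borel_measurable lborel" by measurable
  have mc: "(\<lambda>x. F0 (to_complex x)) \<in> borel_measurable lebesgue" using measurable_completion[OF ml] .
  have mG: "(\<lambda>x. indicator {x. 1 < norm x} x *\<^sub>R F x) \<in> borel_measurable lebesgue"
    using r exterior_lebesgue unfolding exterior_rep_def
    by (subst borel_measurable_restrict_space_iff[symmetric]) auto
  have "(\<integral>x. F x \<partial>lebesgue_on {x. 1 < norm x}) = (\<integral>x. indicator {x. 1 < norm x} x *\<^sub>R F x \<partial>lebesgue)"
    by (rule integral_restrict_space) (use exterior_lebesgue in auto)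
  also have "\<dots> = (\<integral>x. F0 (to_complex x) \<partial>lebesgue)"
    by (rule integral_cong_AE[OF mG mc exterior_rep_AE[OF r]])
  also have "\<dots> = (LBINT x. F0 (to_complex x))" by (rule integral_completion[OF ml])
  also have "\<dots> = (\<integral>z. F0 z \<partial>distr lborel borel to_complex)" by (subst integral_distr) auto
  finally show "(\<integral>x. F x \<partial>lebesgue_on {x. 1 < norm x}) = (LBINT z. F0 z)" by (simp add: distr_to_complex)
  have "integrable (lebesgue_on {x. 1 < norm x}) F \<longleftrightarrow> integrable lebesgue (\<lambda>x. indicator {x. 1 < norm x} x *\<^sub>R F x)"
    by (rule integrable_restrict_space) (use exterior_lebesgue in auto)
  also have "\<dots> \<longleftrightarrow> integrable lebesgue (\<lambda>x. F0 (to_complex x))"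
    by (rule integrable_cong_AE[OF mG mc exterior_rep_AE[OF r]])
  also have "\<dots> \<longleftrightarrow> integrable lborel (\<lambda>x. F0 (to_complex x))" by (rule integrable_completion[OF ml])
  also have "\<dots> \<longleftrightarrow> integrable (distr lborel borel to_complex) F0" by (subst integrable_distr_eq) auto
  finally show "integrable (lebesgue_on {x. 1 < norm x}) F \<longleftrightarrow> integrable lborel F0" by (simp add: distr_to_complex)
qed

lemma exterior_rep_exists:
  assumes "F \<in> borel_measurable (lebesgue_on {x::real^2. 1 < norm x})"
  shows "\<exists>F0. exterior_rep F F0"
proof -
  have "(\<lambda>x. indicator {x. 1 < norm x} x *\<^sub>R F x) \<in> borel_measurable lebesgue"
    using assms exterior_lebesgue by (subst borel_measurable_restrict_space_iff[symmetric]) auto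
  then obtain G where G: "G \<in> borel_measurable lborel" "AE x in lborel. indicator {x. 1 < norm x} x *\<^sub>R F x = G x"
    using completion_ex_borel_measurable_real by blast
  have Gm[measurable]: "G \<in> borel_measurable borel" using G(1) by simp
  have [measurable]: "of_complex \<in> borel_measurable borel"
    by (intro borel_measurable_continuous_onI continuous_on_of_complex)
  have "exterior_rep F (\<lambda>z. if 1 < norm z then G (of_complex z) else 0)"
    unfolding exterior_rep_def
  proof (intro conjI assms)
    show "(\<lambda>z. if 1 < norm z then G (of_complex z) else 0) \<in> borel_measurable borel" by measurable
    have "AE x in lebesgue. indicator {x. 1 < norm x} x *\<^sub>R F x = G x" using G(2) by (rule AE_completion)
    then show "AE x in lebesgue. 1 < norm x \<longrightarrow> F x = (if 1 < norm (to_complex x) then G (of_complex (to_complex x)) else 0)"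
      by eventually_elim auto
  qed auto
  then show ?thesis by blast
qed

lemma exterior_rep_continuous:
  assumes "continuous_on {x::real^2. 1 < norm x} F"
  shows "exterior_rep F (\<lambda>z. indicator {z. 1 < norm z} z *\<^sub>R F (of_complex z))"
  unfolding exterior_rep_def
proof (intro conjI)
  show "F \<in> borel_measurable (lebesgue_on {x. 1 < norm x})"
    by (rule continuous_imp_measurable_on_sets_lebesgue[OF assms exterior_lebesgue])
  show "(\<lambda>z. indicator {z. 1 < norm z} z *\<^sub>R F (of_complex z)) \<in> borel_measurable borel"
  proof (rule borel_measurable_continuous_on_indicator)
    show "continuous_on {z. 1 < norm z} (\<lambda>z. F (of_complex z))"
      by (rule continuous_on_compose2[OF assms continuous_on_of_complex]) auto
  qed (use open_exterior in \<open>auto intro: borel_open\<close>)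
qed auto

lemma exterior_rep_add:
  "exterior_rep F F0 \<Longrightarrow> exterior_rep G G0 \<Longrightarrow> exterior_rep (\<lambda>x. F x + G x) (\<lambda>z. F0 z + G0 z)"
  unfolding exterior_rep_def by (auto elim: eventually_elim2)

lemma exterior_rep_mult:
  assumes "exterior_rep F F0" "continuous_on UNIV g"
  shows "exterior_rep (\<lambda>x. F x * g (to_complex x)) (\<lambda>z. F0 z * g z)"
proof -
  have [measurable]: "g \<in> borel_measurable borel" using assms(2) by (rule borel_measurable_continuous_onI)
  have m: "(\<lambda>x. g (to_complex x)) \<in> borel_measurable (lebesgue_on {x. 1 < norm x})"
    by (rule measurable_restrict_space1, rule measurable_completion) measurable
  then show ?thesis
    using assms(1) unfolding exterior_rep_def by (auto elim!: eventually_mono)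
qed

text \<open>Local integrability speaks of compact sets only. The closed annuli \<open>K n\<close>
  exhaust the exterior domain, and measurability passes to the pointwise limit of the cut-off
  functions.\<close>

lemma locally_integrable_measurable:
  fixes u :: "real^2 \<Rightarrow> real"
  assumes "locally_integrable {x. 1 < norm x} u"
  shows "u \<in> borel_measurable (lebesgue_on {x. 1 < norm x})"
proof -
  define K where "K n = {x::real^2. 1 + 1 / real (Suc n) \<le> norm x \<and> norm x \<le> real n + 2}" for n
  have K: "compact (K n)" "K n \<subseteq> {x. 1 < norm x}" for n
  proof -
    have "closed (K n)" unfolding K_def
      by (intro closed_Collect_conj closed_Collect_le continuous_intros)
    moreover have "bounded (K n)"
      by (rule bounded_subset[OF bounded_cball[of 0 "real n + 2"]]) (auto simp: K_def)
    ultimately show "compact (K n)" by (simp add: compact_eq_bounded_closed)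
    have "0 < 1 / real (Suc n)" by simp
    then show "K n \<subseteq> {x. 1 < norm x}" unfolding K_def by (intro subsetI CollectI; elim CollectE conjE; linarith)
  qed
  have m: "(\<lambda>x. indicator (K n) x *\<^sub>R u x) \<in> borel_measurable lebesgue" for n
    using assms K[of n] unfolding locally_integrable_def set_integrable_def
    by (intro borel_measurable_integrable) blast
  have lim: "(\<lambda>n. indicator (K n) x *\<^sub>R u x) \<longlonglongrightarrow> indicator {x. 1 < norm x} x *\<^sub>R u x" for x
  proof (cases "1 < norm x")
    case True
    obtain n1 where n1: "1 / real (Suc n1) < norm x - 1"
      using reals_Archimedean[of "norm x - 1"] True by (auto simp: inverse_eq_divide)
    obtain n2 where n2: "norm x \<le> real n2" using real_arch_simple by blast
    have "x \<in> K n" if "max n1 n2 \<le> n" for n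
    proof -
      have "1 / real (Suc n) \<le> 1 / real (Suc n1)" using that by (intro divide_left_mono) auto
      then show ?thesis using n1 n2 that unfolding K_def by (auto simp del: of_nat_Suc)
    qed
    then have "eventually (\<lambda>n. indicator (K n) x *\<^sub>R u x = indicator {x. 1 < norm x} x *\<^sub>R u x) sequentially"
      using True by (auto simp: eventually_sequentially intro!: exI[of _ "max n1 n2"])
    then show ?thesis by (rule tendsto_eventually)
  next
    case False
    then have "x \<notin> K n" for n using K(2)[of n] by auto
    then show ?thesis using False by simp
  qed
  have "(\<lambda>x. indicator {x. 1 < norm x} x *\<^sub>R u x) \<in> borel_measurable lebesgue"
    by (rule borel_measurable_LIMSEQ_metric[where f = "\<lambda>n x. indicator (K n) x *\<^sub>R u x", OF m lim])
  then show ?thesis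
    using exterior_lebesgue by (subst borel_measurable_restrict_space_iff) auto
qed

lemma exterior_rep_locally_integrable:
  assumes r: "exterior_rep F F0" and F: "locally_integrable {x. 1 < norm x} F"
    and Q: "compact Q" "Q \<subseteq> {z. 1 < norm z}"
    and g: "continuous_on UNIV g" "\<And>z. z \<notin> Q \<Longrightarrow> g z = 0"
  shows "integrable lborel (\<lambda>z. of_real (F0 z) * g z :: complex)"
proof -
  have F0m[measurable]: "F0 \<in> borel_measurable borel" using r by (simp add: exterior_rep_def)
  have [measurable]: "Q \<in> sets borel" using Q(1) by (simp add: borel_closed compact_imp_closed)
  have gm[measurable]: "g \<in> borel_measurable borel" using g(1) by (rule borel_measurable_continuous_onI)
  define Q' where "Q' = of_complex ` Q"
  have Q': "compact Q'" "Q' \<subseteq> {x. 1 < norm x}"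
    using Q by (auto simp: Q'_def intro!: compact_continuous_image continuous_on_of_complex)
  have mem: "x \<in> Q' \<longleftrightarrow> to_complex x \<in> Q" for x
  proof
    show "x \<in> Q' \<Longrightarrow> to_complex x \<in> Q" by (auto simp: Q'_def)
    show "to_complex x \<in> Q \<Longrightarrow> x \<in> Q'"
      unfolding Q'_def by (rule image_eqI[of _ _ "to_complex x"]) simp
  qed
  have 1: "integrable lebesgue (\<lambda>x. indicator Q' x *\<^sub>R F x)"
    using F Q' unfolding locally_integrable_def set_integrable_def
    by blast
  have ml: "(\<lambda>x. indicator Q (to_complex x) * F0 (to_complex x)) \<in> borel_measurable lborel" by measurable
  have ae: "AE x in lebesgue. indicator Q' x *\<^sub>R F x = indicator Q (to_complex x) * F0 (to_complex x)"
    using exterior_rep_AE[OF r] by eventually_elim (use Q'(2) in \<open>auto simp: indicator_def mem\<close>)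
  have "integrable lebesgue (\<lambda>x. indicator Q (to_complex x) * F0 (to_complex x))"
    using 1 integrable_cong_AE[OF borel_measurable_integrable[OF 1] measurable_completion[OF ml] ae] by simp
  then have "integrable lborel (\<lambda>x. indicator Q (to_complex x) * F0 (to_complex x))"
    using integrable_completion[OF ml] by simp
  then have "integrable (distr lborel borel to_complex) (\<lambda>z. indicator Q z * F0 z)"
    by (subst integrable_distr_eq) auto
  then have i: "integrable lborel (\<lambda>z. indicator Q z * F0 z)" by (simp add: distr_to_complex)
  have "bounded (g ` Q)"
    by (intro compact_imp_bounded compact_continuous_image continuous_on_subset[OF g(1)] Q) auto
  then obtain B where B: "0 < B" "\<forall>x\<in>g ` Q. norm x \<le> B" using bounded_pos by blast
  show ?thesis
  proof (rule Bochner_Integration.integrable_bound)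
    show "integrable lborel (\<lambda>z. B * (indicator Q z * F0 z))" by (rule integrable_mult_right[OF i])
    show "(\<lambda>z. of_real (F0 z) * g z) \<in> borel_measurable lborel" by measurable
    have "norm (of_real (F0 z) * g z) \<le> norm (B * (indicator Q z * F0 z))" for z
    proof (cases "z \<in> Q")
      case True
      then have "norm (F0 z) * norm (g z) \<le> norm (F0 z) * B" using B by (intro mult_left_mono) auto
      then show ?thesis using True B(1) by (simp add: norm_mult abs_mult mult.commute)
    qed (simp add: g(2))
    then show "AE z in lborel. norm (of_real (F0 z) * g z) \<le> norm (B * (indicator Q z * F0 z))" by simp
  qed
qed

section \<open>From real weak equations to complex ones\<close>

lemma test_function_of_C1_test:
  assumes "C1_test {z. 1 < norm z} \<psi> \<psi>x \<psi>y"
  shows "test_function {x. 1 < norm x} (\<lambda>x. Re (\<psi> (to_complex x)))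
    (\<lambda>x. Re (\<psi>x (to_complex x)) *\<^sub>R axis 1 1 + Re (\<psi>y (to_complex x)) *\<^sub>R axis 2 1)"
proof -
  obtain Q where Q: "compact Q" "Q \<subseteq> {z. 1 < norm z}" "\<And>z. z \<notin> Q \<Longrightarrow> \<psi> z = 0" and C: "C1_partials \<psi> \<psi>x \<psi>y"
    using assms unfolding C1_test_def by auto
  note D = C1_partialsD[OF C]
  show ?thesis
    unfolding test_function_def
  proof (intro conjI allI exI[of _ "of_complex ` Q"] impI)
    fix x
    have "((\<lambda>x. \<psi> (to_complex x)) has_derivative (\<lambda>h. Re (to_complex h) *\<^sub>R \<psi>x (to_complex x) + Im (to_complex h) *\<^sub>R \<psi>y (to_complex x))) (at x)"
      by (rule has_derivative_compose[OF bounded_linear_imp_has_derivative[OF bounded_linear_to_complex] D(1)])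
    from has_derivative_Re[OF this]
    show "GDERIV (\<lambda>x. Re (\<psi> (to_complex x))) x :> Re (\<psi>x (to_complex x)) *\<^sub>R axis 1 1 + Re (\<psi>y (to_complex x)) *\<^sub>R axis 2 1"
      unfolding gderiv_def
      by (rule has_derivative_eq_rhs) (auto simp: to_complex_def inner_axis inner_add_right mult.commute)
    show "continuous_on UNIV (\<lambda>x. Re (\<psi>x (to_complex x)) *\<^sub>R axis 1 1 + Re (\<psi>y (to_complex x)) *\<^sub>R (axis 2 1 :: real^2))"
      by (intro continuous_intros continuous_on_compose2[OF D(2)] continuous_on_compose2[OF D(3)] continuous_on_to_complex) auto
    show "compact (of_complex ` Q)" by (intro compact_continuous_image continuous_on_of_complex Q)
    show "of_complex ` Q \<subseteq> {x. 1 < norm x}" using Q(2) by auto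
    fix x assume "x \<notin> of_complex ` Q"
    then have "to_complex x \<notin> Q" using image_eqI[of x of_complex "to_complex x" Q] by auto
    then show "Re (\<psi> (to_complex x)) = 0" using Q(3) by simp
  qed
qed

text \<open>The real part of \<open>- \<i> * \<psi>\<close> is the imaginary part of
  \<open>\<psi>\<close>, so equations for real test functions, applied to \<open>\<psi>\<close> and
  to its rotation, give the complex equation.\<close>

lemma C1_test_rotate:
  "C1_test V \<psi> \<psi>x \<psi>y \<Longrightarrow> C1_test V (\<lambda>z. - \<i> * \<psi> z) (\<lambda>z. - \<i> * \<psi>x z) (\<lambda>z. - \<i> * \<psi>y z)"
  unfolding C1_test_def using C1_partials_cmult[of \<psi> \<psi>x \<psi>y "- \<i>"] by auto

lemma complex_integral_zero:
  fixes G :: "complex \<Rightarrow> complex"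
  assumes "integrable lborel G" "(LBINT z. Re (G z)) = 0" "(LBINT z. Re (- \<i> * G z)) = 0"
  shows "(LBINT z. G z) = 0"
proof -
  have "Re (LBINT z. G z) = 0"
    using integral_bounded_linear[OF bounded_linear_Re assms(1)] assms(2) by simp
  moreover have "Im (LBINT z. G z) = 0"
    using integral_bounded_linear[OF bounded_linear_Im assms(1)] assms(3) by simp
  ultimately show ?thesis by (simp add: complex_eq_iff)
qed

lemma exterior_vector_integral:
  assumes "exterior_rep F F0" "exterior_rep G G0" "integrable lborel F0" "integrable lborel G0"
  shows "(\<integral>x. F x *\<^sub>R axis 1 1 + G x *\<^sub>R axis 2 1 \<partial>lebesgue_on {x::real^2. 1 < norm x})
    = (LBINT z. F0 z) *\<^sub>R axis 1 1 + (LBINT z. G0 z) *\<^sub>R (axis 2 1 :: real^2)"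
  using assms exterior_rep_integral[OF assms(1)] exterior_rep_integral[OF assms(2)] by simp

lemma axis_components:
  "(a *\<^sub>R axis 1 1 + b *\<^sub>R (axis 2 1 :: real^2)) $ 1 = a"
  "(a *\<^sub>R axis 1 1 + b *\<^sub>R (axis 2 1 :: real^2)) $ 2 = b"
  by (auto simp: axis_def)

lemma axis_expand: "(v :: real^2) = (v $ 1) *\<^sub>R axis 1 1 + (v $ 2) *\<^sub>R axis 2 1"
  by (auto simp: vec_eq_iff forall_2 axis_def)

text \<open>The indicator makes the function vanish on the closed unit disc, as
  \<open>exterior_rep\<close> demands.\<close>

definition ext_fun :: "(real^2 \<Rightarrow> real) \<Rightarrow> complex \<Rightarrow> real" where
  "ext_fun F z = indicator {z. 1 < norm z} z *\<^sub>R F (of_complex z)"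

definition complex_gradient :: "(real^2 \<Rightarrow> real^2) \<Rightarrow> complex \<Rightarrow> complex" where
  "complex_gradient Du z = of_real (ext_fun (\<lambda>x. Du x $ 1) z) - \<i> * of_real (ext_fun (\<lambda>x. Du x $ 2) z)"

lemma ext_fun_continuous:
  assumes "continuous_on {x. 1 < norm x} F"
  shows "continuous_on {z. 1 < norm z} (\<lambda>z. of_real (ext_fun F z) :: complex)"
proof -
  have "continuous_on {z. 1 < norm z} (\<lambda>z. of_real (F (of_complex z)) :: complex)"
    by (intro continuous_intros continuous_on_compose2[OF assms continuous_on_of_complex]) auto
  then show ?thesis by (rule continuous_on_eq) (auto simp: ext_fun_def)
qed

text \<open>The weak formulation tests with real functions. Each complex identity is obtained from
  Re \<psi> and from Re (- i \<psi>) = Im \<psi>, and the vector identity for the weak gradient is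
  read off by components.\<close>

lemma complex_weak_equations:
  fixes u :: "real^2 \<Rightarrow> real" and Du W :: "real^2 \<Rightarrow> real^2"
  assumes sol: "weak_drift_solution {x. 1 < norm x} W u Du"
    and Duc: "continuous_on {x. 1 < norm x} Du"
    and u0: "exterior_rep u u0" and g0: "exterior_rep (\<lambda>x. W x \<bullet> Du x) g0"
    and t: "C1_test {z. 1 < norm z} \<psi> \<psi>x \<psi>y"
  defines "p0 \<equiv> ext_fun (\<lambda>x. Du x $ 1)" and "q0 \<equiv> ext_fun (\<lambda>x. Du x $ 2)"
  shows "(LBINT z. of_real (u0 z) * \<psi>x z) = - (LBINT z. of_real (p0 z) * \<psi> z)" (is ?A)
    "(LBINT z. of_real (u0 z) * \<psi>y z) = - (LBINT z. of_real (q0 z) * \<psi> z)" (is ?B)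
    "(LBINT z. of_real (p0 z) * \<psi>x z + of_real (q0 z) * \<psi>y z + of_real (g0 z) * \<psi> z) = 0" (is ?C)
proof -
  let ?\<Omega> = "{x::real^2. 1 < norm x}" and ?U = "{z::complex. 1 < norm z}"
  have Du12: "continuous_on ?\<Omega> (\<lambda>x. Du x $ 1)" "continuous_on ?\<Omega> (\<lambda>x. Du x $ 2)"
    by (intro continuous_intros Duc)+
  have p0: "exterior_rep (\<lambda>x. Du x $ 1) p0" and q0: "exterior_rep (\<lambda>x. Du x $ 2) q0"
    using exterior_rep_continuous[OF Du12(1)] exterior_rep_continuous[OF Du12(2)]
    by (simp_all add: p0_def q0_def ext_fun_def[abs_def])
  have wg: "weak_gradient ?\<Omega> u Du" and lg: "locally_integrable ?\<Omega> (\<lambda>x. W x \<bullet> Du x)"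
    and eq2: "\<And>\<phi> D\<phi>. test_function ?\<Omega> \<phi> D\<phi> \<Longrightarrow> (\<integral>x. Du x \<bullet> D\<phi> x + (W x \<bullet> Du x) * \<phi> x \<partial>lebesgue_on ?\<Omega>) = 0"
    using sol unfolding weak_drift_solution_def by auto
  have lu: "locally_integrable ?\<Omega> u"
    and eq1: "\<And>\<phi> D\<phi>. test_function ?\<Omega> \<phi> D\<phi> \<Longrightarrow> (\<integral>x. u x *\<^sub>R D\<phi> x \<partial>lebesgue_on ?\<Omega>) = - (\<integral>x. \<phi> x *\<^sub>R Du x \<partial>lebesgue_on ?\<Omega>)"
    using wg unfolding weak_gradient_def by auto
  have ints: "integrable lborel (\<lambda>z. of_real (u0 z) * \<psi>x z)" "integrable lborel (\<lambda>z. of_real (u0 z) * \<psi>y z)"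
      "integrable lborel (\<lambda>z. of_real (g0 z) * \<psi> z)"
      "integrable lborel (\<lambda>z. of_real (p0 z) * \<psi> z)" "integrable lborel (\<lambda>z. of_real (p0 z) * \<psi>x z)"
      "integrable lborel (\<lambda>z. of_real (q0 z) * \<psi> z)" "integrable lborel (\<lambda>z. of_real (q0 z) * \<psi>y z)"
    if t: "C1_test ?U \<psi> \<psi>x \<psi>y" for \<psi> \<psi>x \<psi>y
  proof -
    obtain Q where Q: "compact Q" "Q \<subseteq> ?U" "\<And>z. z \<notin> Q \<Longrightarrow> \<psi> z = 0" and C: "C1_partials \<psi> \<psi>x \<psi>y"
      using t unfolding C1_test_def by auto
    note D = C1_partialsD[OF C]
    note Z = C1_partials_zero_outside[OF C compact_imp_closed[OF Q(1)] Q(3)]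
    show "integrable lborel (\<lambda>z. of_real (u0 z) * \<psi>x z)" "integrable lborel (\<lambda>z. of_real (u0 z) * \<psi>y z)"
      using exterior_rep_locally_integrable[OF u0 lu Q(1,2) D(2) Z(1)]
        exterior_rep_locally_integrable[OF u0 lu Q(1,2) D(3) Z(2)] by auto
    show "integrable lborel (\<lambda>z. of_real (g0 z) * \<psi> z)"
      by (rule exterior_rep_locally_integrable[OF g0 lg Q(1,2) D(4) Q(3)])
    note pc = ext_fun_continuous[OF Du12(1), folded p0_def] and qc = ext_fun_continuous[OF Du12(2), folded q0_def]
    show "integrable lborel (\<lambda>z. of_real (p0 z) * \<psi> z)" "integrable lborel (\<lambda>z. of_real (p0 z) * \<psi>x z)"
      using integrable_cutoff[OF open_exterior pc D(4) Q] integrable_cutoff[OF open_exterior pc D(2) Q(1,2) Z(1)] by auto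
    show "integrable lborel (\<lambda>z. of_real (q0 z) * \<psi> z)" "integrable lborel (\<lambda>z. of_real (q0 z) * \<psi>y z)"
      using integrable_cutoff[OF open_exterior qc D(4) Q] integrable_cutoff[OF open_exterior qc D(3) Q(1,2) Z(2)] by auto
  qed
  have Rei: "integrable lborel (\<lambda>z. r z * Re (\<psi> z))" if "integrable lborel (\<lambda>z. of_real (r z) * \<psi> z)"
    for r :: "complex \<Rightarrow> real" and \<psi>
    using integrable_bounded_linear[OF bounded_linear_Re that] by simp
  have real: "(LBINT z. u0 z * Re (\<psi>x z)) = - (LBINT z. p0 z * Re (\<psi> z))"
    "(LBINT z. u0 z * Re (\<psi>y z)) = - (LBINT z. q0 z * Re (\<psi> z))"
    "(LBINT z. p0 z * Re (\<psi>x z) + q0 z * Re (\<psi>y z) + g0 z * Re (\<psi> z)) = 0"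
    if t: "C1_test ?U \<psi> \<psi>x \<psi>y" for \<psi> \<psi>x \<psi>y
  proof -
    have C: "C1_partials \<psi> \<psi>x \<psi>y" using t by (simp add: C1_test_def)
    have c: "continuous_on UNIV (\<lambda>z. Re (\<psi> z))" "continuous_on UNIV (\<lambda>z. Re (\<psi>x z))" "continuous_on UNIV (\<lambda>z. Re (\<psi>y z))"
      by (intro continuous_intros C1_partialsD[OF C])+
    note tf = test_function_of_C1_test[OF t]
    note I = ints[OF t]
    have "(\<integral>x. (u x * Re (\<psi>x (to_complex x))) *\<^sub>R axis 1 1 + (u x * Re (\<psi>y (to_complex x))) *\<^sub>R (axis 2 1 :: real^2) \<partial>lebesgue_on ?\<Omega>)
      = - (\<integral>x. (Du x $ 1 * Re (\<psi> (to_complex x))) *\<^sub>R axis 1 1 + (Du x $ 2 * Re (\<psi> (to_complex x))) *\<^sub>R (axis 2 1 :: real^2) \<partial>lebesgue_on ?\<Omega>)"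
    proof -
      have "(\<lambda>x. Re (\<psi> (to_complex x)) *\<^sub>R Du x) = (\<lambda>x. (Du x $ 1 * Re (\<psi> (to_complex x))) *\<^sub>R axis 1 1 + (Du x $ 2 * Re (\<psi> (to_complex x))) *\<^sub>R axis 2 1)"
      proof
        fix x
        show "Re (\<psi> (to_complex x)) *\<^sub>R Du x = (Du x $ 1 * Re (\<psi> (to_complex x))) *\<^sub>R axis 1 1 + (Du x $ 2 * Re (\<psi> (to_complex x))) *\<^sub>R axis 2 1"
          by (subst axis_expand[of "Du x"]) (simp add: scaleR_add_right mult.commute)
      qed
      then show ?thesis using eq1[OF tf] by (simp add: scaleR_add_right)
    qed
    also have "(\<integral>x. (u x * Re (\<psi>x (to_complex x))) *\<^sub>R axis 1 1 + (u x * Re (\<psi>y (to_complex x))) *\<^sub>R (axis 2 1 :: real^2) \<partial>lebesgue_on ?\<Omega>)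
       = (LBINT z. u0 z * Re (\<psi>x z)) *\<^sub>R axis 1 1 + (LBINT z. u0 z * Re (\<psi>y z)) *\<^sub>R (axis 2 1 :: real^2)"
      by (rule exterior_vector_integral[OF exterior_rep_mult[OF u0 c(2)] exterior_rep_mult[OF u0 c(3)] Rei[OF I(1)] Rei[OF I(2)]])
    also have "(\<integral>x. (Du x $ 1 * Re (\<psi> (to_complex x))) *\<^sub>R axis 1 1 + (Du x $ 2 * Re (\<psi> (to_complex x))) *\<^sub>R (axis 2 1 :: real^2) \<partial>lebesgue_on ?\<Omega>)
       = (LBINT z. p0 z * Re (\<psi> z)) *\<^sub>R axis 1 1 + (LBINT z. q0 z * Re (\<psi> z)) *\<^sub>R (axis 2 1 :: real^2)"
      by (rule exterior_vector_integral[OF exterior_rep_mult[OF p0 c(1)] exterior_rep_mult[OF q0 c(1)] Rei[OF I(4)] Rei[OF I(6)]])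
    finally have v: "(LBINT z. u0 z * Re (\<psi>x z)) *\<^sub>R axis 1 1 + (LBINT z. u0 z * Re (\<psi>y z)) *\<^sub>R (axis 2 1 :: real^2)
       = - ((LBINT z. p0 z * Re (\<psi> z)) *\<^sub>R axis 1 1 + (LBINT z. q0 z * Re (\<psi> z)) *\<^sub>R (axis 2 1 :: real^2))" .
    show "(LBINT z. u0 z * Re (\<psi>x z)) = - (LBINT z. p0 z * Re (\<psi> z))"
      using arg_cong[OF v, of "\<lambda>v::real^2. v $ 1"] by (simp only: uminus_vec_def vec_lambda_beta axis_components vector_uminus_component)
    show "(LBINT z. u0 z * Re (\<psi>y z)) = - (LBINT z. q0 z * Re (\<psi> z))"
      using arg_cong[OF v, of "\<lambda>v::real^2. v $ 2"] by (simp only: axis_components vector_uminus_component)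
    have rep: "exterior_rep (\<lambda>x. Du x $ 1 * Re (\<psi>x (to_complex x)) + Du x $ 2 * Re (\<psi>y (to_complex x)) + (W x \<bullet> Du x) * Re (\<psi> (to_complex x)))
        (\<lambda>z. p0 z * Re (\<psi>x z) + q0 z * Re (\<psi>y z) + g0 z * Re (\<psi> z))"
      by (intro exterior_rep_add exterior_rep_mult[OF p0 c(2)] exterior_rep_mult[OF q0 c(3)] exterior_rep_mult[OF g0 c(1)])
    have "(\<lambda>x. Du x \<bullet> (Re (\<psi>x (to_complex x)) *\<^sub>R axis 1 1 + Re (\<psi>y (to_complex x)) *\<^sub>R axis 2 1) + (W x \<bullet> Du x) * Re (\<psi> (to_complex x)))
      = (\<lambda>x. Du x $ 1 * Re (\<psi>x (to_complex x)) + Du x $ 2 * Re (\<psi>y (to_complex x)) + (W x \<bullet> Du x) * Re (\<psi> (to_complex x)))"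
      by (simp add: fun_eq_iff inner_add_right inner_axis mult.commute)
    then show "(LBINT z. p0 z * Re (\<psi>x z) + q0 z * Re (\<psi>y z) + g0 z * Re (\<psi> z)) = 0"
      using eq2[OF tf] exterior_rep_integral(1)[OF rep] by simp
  qed
  note I = ints[OF t]
  note r = real[OF t] and r' = real[OF C1_test_rotate[OF t]]
  note I' = ints[OF C1_test_rotate[OF t]]
  have "(LBINT z. of_real (u0 z) * \<psi>x z + of_real (p0 z) * \<psi> z) = 0"
    by (rule complex_integral_zero)
       (use I r(1) r'(1) Rei[OF I(1)] Rei[OF I(4)] Rei[OF I'(1)] Rei[OF I'(4)] in \<open>simp_all\<close>)
  then show ?A using I by (simp add: eq_neg_iff_add_eq_0)
  have "(LBINT z. of_real (u0 z) * \<psi>y z + of_real (q0 z) * \<psi> z) = 0"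
    by (rule complex_integral_zero)
       (use I r(2) r'(2) Rei[OF I(2)] Rei[OF I(6)] Rei[OF I'(2)] Rei[OF I'(6)] in \<open>simp_all\<close>)
  then show ?B using I by (simp add: eq_neg_iff_add_eq_0)
  show ?C
  proof (rule complex_integral_zero)
    show "integrable lborel (\<lambda>z. of_real (p0 z) * \<psi>x z + of_real (q0 z) * \<psi>y z + of_real (g0 z) * \<psi> z)"
      by (intro Bochner_Integration.integrable_add I)
    show "(LBINT z. Re (of_real (p0 z) * \<psi>x z + of_real (q0 z) * \<psi>y z + of_real (g0 z) * \<psi> z)) = 0"
      using r(3) by simp
    show "(LBINT z. Re (- \<i> * (of_real (p0 z) * \<psi>x z + of_real (q0 z) * \<psi>y z + of_real (g0 z) * \<psi> z))) = 0"
      using r'(3) by (simp add: algebra_simps)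
  qed
qed

lemma complex_gradient_continuous:
  assumes "continuous_on {x. 1 < norm x} Du"
  shows "continuous_on {z. 1 < norm z} (complex_gradient Du)"
  unfolding complex_gradient_def[abs_def]
  by (intro continuous_intros ext_fun_continuous assms)

lemma norm_complex_gradient:
  assumes "1 < norm z" shows "norm (complex_gradient Du z) = norm (Du (of_complex z))"
  using assms by (simp add: complex_gradient_def ext_fun_def cmod_def norm_vec_def L2_set_def sum_2)

text \<open>Write f = p - i q. Then f (\<psi>x + i \<psi>y) is p \<psi>x + q \<psi>y plus i times p
  \<psi>y - q \<psi>x. The first part is governed by the second-order equation; the second
  integrates to 0 because a weak gradient is curl free. The other identity is f = u_x - i u_y in
  weak form.\<close>

lemma complex_gradient_equation:
  fixes u :: "real^2 \<Rightarrow> real" and Du W :: "real^2 \<Rightarrow> real^2"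
  assumes sol: "weak_drift_solution {x. 1 < norm x} W u Du"
    and Duc: "continuous_on {x. 1 < norm x} Du"
    and u0: "exterior_rep u u0" and g0: "exterior_rep (\<lambda>x. W x \<bullet> Du x) g0"
    and t: "C1_test {z. 1 < norm z} \<psi> \<psi>x \<psi>y"
  shows "(LBINT z. complex_gradient Du z * (\<psi>x z + \<i> * \<psi>y z)) = - (LBINT z. of_real (g0 z) * \<psi> z)"
    "(LBINT z. complex_gradient Du z * \<psi> z) = - (LBINT z. of_real (u0 z) * (\<psi>x z - \<i> * \<psi>y z))"
proof -
  let ?U = "{z::complex. 1 < norm z}"
  let ?p = "\<lambda>z. of_real (ext_fun (\<lambda>x. Du x $ 1) z) :: complex" and ?q = "\<lambda>z. of_real (ext_fun (\<lambda>x. Du x $ 2) z) :: complex"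
  let ?u = "\<lambda>z. of_real (u0 z) :: complex" and ?g = "\<lambda>z. of_real (g0 z) :: complex"
  note E = complex_weak_equations[OF sol Duc u0 g0]
  have lu: "locally_integrable {x. 1 < norm x} u" and lg: "locally_integrable {x. 1 < norm x} (\<lambda>x. W x \<bullet> Du x)"
    using sol unfolding weak_drift_solution_def weak_gradient_def by auto
  have pq: "continuous_on ?U ?p" "continuous_on ?U ?q"
    by (intro ext_fun_continuous continuous_intros Duc)+
  obtain Q where Q: "compact Q" "Q \<subseteq> ?U" "\<And>z. z \<notin> Q \<Longrightarrow> \<psi> z = 0" and C: "C1_partials \<psi> \<psi>x \<psi>y"
    using t unfolding C1_test_def by auto
  note D = C1_partialsD[OF C]
  note Z = C1_partials_zero_outside[OF C compact_imp_closed[OF Q(1)] Q(3)]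
  note c = integrable_cutoff[OF open_exterior _ _ Q(1,2)]
  have i: "integrable lborel (\<lambda>z. ?p z * \<psi> z)" "integrable lborel (\<lambda>z. ?q z * \<psi> z)"
    "integrable lborel (\<lambda>z. ?p z * \<psi>x z)" "integrable lborel (\<lambda>z. ?p z * \<psi>y z)"
    "integrable lborel (\<lambda>z. ?q z * \<psi>x z)" "integrable lborel (\<lambda>z. ?q z * \<psi>y z)"
    using c[OF pq(1) D(4) Q(3)] c[OF pq(2) D(4) Q(3)] c[OF pq(1) D(2) Z(1)] c[OF pq(1) D(3) Z(2)]
      c[OF pq(2) D(2) Z(1)] c[OF pq(2) D(3) Z(2)] by auto
  have iu: "integrable lborel (\<lambda>z. ?u z * \<psi>x z)" "integrable lborel (\<lambda>z. ?u z * \<psi>y z)"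
    using exterior_rep_locally_integrable[OF u0 lu Q(1,2) D(2) Z(1)] exterior_rep_locally_integrable[OF u0 lu Q(1,2) D(3) Z(2)] by auto
  have ig: "integrable lborel (\<lambda>z. ?g z * \<psi> z)"
    by (rule exterior_rep_locally_integrable[OF g0 lg Q(1,2) D(4) Q(3)])
  have curl: "(LBINT z. ?p z * \<psi>y z) = (LBINT z. ?q z * \<psi>x z)"
    by (rule weak_gradient_curl_free[OF open_exterior E(1) E(2) pq t])
  have div: "(LBINT z. ?p z * \<psi>x z) + (LBINT z. ?q z * \<psi>y z) + (LBINT z. ?g z * \<psi> z) = 0"
    using E(3)[OF t] i ig by simp
  have "(\<lambda>z. complex_gradient Du z * (\<psi>x z + \<i> * \<psi>y z)) = (\<lambda>z. (?p z * \<psi>x z + ?q z * \<psi>y z) + \<i> * (?p z * \<psi>y z - ?q z * \<psi>x z))"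
    by (simp add: fun_eq_iff complex_gradient_def algebra_simps)
  then have "(LBINT z. complex_gradient Du z * (\<psi>x z + \<i> * \<psi>y z))
    = ((LBINT z. ?p z * \<psi>x z) + (LBINT z. ?q z * \<psi>y z)) + \<i> * ((LBINT z. ?p z * \<psi>y z) - (LBINT z. ?q z * \<psi>x z))"
    using i by simp
  then show "(LBINT z. complex_gradient Du z * (\<psi>x z + \<i> * \<psi>y z)) = - (LBINT z. of_real (g0 z) * \<psi> z)"
    using curl div by (simp add: eq_neg_iff_add_eq_0)
  have "(\<lambda>z. complex_gradient Du z * \<psi> z) = (\<lambda>z. ?p z * \<psi> z - \<i> * (?q z * \<psi> z))"
    by (simp add: fun_eq_iff complex_gradient_def algebra_simps)
  then have 1: "(LBINT z. complex_gradient Du z * \<psi> z) = (LBINT z. ?p z * \<psi> z) - \<i> * (LBINT z. ?q z * \<psi> z)"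
    using i by simp
  have "(\<lambda>z. ?u z * (\<psi>x z - \<i> * \<psi>y z)) = (\<lambda>z. ?u z * \<psi>x z - \<i> * (?u z * \<psi>y z))"
    by (simp add: fun_eq_iff algebra_simps)
  then have 2: "(LBINT z. ?u z * (\<psi>x z - \<i> * \<psi>y z)) = (LBINT z. ?u z * \<psi>x z) - \<i> * (LBINT z. ?u z * \<psi>y z)"
    using iu by simp
  show "(LBINT z. complex_gradient Du z * \<psi> z) = - (LBINT z. of_real (u0 z) * (\<psi>x z - \<i> * \<psi>y z))"
    unfolding 1 2 E(1)[OF t] E(2)[OF t] by simp
qed

section \<open>The lower bound\<close>

text \<open>For infinite p one has |a| \<le> 1 almost everywhere and the excess is 0, so any
  exponent above 2 would do and 3 is a choice. For finite p the integrand is at most |W|^p.\<close>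

lemma unit_excess_of_Lp_norm:
  fixes p :: ereal and W :: "real^2 \<Rightarrow> real^2" and a :: "complex \<Rightarrow> complex"
  assumes p: "2 < p" and Wp: "Lp_norm p (lebesgue_on (- ball 0 1)) W \<le> 1"
    and am: "a \<in> borel_measurable borel" and a0: "\<And>z. norm z \<le> 1 \<Longrightarrow> a z = 0"
    and aW: "AE x in lebesgue. 1 < norm x \<longrightarrow> norm (a (to_complex x)) \<le> norm (W x) / 2"
  shows "unit_excess (if p = \<infinity> then 3 else real_of_ereal p) a \<le> 1"
proof -
  define q where "q = (if p = \<infinity> then 3 else real_of_ereal p)"
  note [measurable] = am
  define G where "G z = indicator {z. 1 < norm (a z)} z * ennreal (norm (a z) powr q)" for z
  have Gm[measurable]: "G \<in> borel_measurable borel" unfolding G_def by measurable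
  let ?S = "- ball 0 1 :: (real^2) set"
  have S: "?S \<inter> space lebesgue \<in> sets lebesgue" by (simp add: borel_open sets_completionI_sets)
  have "unit_excess q a = (\<integral>\<^sup>+z. G z \<partial>distr lborel borel to_complex)"
    by (simp add: unit_excess_def G_def distr_to_complex)
  also have "\<dots> = (\<integral>\<^sup>+x. G (to_complex x) \<partial>lborel)" by (subst nn_integral_distr) auto
  also have "\<dots> = (\<integral>\<^sup>+x. G (to_complex x) \<partial>lebesgue)" by (simp add: nn_integral_completion)
  finally have eq: "unit_excess q a = (\<integral>\<^sup>+x. G (to_complex x) \<partial>lebesgue)" .
  have "unit_excess q a \<le> 1"
  proof (cases "p = \<infinity>")
    case True
    then have "esssup (lebesgue_on ?S) (\<lambda>x. ereal (norm (W x))) \<le> 1" using Wp by (simp add: Lp_norm_def)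
    then have "AE x in lebesgue_on ?S. ereal (norm (W x)) \<le> 1"
      by (intro eventually_mono[OF esssup_AE[of "\<lambda>x. ereal (norm (W x))" "lebesgue_on ?S"]]) (rule order_trans)
    then have "AE x in lebesgue. x \<in> ?S \<longrightarrow> norm (W x) \<le> 1"
      using AE_restrict_space_iff[OF S, of "\<lambda>x. ereal (norm (W x)) \<le> 1"] by simp
    with aW have "AE x in lebesgue. G (to_complex x) = 0"
    proof eventually_elim
      case (elim x)
      have "norm (a (to_complex x)) \<le> 1"
        using elim a0[of "to_complex x"] by (cases "1 < norm x") auto
      then show ?case by (simp add: G_def)
    qed
    then have "(\<integral>\<^sup>+x. G (to_complex x) \<partial>lebesgue) = (\<integral>\<^sup>+(x::real^2). 0 \<partial>lebesgue)" by (rule nn_integral_cong_AE)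
    then show ?thesis using eq by simp
  next
    case False
    then obtain r where r: "p = ereal r" using p by (cases p) auto
    then have q: "q = r" "2 < r" using p by (auto simp: q_def)
    define I where "I = (\<integral>\<^sup>+x. ennreal (norm (W x) powr r) \<partial>lebesgue_on ?S)"
    have "Lp_norm p (lebesgue_on ?S) W = (if I = \<infinity> then \<infinity> else ereal (enn2real I powr (1 / r)))"
      by (auto simp: r Lp_norm_def I_def Let_def)
    then have "(if I = \<infinity> then \<infinity> else ereal (enn2real I powr (1 / r))) \<le> 1"
      using Wp by (simp only:)
    then have If: "I \<noteq> \<infinity>" and Ip: "enn2real I powr (1 / r) \<le> 1" by (auto split: if_splits)
    have "enn2real I \<le> 1"
    proof (rule ccontr)
      assume "\<not> enn2real I \<le> 1"
      then have "1 powr (1 / r) < enn2real I powr (1 / r)" using q by (intro powr_less_mono2) auto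
      then show False using Ip by simp
    qed
    then have "I \<le> 1"
    proof -
      have "I = ennreal (enn2real I)" using If by (simp add: ennreal_enn2real_if)
      also have "\<dots> \<le> 1" using ennreal_leI[OF \<open>enn2real I \<le> 1\<close>] by simp
      finally show ?thesis .
    qed
    have "(\<integral>\<^sup>+x. G (to_complex x) \<partial>lebesgue) \<le> (\<integral>\<^sup>+x. ennreal (norm (W x) powr r) * indicator ?S x \<partial>lebesgue)"
    proof (rule nn_integral_mono_AE)
      show "AE x in lebesgue. G (to_complex x) \<le> ennreal (norm (W x) powr r) * indicator ?S x"
        using aW
      proof eventually_elim
        case (elim x)
        show ?case
        proof (cases "1 < norm (a (to_complex x))")
          case True
          then have x: "1 < norm x" using a0[of "to_complex x"] by (cases "1 < norm x") auto
          then have "norm (a (to_complex x)) \<le> norm (W x)" using elim norm_ge_zero[of "W x"] by linarith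
          then have "norm (a (to_complex x)) powr r \<le> norm (W x) powr r"
            using q by (intro powr_mono2) auto
          then show ?thesis using x True q by (simp add: G_def ennreal_leI)
        qed (simp add: G_def)
      qed
    qed
    also have "\<dots> = I" unfolding I_def by (rule nn_integral_restrict_space[OF S, symmetric])
    finally show ?thesis using eq \<open>I \<le> 1\<close> by simp
  qed
  then show ?thesis by (simp add: q_def)
qed

text \<open>By continuity the set where the bound fails is open, and an open null set is
  empty.\<close>

lemma gradient_le_one:
  fixes Du :: "real^2 \<Rightarrow> real^2"
  assumes c: "continuous_on {x. 1 < norm x} Du"
    and n: "Lp_norm \<infinity> (lebesgue_on (- ball 0 1)) Du \<le> 1" and x: "1 < norm x"
  shows "norm (Du x) \<le> 1"
proof (rule ccontr)
  let ?S = "- ball 0 1 :: (real^2) set"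
  have S: "?S \<inter> space lebesgue \<in> sets lebesgue" by (simp add: borel_open sets_completionI_sets)
  have "esssup (lebesgue_on ?S) (\<lambda>x. ereal (norm (Du x))) \<le> 1" using n by (simp add: Lp_norm_def)
  then have "AE x in lebesgue_on ?S. ereal (norm (Du x)) \<le> 1"
    by (intro eventually_mono[OF esssup_AE[of "\<lambda>x. ereal (norm (Du x))" "lebesgue_on ?S"]]) (rule order_trans)
  then have ae: "AE x in lebesgue. x \<in> ?S \<longrightarrow> norm (Du x) \<le> 1"
    using AE_restrict_space_iff[OF S, of "\<lambda>x. ereal (norm (Du x)) \<le> 1"] by simp
  define A where "A = {x. 1 < norm x} \<inter> (\<lambda>x. norm (Du x)) -` {1<..}"
  have "open A"
    unfolding A_def by (intro continuous_open_preimage continuous_on_norm c open_exterior) auto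
  moreover have "AE x\<in>A in lebesgue. x \<in> ({} :: (real^2) set)"
    using ae by eventually_elim (auto simp: A_def)
  moreover assume "\<not> norm (Du x) \<le> 1"
  then have "x \<in> A" using x by (simp add: A_def)
  ultimately show False using mem_closed_if_AE_lebesgue_open[of A "{}" x] by auto
qed

text \<open>Turns a solution into the hypotheses of \<open>complex_landis_bound\<close>. The
  coefficient is a = (W \<bullet> Du) / (2 f), and |f| = |Du| gives |a| \<le> |W| / 2 by
  Cauchy-Schwarz. \<open>T\<close> stands for any positive bound of |u| on the unit ball around
  x0.\<close>

lemma solution_lower_bound:
  fixes p :: ereal and q C0 :: real and u :: "real^2 \<Rightarrow> real" and Du W :: "real^2 \<Rightarrow> real^2"
  assumes p: "2 < p" and R: "8 \<le> R" and x0: "norm x0 = R"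
    and Wp: "Lp_norm p (lebesgue_on (- ball 0 1)) W \<le> 1"
    and Wm: "W \<in> borel_measurable (lebesgue_on (- ball 0 1))"
    and sol: "weak_drift_solution {x. 1 < norm x} W u Du"
    and Duc: "continuous_on {x. 1 < norm x} Du"
    and T: "0 < T" "\<And>x. x \<in> ball x0 1 \<Longrightarrow> \<bar>u x\<bar> \<le> T"
  defines "D \<equiv> {z::complex. 1 < norm z \<and> norm z < 20 * R}" and "f \<equiv> complex_gradient Du"
  shows "\<exists>a. a \<in> borel_measurable borel \<and> (\<forall>z. norm z < 20 * R \<or> a z = 0) \<and>
     unit_excess (if p = \<infinity> then 3 else real_of_ereal p) a \<le> 1 \<and> weak_dbar_eq f a D \<and>
     gradient_bound f T (ball (to_complex x0) 1)"
proof -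
  let ?\<Omega> = "{x::real^2. 1 < norm x}"
  have "W \<in> borel_measurable (lebesgue_on ?\<Omega>)"
    by (rule measurable_restrict_mono[OF Wm]) auto
  moreover have "Du \<in> borel_measurable (lebesgue_on ?\<Omega>)"
    by (rule continuous_imp_measurable_on_sets_lebesgue[OF Duc exterior_lebesgue])
  ultimately have "(\<lambda>x. W x \<bullet> Du x) \<in> borel_measurable (lebesgue_on ?\<Omega>)" by (rule borel_measurable_inner)
  then obtain g1 where g1: "exterior_rep (\<lambda>x. W x \<bullet> Du x) g1" using exterior_rep_exists by blast
  have "locally_integrable ?\<Omega> u" using sol by (simp add: weak_drift_solution_def weak_gradient_def)
  then obtain u0 where u0: "exterior_rep u u0" using exterior_rep_exists locally_integrable_measurable by blast
  have [measurable]: "(\<lambda>z. ext_fun (\<lambda>x. Du x $ 1) z) \<in> borel_measurable borel" "(\<lambda>z. ext_fun (\<lambda>x. Du x $ 2) z) \<in> borel_measurable borel"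
    using exterior_rep_continuous[of "\<lambda>x. Du x $ 1"] exterior_rep_continuous[of "\<lambda>x. Du x $ 2"] Duc
    by (auto simp: exterior_rep_def ext_fun_def[abs_def] intro!: continuous_intros)
  have fm[measurable]: "f \<in> borel_measurable borel"
    unfolding f_def complex_gradient_def[abs_def] by measurable
  have nf: "norm (f (to_complex x)) = norm (Du x)" if "1 < norm x" for x
    using norm_complex_gradient[of "to_complex x" Du] that by (simp add: f_def)
  \<comment> \<open>W \<bullet> Du vanishes where Du does, so the representative may be set to 0
    there. Then 2 a f = g0 holds at every point of D, zeros of f included, and not merely almost
    everywhere.\<close>
  define g0 where "g0 z = (if f z = 0 then 0 else g1 z)" for z
  have g1m[measurable]: "g1 \<in> borel_measurable borel" using g1 by (simp add: exterior_rep_def)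
  have g0: "exterior_rep (\<lambda>x. W x \<bullet> Du x) g0"
    unfolding exterior_rep_def
  proof (intro conjI)
    show "g0 \<in> borel_measurable borel" unfolding g0_def by measurable
    have "AE x in lebesgue. 1 < norm x \<longrightarrow> W x \<bullet> Du x = g1 (to_complex x)" using g1 by (simp add: exterior_rep_def)
    then show "AE x in lebesgue. 1 < norm x \<longrightarrow> W x \<bullet> Du x = g0 (to_complex x)"
    proof eventually_elim
      case (elim x)
      then show ?case using nf[of x] by (auto simp: g0_def)
    qed
  qed (use g1 in \<open>auto simp: exterior_rep_def g0_def\<close>)
  then have g0m[measurable]: "g0 \<in> borel_measurable borel" by (simp add: exterior_rep_def)
  \<comment> \<open>Cut off to D so that the potential is an integral over a bounded set. Division
    by zero returns 0 at the zeros of f.\<close>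
  define a where "a z = (if z \<in> D then of_real (g0 z) / (2 * f z) else 0)" for z
  have am: "a \<in> borel_measurable borel" unfolding a_def D_def mem_Collect_eq by measurable
  have af: "2 * a z * f z = of_real (g0 z)" if "z \<in> D" for z
    using that by (simp add: a_def g0_def)
  have "AE x in lebesgue. 1 < norm x \<longrightarrow> W x \<bullet> Du x = g0 (to_complex x)" using g0 by (simp add: exterior_rep_def)
  then have aW: "AE x in lebesgue. 1 < norm x \<longrightarrow> norm (a (to_complex x)) \<le> norm (W x) / 2"
  proof eventually_elim
    case (elim x)
    show ?case
    proof (intro impI)
      assume x: "1 < norm x"
      show "norm (a (to_complex x)) \<le> norm (W x) / 2"
      proof (cases "to_complex x \<in> D \<and> Du x \<noteq> 0")
        case True
        have "norm (a (to_complex x)) = \<bar>W x \<bullet> Du x\<bar> / (2 * norm (Du x))"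
          using True elim x nf[OF x] by (simp add: a_def norm_divide norm_mult)
        also have "\<dots> \<le> norm (W x) * norm (Du x) / (2 * norm (Du x))"
          by (intro divide_right_mono Cauchy_Schwarz_ineq2) auto
        finally show ?thesis using True by simp
      next
        case False
        then have "a (to_complex x) = 0" using nf[OF x] by (auto simp: a_def)
        then show ?thesis by simp
      qed
    qed
  qed
  have ex: "unit_excess (if p = \<infinity> then 3 else real_of_ereal p) a \<le> 1"
    by (rule unit_excess_of_Lp_norm[OF p Wp am _ aW]) (simp add: a_def D_def)
  note E = complex_gradient_equation[OF sol Duc u0 g0, folded f_def]
  have mono: "C1_test {z. 1 < norm z} \<psi> \<psi>x \<psi>y" if "C1_test V \<psi> \<psi>x \<psi>y" "V \<subseteq> {z. 1 < norm z}" for V \<psi> \<psi>x \<psi>y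
    using that unfolding C1_test_def by blast
  have weak: "weak_dbar_eq f a D"
    unfolding weak_dbar_eq_def
  proof (intro allI impI)
    fix \<psi> \<psi>x \<psi>y assume t: "C1_test D \<psi> \<psi>x \<psi>y"
    have "(\<lambda>z. of_real (g0 z) * \<psi> z) = (\<lambda>z. 2 * a z * f z * \<psi> z)"
    proof
      fix z show "of_real (g0 z) * \<psi> z = 2 * a z * f z * \<psi> z"
      proof (cases "z \<in> D")
        case True then show ?thesis by (simp only: af)
      next
        case False
        then have "\<psi> z = 0" using t unfolding C1_test_def by blast
        then show ?thesis by simp
      qed
    qed
    then show "(LBINT z. f z * (\<psi>x z + \<i> * \<psi>y z)) = - (LBINT z. 2 * a z * f z * \<psi> z)"
      using E(1)[OF mono[OF t]] by (auto simp: D_def)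
  qed
  have "gradient_bound f T (ball (to_complex x0) 1)"
    unfolding gradient_bound_def
  proof (intro allI impI)
    fix \<psi> \<psi>x \<psi>y assume t: "C1_test (ball (to_complex x0) 1) \<psi> \<psi>x \<psi>y"
    have far: "1 < norm z" if "z \<in> ball (to_complex x0) 1" for z
      using norm_triangle_ineq2[of "to_complex x0" "to_complex x0 - z"] that x0 R by (auto simp: dist_norm)
    have tU: "C1_test {z. 1 < norm z} \<psi> \<psi>x \<psi>y" by (rule mono[OF t]) (use far in auto)
    obtain Q where Q: "compact Q" "Q \<subseteq> ball (to_complex x0) 1" "\<And>z. z \<notin> Q \<Longrightarrow> \<psi> z = 0" and C: "C1_partials \<psi> \<psi>x \<psi>y"
      using t unfolding C1_test_def by auto
    have QU: "Q \<subseteq> {z. 1 < norm z}" using Q(2) far by auto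
    note C' = C1_partialsD[OF C]
    note Z = C1_partials_zero_outside[OF C compact_imp_closed[OF Q(1)] Q(3)]
    have lu: "locally_integrable ?\<Omega> u" by fact
    have i: "integrable lborel (\<lambda>z. of_real (u0 z) * (\<psi>x z - \<i> * \<psi>y z))"
      by (rule exterior_rep_locally_integrable[OF u0 lu Q(1) QU]) (use Z in \<open>auto intro!: continuous_intros C'\<close>)
    have ib: "integrable lborel (\<lambda>z. T * (norm (\<psi>x z) + norm (\<psi>y z)))"
      by (intro integrable_mult_right Bochner_Integration.integrable_add integrable_norm
            integrable_continuous_compact[OF _ Q(1)] C' Z)
    have [measurable]: "u0 \<in> borel_measurable borel" using u0 by (simp add: exterior_rep_def)
    have "AE x in lebesgue. 1 < norm x \<longrightarrow> u x = u0 (to_complex x)" using u0 by (simp add: exterior_rep_def)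
    then have "AE x in lebesgue. dist (to_complex x0) (to_complex x) < 1 \<longrightarrow> \<bar>u0 (to_complex x)\<bar> \<le> T"
    proof eventually_elim
      case (elim x)
      show ?case
      proof
        assume d: "dist (to_complex x0) (to_complex x) < 1"
        have "to_complex x0 - to_complex x = to_complex (x0 - x)"
          by (simp add: to_complex_def complex_eq_iff)
        then have "x \<in> ball x0 1" using d by (simp add: dist_norm)
        then have "\<bar>u x\<bar> \<le> T" by (rule T(2))
        moreover have "1 < norm x" using far[of "to_complex x"] d by simp
        ultimately show "\<bar>u0 (to_complex x)\<bar> \<le> T" using elim by simp
      qed
    qed
    then have ae: "AE z in lborel. dist (to_complex x0) z < 1 \<longrightarrow> \<bar>u0 z\<bar> \<le> T"
      by (rule AE_to_complex[rotated]) measurable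
    have "norm (LBINT z. f z * \<psi> z) = norm (LBINT z. of_real (u0 z) * (\<psi>x z - \<i> * \<psi>y z))"
      unfolding E(2)[OF tU] by simp
    also have "\<dots> \<le> (LBINT z. norm (of_real (u0 z) * (\<psi>x z - \<i> * \<psi>y z)))"
      by (rule integral_norm_bound)
    also have "\<dots> \<le> (LBINT z. T * (norm (\<psi>x z) + norm (\<psi>y z)))"
    proof (rule integral_mono_AE[OF integrable_norm[OF i] ib])
      show "AE z in lborel. norm (of_real (u0 z) * (\<psi>x z - \<i> * \<psi>y z)) \<le> T * (norm (\<psi>x z) + norm (\<psi>y z))"
        using ae
      proof eventually_elim
        case (elim z)
        show ?case
        proof (cases "z \<in> Q")
          case True
          then have "\<bar>u0 z\<bar> \<le> T" using elim Q(2) by auto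
          moreover have "norm (\<psi>x z - \<i> * \<psi>y z) \<le> norm (\<psi>x z) + norm (\<psi>y z)"
            using norm_triangle_ineq4[of "\<psi>x z" "\<i> * \<psi>y z"] by (simp add: norm_mult)
          ultimately show ?thesis unfolding norm_mult norm_of_real using T(1) by (intro mult_mono) auto
        next
          case False then show ?thesis using Z T(1) by simp
        qed
      qed
    qed
    finally show "norm (LBINT z. f z * \<psi> z) \<le> T * (LBINT z. norm (\<psi>x z) + norm (\<psi>y z))" by simp
  qed
  moreover have "\<forall>z. norm z < 20 * R \<or> a z = 0" by (auto simp: a_def D_def)
  ultimately show ?thesis using am ex weak by blast
qed

theorem corollary1p1:
  fixes p :: ereal and C0 :: real
  assumes "2 < p" and "0 < C0"
  shows "\<exists>C1>0. \<exists>C2>0. \<exists>R0::real.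
    \<forall>(u :: real^2 \<Rightarrow> real) (Du :: real^2 \<Rightarrow> real^2) (W :: real^2 \<Rightarrow> real^2).
      W \<in> borel_measurable (lebesgue_on (- ball 0 1)) \<and>
      Lp_norm p (lebesgue_on (- ball 0 1)) W \<le> 1 \<and>
      weak_drift_solution (interior (- ball 0 1)) W u Du \<and>
      continuous_on (interior (- ball 0 1)) Du \<and>
      Lp_norm \<infinity> (lebesgue_on (- ball 0 1)) Du \<le> 1 \<and>
      C0 \<le> (INF z0\<in>sphere 0 3. norm (Du z0))
      \<longrightarrow> (\<forall>R\<ge>R0. ereal (C2 * exp (- C1 * R * (ln R)\<^sup>2))
              \<le> (INF z0\<in>sphere 0 R. SUP z\<in>ball z0 1. ereal \<bar>u z\<bar>))"
proof -
  define q where "q = (if p = \<infinity> then 3 else real_of_ereal p)"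
  have q: "2 < q" using assms(1) by (cases p) (auto simp: q_def)
  obtain C R0 where C: "0 < C" and R0: "8 \<le> R0" and "\<forall>R\<ge>R0. \<forall>f a z0 M.
      norm z0 = R \<longrightarrow> continuous_on {z. 1 < norm z \<and> norm z < 20 * R} f \<longrightarrow>
      (\<forall>z. 1 < norm z \<longrightarrow> norm z < 20 * R \<longrightarrow> norm (f z) \<le> 1) \<longrightarrow>
      C0 \<le> norm (f (of_real (3 / R) * z0)) \<longrightarrow>
      a \<in> borel_measurable borel \<longrightarrow> (\<forall>z. norm z < 20 * R \<or> a z = 0) \<longrightarrow> unit_excess q a \<le> 1 \<longrightarrow>
      weak_dbar_eq f a {z. 1 < norm z \<and> norm z < 20 * R} \<longrightarrow>
      gradient_bound f M (ball z0 1) \<longrightarrow> 0 < M \<longrightarrow> exp (- C * R * (ln R)\<^sup>2) \<le> M"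
    using complex_landis_bound[OF q assms(2)] by (elim exE conjE)
  note bound = this(3)[rule_format]
  show ?thesis
  \<comment> \<open>The complex bound gives the inequality with the constant C. Raising it to C + 1
    makes T strictly smaller than that bound, so the negated claim is contradictory and the front
    factor can be 1.\<close>
  proof (rule exI[of _ "C + 1"], rule conjI[OF add_pos_pos[OF C zero_less_one]],
      rule exI[of _ "1::real"], rule conjI[OF zero_less_one], rule exI[of _ R0], intro allI impI)
    fix u :: "real^2 \<Rightarrow> real" and Du W :: "real^2 \<Rightarrow> real^2" and R :: real
    assume "W \<in> borel_measurable (lebesgue_on (- ball 0 1)) \<and>
      Lp_norm p (lebesgue_on (- ball 0 1)) W \<le> 1 \<and>
      weak_drift_solution (interior (- ball 0 1)) W u Du \<and>
      continuous_on (interior (- ball 0 1)) Du \<and>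
      Lp_norm \<infinity> (lebesgue_on (- ball 0 1)) Du \<le> 1 \<and>
      C0 \<le> (INF z0\<in>sphere 0 3. norm (Du z0))"
    then have W: "W \<in> borel_measurable (lebesgue_on (- ball 0 1))" "Lp_norm p (lebesgue_on (- ball 0 1)) W \<le> 1"
      and sol: "weak_drift_solution {x. 1 < norm x} W u Du" and Duc: "continuous_on {x. 1 < norm x} Du"
      and Du1: "Lp_norm \<infinity> (lebesgue_on (- ball 0 1)) Du \<le> 1"
      and Du3: "C0 \<le> (INF z0\<in>sphere 0 3. norm (Du z0))"
      by (simp_all add: exterior_eq)
    assume "R0 \<le> R"
    then have R: "8 \<le> R" using R0 by simp
    \<comment> \<open>Under the negated claim T bounds |u| on the ball. It replaces the supremum,
      which might be 0, while \<open>bound\<close> asks for a positive M.\<close>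
    define T where "T = exp (- (C + 1) * R * (ln R)\<^sup>2)"
    show "ereal (1 * exp (- (C + 1) * R * (ln R)\<^sup>2)) \<le> (INF z0\<in>sphere 0 R. SUP z\<in>ball z0 1. ereal \<bar>u z\<bar>)"
    proof (rule INF_greatest, rule ccontr)
      fix x0 :: "real^2" assume x0: "x0 \<in> sphere 0 R"
      assume "\<not> ereal (1 * exp (- (C + 1) * R * (ln R)\<^sup>2)) \<le> (SUP z\<in>ball x0 1. ereal \<bar>u z\<bar>)"
      then have less: "(SUP z\<in>ball x0 1. ereal \<bar>u z\<bar>) < ereal T" by (simp add: T_def not_le)
      have uT: "\<bar>u x\<bar> \<le> T" if "x \<in> ball x0 1" for x
        using le_less_trans[OF SUP_upper[OF that, of "\<lambda>z. ereal \<bar>u z\<bar>"] less] by simp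
      have T0: "0 < T" by (simp add: T_def)
      have nx0: "norm x0 = R" using x0 by simp
      define f where "f = complex_gradient Du"
      have "\<exists>a. a \<in> borel_measurable borel \<and> (\<forall>z. norm z < 20 * R \<or> a z = 0) \<and>
         unit_excess q a \<le> 1 \<and> weak_dbar_eq f a {z. 1 < norm z \<and> norm z < 20 * R} \<and>
         gradient_bound f T (ball (to_complex x0) 1)"
        unfolding q_def f_def
        by (rule solution_lower_bound[OF assms(1) R nx0 W(2,1) sol Duc T0]) (rule uT)
      then obtain a where a: "a \<in> borel_measurable borel" "\<forall>z. norm z < 20 * R \<or> a z = 0" "unit_excess q a \<le> 1"
        "weak_dbar_eq f a {z. 1 < norm z \<and> norm z < 20 * R}" "gradient_bound f T (ball (to_complex x0) 1)"
        by (elim exE conjE)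
      have "exp (- C * R * (ln R)\<^sup>2) \<le> T"
      proof (rule bound[OF \<open>R0 \<le> R\<close> _ _ _ _ a(1) a(2)[rule_format] a(3-5) T0])
        show "norm (to_complex x0) = R" by (simp add: nx0)
        show "continuous_on {z. 1 < norm z \<and> norm z < 20 * R} f"
          unfolding f_def by (rule continuous_on_subset[OF complex_gradient_continuous[OF Duc]]) auto
        show "norm (f z) \<le> 1" if "1 < norm z" "norm z < 20 * R" for z
          unfolding f_def norm_complex_gradient[OF that(1)] by (rule gradient_le_one[OF Duc Du1]) (use that in simp)
        have n3: "norm (of_real (3 / R) * to_complex x0) = 3" using R nx0 by (simp add: norm_mult norm_divide)
        have "C0 \<le> (INF z0\<in>sphere 0 3. norm (Du z0))" by (rule Du3)
        also have "\<dots> \<le> norm (Du (of_complex (of_real (3 / R) * to_complex x0)))"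
          by (rule cINF_lower) (use n3 in \<open>auto intro: bdd_belowI2[of _ 0]\<close>)
        also have "\<dots> = norm (f (of_real (3 / R) * to_complex x0))"
        proof -
          have "1 < norm (of_real (3 / R) * to_complex x0)" unfolding n3 by simp
          then show ?thesis unfolding f_def by (rule norm_complex_gradient[symmetric])
        qed
        finally show "C0 \<le> norm (f (of_real (3 / R) * to_complex x0))" .
      qed
      moreover have "T < exp (- C * R * (ln R)\<^sup>2)"
      proof -
        have "0 < ln R" using R by simp
        then have "0 < R * (ln R)\<^sup>2" using R by simp
        then show ?thesis by (simp add: T_def algebra_simps)
      qed
      ultimately show False by simp
    qed
  qed
qed

end
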